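(* There is an absolute constant $C>0$ such that for every integer $N\ge1$ and every $\beta>0$: (i) for every $u\in L^2(\mathbb{R})$, $\|u-\widehat{\Pi}_N^\beta u\|\le C\,E_N^\beta(u)$; (ii) for every $u\in H^1(\mathbb{R})$, $\|\partial_x(u-\widehat{\Pi}_N^\beta u)\|\le C\bigl(E_N^\beta(\partial_xu)+\beta\sqrt N\,E_N^\beta(u)\bigr)$; (iii) for every $u\in H^2(\mathbb{R})$, $\|\partial_x^2(u-\widehat{\Pi}_N^\beta u)\|\le C\bigl(E_N^\beta(\partial_x^2u)+\beta\,E_N^\beta(\partial_xu)+\beta^2N\,E_N^\beta(u)\bigr)$.
   Context: $\|\cdot\|$ is the $L^2(\mathbb{R})$ norm, $\mathbb{I}_A$ the indicator function of $A$, and $\mathcal{F}[u](k)=\frac{1}{\sqrt{2\pi}}\int u(x)e^{-ikx}dx$ the Fourier transform. For $\beta>0$, $\widehat{P}_N^\beta=\{e^{-\beta^2x^2/2}\psi(x):\ \psi\text{ a polynomial of degree}\le N\}$ and $\widehat{\Pi}_N^\beta$ is the $L^2$-orthogonal projection onto $\widehat{P}_N^\beta$. For $w\in L^2(\mathbb{R})$ define $E_{s,N}^\beta(w)=\|w\cdot\mathbb{I}_{\{|x|>\frac{1}{2\sqrt2}\sqrt N/\beta\}}\|$, $E_{f,N}^\beta(w)=\|\mathcal{F}[w](k)\cdot\mathbb{I}_{\{|k|>\frac{1}{2\sqrt2}\sqrt N\beta\}}\|$, $E_{h,N}(w)=\|w\|e^{-N/16}$, and $E_N^\beta(w)=E_{s,N}^\beta(w)+E_{f,N}^\beta(w)+E_{h,N}(w)$.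 *)

theory Defs
  imports "HOL-Analysis.Analysis" "HOL-Computational_Algebra.Polynomial"
begin

definition in_L2 :: "(real \<Rightarrow> complex) \<Rightarrow> bool" where
  "in_L2 u \<longleftrightarrow> u \<in> borel_measurable lborel \<and> integrable lborel (\<lambda>x. (cmod (u x))^2)"

definition L2norm :: "(real \<Rightarrow> complex) \<Rightarrow> real" where
  "L2norm u = sqrt (LINT x|lborel. (cmod (u x))^2)"

definition L2inner :: "(real \<Rightarrow> complex) \<Rightarrow> (real \<Rightarrow> complex) \<Rightarrow> complex" where
  "L2inner u v = (LINT x|lborel. u x * cnj (v x))"

definition Pspace :: "real \<Rightarrow> nat \<Rightarrow> (real \<Rightarrow> complex) set" where
  "Pspace \<beta> N = {(\<lambda>x. complex_of_real (exp (- (\<beta>^2 * x^2) / 2)) * poly p (complex_of_real x)) |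
                   p :: complex poly. degree p \<le> N}"

definition proj :: "real \<Rightarrow> nat \<Rightarrow> (real \<Rightarrow> complex) \<Rightarrow> (real \<Rightarrow> complex)" where
  "proj \<beta> N u = (THE v. v \<in> Pspace \<beta> N \<and>
                     (\<forall>p\<in>Pspace \<beta> N. L2inner (\<lambda>x. u x - v x) p = 0))"

text \<open>Truncated Fourier integral; the L^2 Fourier transform is its L^2 limit (Plancherel).\<close>

definition FT_trunc :: "real \<Rightarrow> (real \<Rightarrow> complex) \<Rightarrow> real \<Rightarrow> complex" where
  "FT_trunc R u k = complex_of_real (1 / sqrt (2 * pi)) *
      (LINT x:{-R..R}|lborel. u x * cis (- (k * x)))"

definition E_s :: "real \<Rightarrow> nat \<Rightarrow> (real \<Rightarrow> complex) \<Rightarrow> real" where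
  "E_s \<beta> N w = L2norm (\<lambda>x. indicator {x. \<bar>x\<bar> > sqrt (real N) / (2 * sqrt 2 * \<beta>)} x * w x)"

definition E_f :: "real \<Rightarrow> nat \<Rightarrow> (real \<Rightarrow> complex) \<Rightarrow> real" where
  "E_f \<beta> N w = lim (\<lambda>n::nat.
      L2norm (\<lambda>k. indicator {k. \<bar>k\<bar> > sqrt (real N) * \<beta> / (2 * sqrt 2)} k * FT_trunc (real n) w k))"

definition E_h :: "nat \<Rightarrow> (real \<Rightarrow> complex) \<Rightarrow> real" where
  "E_h N w = L2norm w * exp (- real N / 16)"

definition E_N :: "real \<Rightarrow> nat \<Rightarrow> (real \<Rightarrow> complex) \<Rightarrow> real" where
  "E_N \<beta> N w = E_s \<beta> N w + E_f \<beta> N w + E_h N w"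

definition test_fn :: "(real \<Rightarrow> real) \<Rightarrow> bool" where
  "test_fn \<phi> \<longleftrightarrow> (\<forall>k x. ((deriv ^^ k) \<phi>) differentiable (at x)) \<and>
                   (\<exists>R. \<forall>x. R < \<bar>x\<bar> \<longrightarrow> \<phi> x = 0)"

definition weak_deriv :: "(real \<Rightarrow> complex) \<Rightarrow> (real \<Rightarrow> complex) \<Rightarrow> bool" where
  "weak_deriv u v \<longleftrightarrow> (\<forall>\<phi>. test_fn \<phi> \<longrightarrow>
      (LINT x|lborel. u x * complex_of_real (deriv \<phi> x)) =
      - (LINT x|lborel. v x * complex_of_real (\<phi> x)))"

end

(*
  By duality the projection error is controlled by the inner products of u with functions v orthogonal
  to the Hermite functions of index below N - 1.  Split u = (1 - m) u + m u, where m is the indicator of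
  |x| <= 2M mollified by a Gaussian, M being the spatial threshold in E_s.  Then 1 - m = O(exp(-N/16)) on
  |x| <= M, so (1 - m) u is paid for by E_s and E_h.  For m u use Plancherel: frequencies beyond the
  threshold in E_f are paid for by E_f, and at the remaining frequencies the Fourier transform of m v is a
  mixture of inner products of v with Gaussian wave packets whose squared Hermite coefficients are Poisson
  weights of mean at most 5N/16.  Orthogonality of v leaves only the Poisson tail beyond N - 1, and
  Chernoff's bound beats exp(-N/16).
  For derivatives, d/dx acts on Hermite coefficients by a two-term ladder, so its commutator with the
  projection telescopes to the modes N - 1, ..., N + 2, whose coefficients obey the same bound.
*)

theory Submission
  imports Defs "HOL-Probability.Probability"
begin

subsection \<open>Square-integrable functions\<close>

text \<open>In units where \<beta> = 1 both thresholds equal r = sqrt(N/8), and a wave packet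
  centred at position q and frequency k has Poisson mean (q^2 + k^2)/2. The window reaches out to 2r
  so that its edge keeps a distance r from the inner region: the Gaussian tail there is of order
  exp(-r^2/2) = exp(-N/16), the rate in \<open>E_h\<close>. The rectangle |q| <= 2r, |k| <= r then
  has largest mean 5 r^2 / 2, which is 5N/16. Since 5/16 + 1/8 < ln 2, the tail exp(5N/16) / 2^N
  beats exp(-N/8) with room to absorb the powers of N that come from the lengths of window and band.
  The packets have the width 1/\<beta> of the lowest Hermite function; this is what makes their
  coefficients Poissonian. The threshold N - 1, instead of N + 1, is dictated by the derivative
  estimates, which use the duality bound with v a single Hermite function of index down to N - 1. As
  \<open>E_f\<close> is a limit of truncated transforms, Plancherel is proved for functions that are
  both integrable and square-integrable, and only the final duality bound is extended by
  truncation.\<close>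

lemma integrable_dominated:
  fixes f :: "'a \<Rightarrow> real" and g :: "'a \<Rightarrow> 'b::{banach, second_countable_topology}"
  assumes "integrable M f" "\<And>x. norm (g x) \<le> f x" "g \<in> borel_measurable M"
  shows "integrable M g"
  using assms(1,3) by (rule Bochner_Integration.integrable_bound)
    (auto intro: order_trans[OF assms(2) abs_ge_self])

lemma borel_measurable_cnj [measurable (raw)]:
  "f \<in> borel_measurable M \<Longrightarrow> (\<lambda>x. cnj (f x)) \<in> borel_measurable M"
  by (rule measurable_compose[OF _ borel_measurable_continuous_onI]) (auto intro: continuous_intros)

lemma in_L2_measurable [measurable_dest]: "in_L2 u \<Longrightarrow> u \<in> borel_measurable borel"
  by (simp add: in_L2_def)

lemma in_L2_integrable: "in_L2 u \<Longrightarrow> integrable lborel (\<lambda>x. (cmod (u x))\<^sup>2)"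
  by (simp add: in_L2_def)

lemma L2norm_nonneg [simp]: "0 \<le> L2norm u"
  by (simp add: L2norm_def)

lemma L2norm_power2: "(L2norm u)\<^sup>2 = (LINT x|lborel. (cmod (u x))\<^sup>2)"
  by (simp add: L2norm_def)

lemma in_L2_dominated:
  assumes "in_L2 u" and [measurable]: "v \<in> borel_measurable borel"
    and "\<And>x. cmod (v x) \<le> C * cmod (u x)"
  shows "in_L2 v"
proof -
  have "integrable lborel (\<lambda>x. C\<^sup>2 * (cmod (u x))\<^sup>2)"
    using assms(1) by (simp add: in_L2_def)
  moreover have "(cmod (v x))\<^sup>2 \<le> C\<^sup>2 * (cmod (u x))\<^sup>2" for x
    using power_mono[OF assms(3), of x 2] by (simp add: power_mult_distrib)
  ultimately have "integrable lborel (\<lambda>x. (cmod (v x))\<^sup>2)"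
    by - (rule integrable_dominated, assumption, auto)
  then show ?thesis by (simp add: in_L2_def)
qed

lemma in_L2_cmult [simp]: "in_L2 u \<Longrightarrow> in_L2 (\<lambda>x. c * u x)"
  by (rule in_L2_dominated[where C = "cmod c" and u = u]) (auto simp: norm_mult dest: in_L2_measurable)

lemma in_L2_zero [simp]: "in_L2 (\<lambda>x. 0)"
  by (simp add: in_L2_def)

lemma in_L2_add:
  assumes "in_L2 u" "in_L2 v"
  shows "in_L2 (\<lambda>x. u x + v x)"
proof -
  note [measurable] = in_L2_measurable[OF assms(1)] in_L2_measurable[OF assms(2)]
  have "integrable lborel (\<lambda>x. 2 * (cmod (u x))\<^sup>2 + 2 * (cmod (v x))\<^sup>2)"
    using assms by (simp add: in_L2_def)
  moreover have "(cmod (u x + v x))\<^sup>2 \<le> 2 * (cmod (u x))\<^sup>2 + 2 * (cmod (v x))\<^sup>2" for x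
  proof -
    have "(cmod (u x + v x))\<^sup>2 \<le> (cmod (u x) + cmod (v x))\<^sup>2"
      by (intro power_mono norm_triangle_ineq) auto
    also have "\<dots> \<le> 2 * (cmod (u x))\<^sup>2 + 2 * (cmod (v x))\<^sup>2"
      using sum_squares_bound[of "cmod (u x)" "cmod (v x)"] by (simp add: power2_sum)
    finally show ?thesis .
  qed
  ultimately have "integrable lborel (\<lambda>x. (cmod (u x + v x))\<^sup>2)"
    by - (rule integrable_dominated, assumption, auto)
  then show ?thesis by (simp add: in_L2_def)
qed

lemma in_L2_diff:
  assumes "in_L2 u" "in_L2 v"
  shows "in_L2 (\<lambda>x. u x - v x)"
  using in_L2_add[OF assms(1) in_L2_cmult[OF assms(2), of "-1"]] by simp

lemma in_L2_sum: "(\<And>i. i \<in> A \<Longrightarrow> in_L2 (f i)) \<Longrightarrow> in_L2 (\<lambda>x. \<Sum>i\<in>A. f i x)"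
  by (induction A rule: infinite_finite_induct) (auto intro: in_L2_add)

lemma in_L2_indicator_mult:
  assumes "in_L2 u" "A \<in> sets borel"
  shows "in_L2 (\<lambda>x. indicator A x * u x)"
  by (rule in_L2_dominated[OF assms(1), where C = 1])
     (use assms in \<open>auto split: split_indicator dest: in_L2_measurable\<close>)

lemma in_L2_integrable_norm_mult:
  assumes "in_L2 u" "in_L2 v"
  shows "integrable lborel (\<lambda>x. cmod (u x) * cmod (v x))"
proof -
  note [measurable] = in_L2_measurable[OF assms(1)] in_L2_measurable[OF assms(2)]
  have "integrable lborel (\<lambda>x. (cmod (u x))\<^sup>2 + (cmod (v x))\<^sup>2)"
    using assms by (simp add: in_L2_def)
  moreover have "cmod (u x) * cmod (v x) \<le> (cmod (u x))\<^sup>2 + (cmod (v x))\<^sup>2" for x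
    using sum_squares_bound[of "cmod (u x)" "cmod (v x)"]
      mult_nonneg_nonneg[OF norm_ge_zero[of "u x"] norm_ge_zero[of "v x"]] by linarith
  ultimately show ?thesis
    by - (rule integrable_dominated, assumption, auto)
qed

lemma in_L2_integrable_mult:
  assumes "in_L2 u" "in_L2 v"
  shows "integrable lborel (\<lambda>x. u x * v x)"
proof -
  note [measurable] = in_L2_measurable[OF assms(1)] in_L2_measurable[OF assms(2)]
  show ?thesis
    by (rule integrable_dominated[OF in_L2_integrable_norm_mult[OF assms]])
       (auto simp: norm_mult)
qed

lemma in_L2_cnj: "in_L2 u \<Longrightarrow> in_L2 (\<lambda>x. cnj (u x))"
  by (rule in_L2_dominated[where C = 1 and u = u])
     (auto dest: in_L2_measurable)

lemma in_L2_integrable_inner: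
  assumes "in_L2 u" "in_L2 v"
  shows "integrable lborel (\<lambda>x. u x * cnj (v x))"
  using in_L2_integrable_mult[OF assms(1) in_L2_cnj[OF assms(2)]] .

text \<open>The pointwise inequality 2ab <= t a^2 + b^2/t is integrated and t > 0 is then optimised.
  Having the moduli inside the integral is what the triangle inequality and the Fubini arguments
  use.\<close>

lemma Cauchy_Schwarz_L2_norm:
  assumes "in_L2 u" "in_L2 v"
  shows "(LINT x|lborel. cmod (u x) * cmod (v x)) \<le> L2norm u * L2norm v"
proof -
  define P where "P = (LINT x|lborel. cmod (u x) * cmod (v x))"
  define a b where "a = L2norm u" and "b = L2norm v"
  have ab: "a \<ge> 0" "b \<ge> 0" by (auto simp: a_def b_def)
  have key: "2 * P \<le> t * a\<^sup>2 + b\<^sup>2 / t" if "t > 0" for t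
  proof -
    have "2 * P = (LINT x|lborel. 2 * (cmod (u x) * cmod (v x)))"
      by (simp add: P_def)
    also have "\<dots> \<le> (LINT x|lborel. t * (cmod (u x))\<^sup>2 + (cmod (v x))\<^sup>2 / t)"
    proof (rule integral_mono)
      fix x
      have "0 \<le> (t * cmod (u x) - cmod (v x))\<^sup>2 / t" using that by simp
      also have "\<dots> = t * (cmod (u x))\<^sup>2 + (cmod (v x))\<^sup>2 / t - 2 * (cmod (u x) * cmod (v x))"
        using that by (simp add: power2_eq_square field_simps)
      finally show "2 * (cmod (u x) * cmod (v x)) \<le> t * (cmod (u x))\<^sup>2 + (cmod (v x))\<^sup>2 / t" by simp
    qed (use assms in \<open>auto intro!: in_L2_integrable_norm_mult in_L2_integrable\<close>)
    also have "\<dots> = t * a\<^sup>2 + b\<^sup>2 / t"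
      using assms by (simp add: in_L2_def L2norm_power2 a_def b_def)
    finally show ?thesis .
  qed
  \<comment> \<open>The optimal weight b/a may be 0 or undefined, so both norms are shifted by d,
    chosen so small that the loss d(a + b) is at most e.\<close>
  have "P \<le> a * b + e" if "e > 0" for e
  proof -
    define d where "d = e / (a + b + 1)"
    have d: "d > 0" using that ab by (simp add: d_def)
    have "2 * P \<le> (b + d) / (a + d) * a\<^sup>2 + b\<^sup>2 / ((b + d) / (a + d))"
      using d ab by (intro key) auto
    also have "(b + d) / (a + d) * a\<^sup>2 \<le> (b + d) * a"
      using d ab by (simp add: power2_eq_square field_simps)
    also have "b\<^sup>2 / ((b + d) / (a + d)) \<le> (a + d) * b"
      using d ab by (simp add: power2_eq_square field_simps)
    also have "(b + d) * a + (a + d) * b = 2 * (a * b) + d * (a + b)"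
      by (simp add: algebra_simps)
    also have "d * (a + b) \<le> e"
      using that ab by (simp add: d_def field_simps)
    finally show ?thesis using that by linarith
  qed
  then show ?thesis unfolding P_def a_def b_def by (rule field_le_epsilon)
qed

lemma Cauchy_Schwarz_L2:
  assumes "in_L2 u" "in_L2 v"
  shows "cmod (L2inner u v) \<le> L2norm u * L2norm v"
proof -
  have "cmod (L2inner u v) \<le> (LINT x|lborel. cmod (u x * cnj (v x)))"
    unfolding L2inner_def by (rule integral_norm_bound)
  then show ?thesis using Cauchy_Schwarz_L2_norm[OF assms] by (simp add: norm_mult)
qed

lemma L2norm_mono:
  assumes "in_L2 v" "u \<in> borel_measurable borel" "\<And>x. cmod (u x) \<le> cmod (v x)"
  shows "L2norm u \<le> L2norm v"
  unfolding L2norm_def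
  using in_L2_dominated[OF assms(1,2), of 1] assms
  by (auto intro!: integral_mono power_mono simp: in_L2_def)

lemma L2norm_cmult: "L2norm (\<lambda>x. c * u x) = cmod c * L2norm u"
  by (simp add: L2norm_def norm_mult power_mult_distrib real_sqrt_mult)

lemma L2norm_triangle:
  assumes "in_L2 u" "in_L2 v"
  shows "L2norm (\<lambda>x. u x + v x) \<le> L2norm u + L2norm v"
proof (rule power2_le_imp_le)
  have "(L2norm (\<lambda>x. u x + v x))\<^sup>2 \<le>
     (LINT x|lborel. (cmod (u x))\<^sup>2 + (cmod (v x))\<^sup>2 + 2 * (cmod (u x) * cmod (v x)))"
    unfolding L2norm_power2
  proof (rule integral_mono)
    fix x
    show "(cmod (u x + v x))\<^sup>2 \<le> (cmod (u x))\<^sup>2 + (cmod (v x))\<^sup>2 + 2 * (cmod (u x) * cmod (v x))"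
      using power_mono[OF norm_triangle_ineq[of "u x" "v x"], of 2] by (simp add: power2_sum)
  qed (use assms in_L2_add[OF assms] in \<open>auto intro!: in_L2_integrable_norm_mult in_L2_integrable\<close>)
  also have "\<dots> = (L2norm u)\<^sup>2 + (L2norm v)\<^sup>2 + 2 * (LINT x|lborel. cmod (u x) * cmod (v x))"
    using assms in_L2_integrable_norm_mult[OF assms] by (simp add: in_L2_def L2norm_power2)
  also have "\<dots> \<le> (L2norm u + L2norm v)\<^sup>2"
    using Cauchy_Schwarz_L2_norm[OF assms] by (simp add: power2_sum)
  finally show "(L2norm (\<lambda>x. u x + v x))\<^sup>2 \<le> (L2norm u + L2norm v)\<^sup>2" .
qed simp

lemma L2norm_diff_triangle:
  assumes "in_L2 u" "in_L2 v"
  shows "L2norm (\<lambda>x. u x - v x) \<le> L2norm u + L2norm v"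
  using L2norm_triangle[OF assms(1) in_L2_cmult[OF assms(2), of "-1"]] L2norm_cmult[of "-1" v] by simp

lemma L2norm_triangle_diff:
  assumes "in_L2 u" "in_L2 v"
  shows "\<bar>L2norm u - L2norm v\<bar> \<le> L2norm (\<lambda>x. u x - v x)"
  using L2norm_triangle[OF in_L2_diff[OF assms] assms(2)]
    L2norm_triangle[OF in_L2_diff[OF assms(2,1)] assms(1)]
    L2norm_cmult[of "-1" "\<lambda>x. u x - v x"] by simp

lemma L2inner_diff_left: 
  assumes "in_L2 u" "in_L2 v" "in_L2 w"
  shows "L2inner (\<lambda>x. u x - v x) w = L2inner u w - L2inner v w"
  using assms by (simp add: L2inner_def left_diff_distrib in_L2_integrable_inner)

lemma L2inner_cnj: "cnj (L2inner u v) = L2inner v u"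
  unfolding L2inner_def by (subst Bochner_Integration.integral_cnj[symmetric]) (simp add: mult.commute)

lemma L2inner_sum_left: 
  assumes "\<And>i. i \<in> A \<Longrightarrow> in_L2 (f i)" "in_L2 w"
  shows "L2inner (\<lambda>x. \<Sum>i\<in>A. c i * f i x) w = (\<Sum>i\<in>A. c i * L2inner (f i) w)"
  unfolding L2inner_def sum_distrib_right
  by (subst Bochner_Integration.integral_sum)
     (use assms in \<open>auto simp: mult.assoc intro!: in_L2_integrable_inner\<close>)

lemma L2inner_sum_right: 
  assumes "\<And>i. i \<in> A \<Longrightarrow> in_L2 (f i)" "in_L2 w"
  shows "L2inner w (\<lambda>x. \<Sum>i\<in>A. c i * f i x) = (\<Sum>i\<in>A. cnj (c i) * L2inner w (f i))"
  using arg_cong[OF L2inner_sum_left[OF assms, where c = c], where f = cnj] by (simp add: L2inner_cnj)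

lemma L2inner_self: "L2inner u u = complex_of_real ((L2norm u)\<^sup>2)"
  unfolding L2inner_def L2norm_power2
  by (subst integral_complex_of_real[symmetric]) (simp add: complex_norm_square[symmetric])

subsection \<open>Continuity of translations in the mean\<close>

lemma integrable_translate:
  fixes f :: "real \<Rightarrow> 'a::{banach, second_countable_topology}"
  shows "integrable lborel f \<Longrightarrow> integrable lborel (\<lambda>x. f (x - t))"
  using lborel_integrable_real_affine[of f 1 "- t"] by simp

lemma integral_translate:
  fixes f :: "real \<Rightarrow> 'a::{banach, second_countable_topology}"
  shows "(LINT x|lborel. f (x - t)) = (LINT x|lborel. f x)"
  using lborel_integral_real_affine[of 1 f "- t"] by simp

lemma integral_reflect:
  fixes f :: "real \<Rightarrow> 'a::{banach, second_countable_topology}"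
  shows "(LINT x|lborel. f (c - x)) = (LINT x|lborel. f x)"
  using lborel_integral_real_affine[of "-1" f c] by simp

lemma integrable_reflect:
  fixes f :: "real \<Rightarrow> 'a::{banach, second_countable_topology}"
  shows "integrable lborel f \<Longrightarrow> integrable lborel (\<lambda>x. f (c - x))"
  using lborel_integrable_real_affine[of f "-1" c] by simp

text \<open>Continuity at shift 0 is phrased along sequences to fit dominated convergence.
  Integrability is included so that an approximating function brings it along.\<close>

definition translation_cont_L1 :: "(real \<Rightarrow> real) \<Rightarrow> bool" where
  "translation_cont_L1 f \<longleftrightarrow> integrable lborel f \<and>
     (\<forall>t::nat \<Rightarrow> real. t \<longlonglongrightarrow> 0 \<longrightarrow> (\<lambda>n. LINT x|lborel. \<bar>f (x - t n) - f x\<bar>) \<longlonglongrightarrow> 0)"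

text \<open>The property is closed under L^1 limits: translation preserves the L^1 distance to the
  approximant, so three terms of size r/4 suffice.\<close>

lemma translation_cont_L1_approx:
  assumes f: "integrable lborel f"
    and "\<And>e. e > 0 \<Longrightarrow> \<exists>g. translation_cont_L1 g \<and> (LINT x|lborel. \<bar>f x - g x\<bar>) \<le> e"
  shows "translation_cont_L1 f"
  unfolding translation_cont_L1_def
proof (intro conjI allI impI)
  fix t :: "nat \<Rightarrow> real" assume t: "t \<longlonglongrightarrow> 0"
  show "(\<lambda>n. LINT x|lborel. \<bar>f (x - t n) - f x\<bar>) \<longlonglongrightarrow> 0"
  proof (rule LIMSEQ_I)
    fix r :: real assume r: "r > 0"
    obtain g where g: "translation_cont_L1 g" "(LINT x|lborel. \<bar>f x - g x\<bar>) \<le> r / 4"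
      using assms(2)[of "r / 4"] r by auto
    have gi: "integrable lborel g" using g by (simp add: translation_cont_L1_def)
    have "(\<lambda>n. LINT x|lborel. \<bar>g (x - t n) - g x\<bar>) \<longlonglongrightarrow> 0"
      using g t by (simp add: translation_cont_L1_def)
    from LIMSEQ_D[OF this, of "r / 4"] r obtain n0 where
      n0: "\<And>n. n \<ge> n0 \<Longrightarrow> \<bar>LINT x|lborel. \<bar>g (x - t n) - g x\<bar>\<bar> < r / 4" by auto
    have "\<bar>LINT x|lborel. \<bar>f (x - t n) - f x\<bar>\<bar> < r" if "n \<ge> n0" for n
    proof -
      note int = f gi integrable_translate[OF f, of "t n"] integrable_translate[OF gi, of "t n"]
      have "(LINT x|lborel. \<bar>f (x - t n) - f x\<bar>) \<le> 
         (LINT x|lborel. \<bar>f (x - t n) - g (x - t n)\<bar> + \<bar>g (x - t n) - g x\<bar> + \<bar>f x - g x\<bar>)"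
        using int by (intro integral_mono) auto
      also have "\<dots> = (LINT x|lborel. \<bar>f (x - t n) - g (x - t n)\<bar>) + 
          (LINT x|lborel. \<bar>g (x - t n) - g x\<bar>) + (LINT x|lborel. \<bar>f x - g x\<bar>)"
        using int by simp
      also have "(LINT x|lborel. \<bar>f (x - t n) - g (x - t n)\<bar>) = (LINT x|lborel. \<bar>f x - g x\<bar>)"
        by (rule integral_translate[of "\<lambda>x. \<bar>f x - g x\<bar>"])
      finally show ?thesis using g(2) n0[OF that] r by (auto simp: abs_less_iff)
    qed
    then show "\<exists>no. \<forall>n\<ge>no. norm ((LINT x|lborel. \<bar>f (x - t n) - f x\<bar>) - 0) < r" by auto
  qed
qed (rule f)

text \<open>The L^1 distance is twice the measure of U minus twice that of the overlap of U with its
  translate. For the overlap, points of U stay in U under small shifts, and outside U the product is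
  0, so boundary points need no attention.\<close>

lemma translation_cont_L1_open:
  assumes U: "open U" "emeasure lborel U < \<infinity>"
  shows "translation_cont_L1 (indicator U)"
  unfolding translation_cont_L1_def
proof (intro conjI allI impI)
  have [measurable]: "U \<in> sets borel" using U by auto
  show int: "integrable lborel (indicator U :: real \<Rightarrow> real)"
    using U by (intro integrable_real_indicator) auto
  fix t :: "nat \<Rightarrow> real" assume t: "t \<longlonglongrightarrow> 0"
  let ?I = "indicator U :: real \<Rightarrow> real"
  have intp: "integrable lborel (\<lambda>x. ?I x * ?I (x - s))" for s
    by (rule integrable_dominated[OF int]) (auto split: split_indicator)
  have eq: "(LINT x|lborel. \<bar>?I (x - s) - ?I x\<bar>) = 2 * (LINT x|lborel. ?I x) - 2 * (LINT x|lborel. ?I x * ?I (x - s))" for s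
  proof -
    have "(LINT x|lborel. \<bar>?I (x - s) - ?I x\<bar>) = (LINT x|lborel. ?I (x - s) + ?I x - 2 * (?I x * ?I (x - s)))"
      by (intro Bochner_Integration.integral_cong) (auto split: split_indicator)
    also have "\<dots> = (LINT x|lborel. ?I (x - s)) + (LINT x|lborel. ?I x) - 2 * (LINT x|lborel. ?I x * ?I (x - s))"
      using integrable_translate[OF int, of s] int intp[of s] by (simp only: Bochner_Integration.integral_diff Bochner_Integration.integral_add Bochner_Integration.integrable_add integrable_mult_right integral_mult_right_zero)
    also have "(LINT x|lborel. ?I (x - s)) = (LINT x|lborel. ?I x)"
      by (rule integral_translate)
    finally show ?thesis by simp
  qed
  have "(\<lambda>n. LINT x|lborel. ?I x * ?I (x - t n)) \<longlonglongrightarrow> (LINT x|lborel. ?I x)"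
  proof (rule integral_dominated_convergence[where w = ?I])
    show "AE x in lborel. (\<lambda>n. ?I x * ?I (x - t n)) \<longlonglongrightarrow> ?I x"
    proof (rule AE_I2)
      fix x :: real
      show "(\<lambda>n. ?I x * ?I (x - t n)) \<longlonglongrightarrow> ?I x"
      proof (cases "x \<in> U")
        case True
        have "(\<lambda>n. x - t n) \<longlonglongrightarrow> x - 0" by (intro tendsto_intros t)
        then have "\<forall>\<^sub>F n in sequentially. x - t n \<in> U"
          using topological_tendstoD[OF _ U(1)] True by fastforce
        then show ?thesis
          by (intro tendsto_eventually) (auto elim!: eventually_mono simp: True)
      qed simp
    qed
  qed (use int in \<open>auto split: split_indicator\<close>)
  then have "(\<lambda>n. 2 * (LINT x|lborel. ?I x) - 2 * (LINT x|lborel. ?I x * ?I (x - t n))) \<longlonglongrightarrow>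
     2 * (LINT x|lborel. ?I x) - 2 * (LINT x|lborel. ?I x)"
    by (intro tendsto_intros)
  then show "(\<lambda>n. LINT x|lborel. \<bar>?I (x - t n) - ?I x\<bar>) \<longlonglongrightarrow> 0"
    unfolding eq by simp
qed

text \<open>Outer regularity supplies an open superset of finite measure that is close in
  L^1.\<close>

lemma translation_cont_L1_indicator:
  assumes [measurable]: "A \<in> sets borel" and A: "emeasure lborel A < \<infinity>"
  shows "translation_cont_L1 (indicator A)"
proof (rule translation_cont_L1_approx)
  show int: "integrable lborel (indicator A :: real \<Rightarrow> real)"
    using A by (intro integrable_real_indicator) auto
  fix e :: real assume e: "e > 0"
  obtain U where U: "open U" "A \<subseteq> U" "emeasure lborel (U - A) < e"
    using outer_regular_lborel[OF assms(1) e] by auto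
  have [measurable]: "U \<in> sets borel" using U by auto
  have "emeasure lborel U \<le> emeasure lborel A + emeasure lborel (U - A)"
    using U(2) by (subst plus_emeasure) (auto simp: Un_absorb1)
  also have "\<dots> < \<infinity>" using A U(3) by (simp add: ennreal_add_eq_top less_top top.not_eq_extremum order.strict_trans[of _ "ennreal e"])
  finally have fin: "emeasure lborel U < \<infinity>" .
  have "(LINT x|lborel. \<bar>indicator A x - indicator U x :: real\<bar>) = (LINT x|lborel. indicator (U - A) x)"
    using U(2) by (intro Bochner_Integration.integral_cong) (auto split: split_indicator)
  also have "\<dots> = measure lborel (U - A)" by simp
  also have "\<dots> \<le> e"
    using U(3) e by (auto simp: measure_def intro: enn2real_leI)
  finally show "\<exists>g. translation_cont_L1 g \<and> (LINT x|lborel. \<bar>indicator A x - g x\<bar>) \<le> e"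
    using translation_cont_L1_open[OF U(1) fin] by auto
qed

lemma translation_cont_L1:
  assumes "integrable lborel f"
  shows "translation_cont_L1 f"
  using assms
proof (induction rule: integrable_induct)
  case (base A c)
  have "translation_cont_L1 (indicator A)"
    using base by (intro translation_cont_L1_indicator) auto
  then have int: "integrable lborel (indicator A :: real \<Rightarrow> real)"
    and lim: "\<And>t::nat \<Rightarrow> real. t \<longlonglongrightarrow> 0 \<Longrightarrow> (\<lambda>n. LINT x|lborel. \<bar>indicator A (x - t n) - indicator A x :: real\<bar>) \<longlonglongrightarrow> 0"
    by (simp_all add: translation_cont_L1_def)
  have eq: "(LINT x|lborel. \<bar>indicator A (x - s) *\<^sub>R c - indicator A x *\<^sub>R c\<bar>) = 
     (LINT x|lborel. \<bar>indicator A (x - s) - indicator A x\<bar>) * \<bar>c\<bar>" for s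
    unfolding integral_mult_left_zero[symmetric] by (simp add: abs_mult left_diff_distrib[symmetric])
  show ?case
    unfolding translation_cont_L1_def eq
    using int by (intro conjI allI impI tendsto_mult_left_zero lim) auto
next
  case (add f g)
  show ?case
    unfolding translation_cont_L1_def
  proof (intro conjI allI impI)
    show "integrable lborel (\<lambda>x. f x + g x)" using add by auto
    fix t :: "nat \<Rightarrow> real" assume t: "t \<longlonglongrightarrow> 0"
    have "(\<lambda>n. (LINT x|lborel. \<bar>f (x - t n) - f x\<bar>) + (LINT x|lborel. \<bar>g (x - t n) - g x\<bar>)) \<longlonglongrightarrow> 0 + 0"
      using add t by (intro tendsto_add) (auto simp: translation_cont_L1_def)
    then have lim: "(\<lambda>n. (LINT x|lborel. \<bar>f (x - t n) - f x\<bar>) + (LINT x|lborel. \<bar>g (x - t n) - g x\<bar>)) \<longlonglongrightarrow> 0"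
      by simp
    note int = add(1,2) integrable_translate[OF add(1)] integrable_translate[OF add(2)]
    show "(\<lambda>n. LINT x|lborel. \<bar>f (x - t n) + g (x - t n) - (f x + g x)\<bar>) \<longlonglongrightarrow> 0"
    proof (rule tendsto_sandwich[OF _ _ tendsto_const lim])
      show "\<forall>\<^sub>F n in sequentially. 0 \<le> (LINT x|lborel. \<bar>f (x - t n) + g (x - t n) - (f x + g x)\<bar>)"
        by simp
      have "(LINT x|lborel. \<bar>f (x - t n) + g (x - t n) - (f x + g x)\<bar>) \<le>
         (LINT x|lborel. \<bar>f (x - t n) - f x\<bar> + \<bar>g (x - t n) - g x\<bar>)" for n
        using int by (intro integral_mono) auto
      then show "\<forall>\<^sub>F n in sequentially. (LINT x|lborel. \<bar>f (x - t n) + g (x - t n) - (f x + g x)\<bar>) \<le>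
         (LINT x|lborel. \<bar>f (x - t n) - f x\<bar>) + (LINT x|lborel. \<bar>g (x - t n) - g x\<bar>)"
        using int by simp
    qed
  qed
next
  case (lim f s)
  have conv: "(\<lambda>i. s i x) \<longlonglongrightarrow> f x" and bnd: "norm (s i x) \<le> 2 * norm (f x)"
    and tr: "translation_cont_L1 (s i)" for i x using lim by auto
  have "(\<lambda>i. LINT x|lborel. \<bar>f x - s i x\<bar>) \<longlonglongrightarrow> (LINT x|(lborel::real measure). 0)"
  proof (rule integral_dominated_convergence[where w = "\<lambda>x. 3 * \<bar>f x\<bar>"])
    show "AE x in lborel. (\<lambda>i. \<bar>f x - s i x\<bar>) \<longlonglongrightarrow> 0"
    proof (rule AE_I2)
      fix x
      have "(\<lambda>i. f x - s i x) \<longlonglongrightarrow> f x - f x"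
        by (intro tendsto_diff tendsto_const conv)
      then show "(\<lambda>i. \<bar>f x - s i x\<bar>) \<longlonglongrightarrow> 0" by (simp add: tendsto_rabs_zero)
    qed
    show "AE x in lborel. norm \<bar>f x - s i x\<bar> \<le> 3 * \<bar>f x\<bar>" for i
    proof (rule AE_I2)
      fix x show "norm \<bar>f x - s i x\<bar> \<le> 3 * \<bar>f x\<bar>" using bnd[of i x] by auto
    qed
  qed (use lim in auto)
  then have L: "(\<lambda>i. LINT x|lborel. \<bar>f x - s i x\<bar>) \<longlonglongrightarrow> 0" by simp
  show ?case
  proof (rule translation_cont_L1_approx)
    fix e :: real assume "e > 0"
    from LIMSEQ_D[OF L this] obtain i where "\<bar>LINT x|lborel. \<bar>f x - s i x\<bar>\<bar> < e" by fastforce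
    then show "\<exists>g. translation_cont_L1 g \<and> (LINT x|lborel. \<bar>f x - g x\<bar>) \<le> e"
      using tr by (intro exI[of _ "s i"]) auto
  qed (use lim in auto)
qed

lemma in_L2_translate:
  assumes "in_L2 g" 
  shows "in_L2 (\<lambda>x. g (x - t))" "L2norm (\<lambda>x. g (x - t)) = L2norm g"
proof -
  note [measurable] = in_L2_measurable[OF assms]
  show "in_L2 (\<lambda>x. g (x - t))"
    using integrable_translate[OF in_L2_integrable[OF assms], of t] by (simp add: in_L2_def)
  show "L2norm (\<lambda>x. g (x - t)) = L2norm g"
    unfolding L2norm_def by (subst integral_translate[of "\<lambda>x. (cmod (g x))\<^sup>2"]) simp
qed

text \<open>Reduction to continuity in the mean through \<open>\<bar>a - b\<bar>\<^sup>2 \<le> \<bar>a\<^sup>2 - b\<^sup>2\<bar>\<close>.\<close>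

lemma translation_cont_L2_nonneg:
  assumes f [measurable]: "f \<in> borel_measurable borel" and int: "integrable lborel (\<lambda>x. (f x)\<^sup>2)" 
    and nn: "\<And>x. 0 \<le> f x" and t: "t \<longlonglongrightarrow> (0::real)"
  shows "(\<lambda>n. L2norm (\<lambda>x. complex_of_real (f (x - t n)) - complex_of_real (f x))) \<longlonglongrightarrow> 0"
proof -
  have "(\<lambda>n. LINT x|lborel. \<bar>(f (x - t n))\<^sup>2 - (f x)\<^sup>2\<bar>) \<longlonglongrightarrow> 0"
    using translation_cont_L1[OF int] t by (auto simp: translation_cont_L1_def)
  from tendsto_real_sqrt[OF this]
  have lim: "(\<lambda>n. sqrt (LINT x|lborel. \<bar>(f (x - t n))\<^sup>2 - (f x)\<^sup>2\<bar>)) \<longlonglongrightarrow> 0" by simp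
  have ineq: "(cmod (complex_of_real a - complex_of_real b))\<^sup>2 \<le> \<bar>a\<^sup>2 - b\<^sup>2\<bar>" if "a \<ge> 0" "b \<ge> 0" for a b
  proof -
    have "(cmod (complex_of_real a - complex_of_real b))\<^sup>2 = \<bar>a - b\<bar> * \<bar>a - b\<bar>"
      by (metis norm_of_real of_real_diff power2_eq_square)
    also have "\<dots> \<le> \<bar>a - b\<bar> * \<bar>a + b\<bar>" using that by (intro mult_left_mono) auto
    also have "\<dots> = \<bar>a\<^sup>2 - b\<^sup>2\<bar>" by (simp add: abs_mult[symmetric] power2_eq_square algebra_simps)
    finally show ?thesis .
  qed
  show ?thesis
  proof (rule tendsto_sandwich[OF _ _ tendsto_const lim])
    have "L2norm (\<lambda>x. complex_of_real (f (x - t n)) - complex_of_real (f x)) \<le> sqrt (LINT x|lborel. \<bar>(f (x - t n))\<^sup>2 - (f x)\<^sup>2\<bar>)" for n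
    proof -
      have i: "integrable lborel (\<lambda>x. \<bar>(f (x - t n))\<^sup>2 - (f x)\<^sup>2\<bar>)"
        using int integrable_translate[OF int, of "t n"] by auto
      have "integrable lborel (\<lambda>x. (cmod (complex_of_real (f (x - t n)) - complex_of_real (f x)))\<^sup>2)"
        by (rule integrable_dominated[OF i]) (use ineq nn in auto)
      with i show ?thesis
        unfolding L2norm_def by (intro real_sqrt_le_mono integral_mono) (use ineq nn in auto)
    qed
    then show "\<forall>\<^sub>F n in sequentially. L2norm (\<lambda>x. complex_of_real (f (x - t n)) - complex_of_real (f x)) \<le> sqrt (LINT x|lborel. \<bar>(f (x - t n))\<^sup>2 - (f x)\<^sup>2\<bar>)" by simp
  qed simp
qed

text \<open>The reduction to L^1 requires nonnegative values, so g is split into the positive and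
  negative parts of its real and imaginary parts.\<close>

lemma translation_cont_L2:
  assumes g: "in_L2 g" and t: "t \<longlonglongrightarrow> (0::real)"
  shows "(\<lambda>n. L2norm (\<lambda>x. g (x - t n) - g x)) \<longlonglongrightarrow> 0"
proof -
  note [measurable] = in_L2_measurable[OF g]
  define D where "D = (\<lambda>(f :: real \<Rightarrow> real) n x. complex_of_real (f (x - t n)) - complex_of_real (f x))"
  define a b c d where "a = (\<lambda>x. max 0 (Re (g x)))" and "b = (\<lambda>x. max 0 (- Re (g x)))"
    and "c = (\<lambda>x. max 0 (Im (g x)))" and "d = (\<lambda>x. max 0 (- Im (g x)))"
  have m [measurable]: "a \<in> borel_measurable borel" "b \<in> borel_measurable borel"
    "c \<in> borel_measurable borel" "d \<in> borel_measurable borel"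
    by (simp_all add: a_def b_def c_def d_def)
  have le: "\<bar>a x\<bar> \<le> cmod (g x)" "\<bar>b x\<bar> \<le> cmod (g x)" "\<bar>c x\<bar> \<le> cmod (g x)" "\<bar>d x\<bar> \<le> cmod (g x)" for x
    using abs_Re_le_cmod[of "g x"] abs_Im_le_cmod[of "g x"] by (auto simp: a_def b_def c_def d_def)
  have L2: "in_L2 (\<lambda>x. complex_of_real (a x))" "in_L2 (\<lambda>x. complex_of_real (b x))"
    "in_L2 (\<lambda>x. complex_of_real (c x))" "in_L2 (\<lambda>x. complex_of_real (d x))"
    by (rule in_L2_dominated[OF g, where C = 1]; use le in simp)+
  have lim: "(\<lambda>n. L2norm (D a n)) \<longlonglongrightarrow> 0" "(\<lambda>n. L2norm (D b n)) \<longlonglongrightarrow> 0"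
    "(\<lambda>n. L2norm (D c n)) \<longlonglongrightarrow> 0" "(\<lambda>n. L2norm (D d n)) \<longlonglongrightarrow> 0"
    unfolding D_def using L2
    by (auto intro!: translation_cont_L2_nonneg t simp: in_L2_def simp: a_def b_def c_def d_def)
  have DL2: "in_L2 (D a n)" "in_L2 (D b n)" "in_L2 (D c n)" "in_L2 (D d n)" for n
    unfolding D_def using L2 by (auto intro!: in_L2_diff in_L2_translate)
  have eq: "(\<lambda>x. g (x - t n) - g x) = (\<lambda>x. (D a n x - D b n x) + \<i> * (D c n x - D d n x))" for n
    by (auto simp: fun_eq_iff complex_eq_iff D_def a_def b_def c_def d_def)
  have bd: "L2norm (\<lambda>x. g (x - t n) - g x) \<le> (L2norm (D a n) + L2norm (D b n)) + (L2norm (D c n) + L2norm (D d n))" for n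
  proof -
    have "L2norm (\<lambda>x. g (x - t n) - g x) \<le> L2norm (\<lambda>x. D a n x - D b n x) + L2norm (\<lambda>x. \<i> * (D c n x - D d n x))"
      unfolding eq by (intro L2norm_triangle in_L2_diff in_L2_cmult DL2)
    also have "\<dots> \<le> (L2norm (D a n) + L2norm (D b n)) + (L2norm (D c n) + L2norm (D d n))"
      unfolding L2norm_cmult using DL2 by (auto intro!: add_mono L2norm_diff_triangle)
    finally show ?thesis .
  qed
  have "(\<lambda>n. (L2norm (D a n) + L2norm (D b n)) + (L2norm (D c n) + L2norm (D d n))) \<longlonglongrightarrow> (0 + 0) + (0 + 0)"
    by (intro tendsto_add lim)
  then have upper: "(\<lambda>n. (L2norm (D a n) + L2norm (D b n)) + (L2norm (D c n) + L2norm (D d n))) \<longlonglongrightarrow> 0"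
    by (simp only: add_0_right)
  show ?thesis
    by (rule tendsto_sandwich[OF always_eventually always_eventually tendsto_const upper])
       (simp, intro allI bd)
qed

subsection \<open>Gaussian integrals and Hermite polynomials\<close>

text \<open>Completing the square gives a multiple of the normal density with mean b/(2a) and
  variance 1/(2a).\<close>

lemma real_gauss_integral:
  fixes a b :: real
  assumes a: "a > 0"
  shows "has_bochner_integral lborel (\<lambda>x. exp (- (a * x\<^sup>2) + b * x)) (sqrt (pi / a) * exp (b\<^sup>2 / (4 * a)))"
proof -
  define \<sigma> where "\<sigma> = 1 / sqrt (2 * a)"
  define \<mu> where "\<mu> = b / (2 * a)"
  have \<sigma>: "\<sigma> > 0" "\<sigma>\<^sup>2 = 1 / (2 * a)" using a by (auto simp: \<sigma>_def power_divide)
  have "has_bochner_integral lborel (normal_density \<mu> \<sigma>) 1"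
    using \<sigma> by (auto simp: has_bochner_integral_iff)
  then have "has_bochner_integral lborel (\<lambda>x. sqrt (pi / a) * exp (b\<^sup>2 / (4 * a)) * normal_density \<mu> \<sigma> x)
     (sqrt (pi / a) * exp (b\<^sup>2 / (4 * a)) * 1)"
    by (rule has_bochner_integral_mult_right)
  moreover have "sqrt (pi / a) * exp (b\<^sup>2 / (4 * a)) * normal_density \<mu> \<sigma> x = exp (- (a * x\<^sup>2) + b * x)" for x
  proof -
    have "b\<^sup>2 / (4 * a) + - (x - \<mu>)\<^sup>2 / (2 * \<sigma>\<^sup>2) = - (a * x\<^sup>2) + b * x"
      using a unfolding \<sigma>(2) \<mu>_def by (simp add: field_simps power2_eq_square)
    moreover have "sqrt (pi / a) * (1 / sqrt (2 * pi * \<sigma>\<^sup>2)) = 1"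
      using a unfolding \<sigma>(2) by simp
    moreover have "sqrt (pi / a) * exp (b\<^sup>2 / (4 * a)) * normal_density \<mu> \<sigma> x = 
       (sqrt (pi / a) * (1 / sqrt (2 * pi * \<sigma>\<^sup>2))) * exp (b\<^sup>2 / (4 * a) + - (x - \<mu>)\<^sup>2 / (2 * \<sigma>\<^sup>2))"
      unfolding normal_density_def exp_add by (simp only: mult_ac)
    ultimately show ?thesis by (simp only: mult_1)
  qed
  ultimately show ?thesis by simp
qed

section \<open>Polynomials times Gaussians: integrability, decay and integration by parts\<close>

lemma poly_le_exp_abs:
  fixes p :: "real poly"
  assumes "d > 0"
  shows "\<exists>C\<ge>0. \<forall>x. \<bar>poly p x\<bar> \<le> C * exp (d * \<bar>x\<bar>)"
  using assms
proof (induction p arbitrary: d)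
  case 0
  then show ?case by (auto intro!: exI[of _ 0])
next
  case (pCons c p)
  \<comment> \<open>Half of the exponent is spent on \<open>p\<close> and half on the new factor x,
    which is why \<open>d\<close> varies in the induction.\<close>
  from pCons.IH[of "d / 2"] pCons.prems obtain C where C: "C \<ge> 0" "\<And>x. \<bar>poly p x\<bar> \<le> C * exp (d / 2 * \<bar>x\<bar>)"
    by auto
  have "\<bar>poly (pCons c p) x\<bar> \<le> (\<bar>c\<bar> + 2 * C / d) * exp (d * \<bar>x\<bar>)" for x
  proof -
    have "1 + d / 2 * \<bar>x\<bar> \<le> exp (d / 2 * \<bar>x\<bar>)" by (rule exp_ge_add_one_self)
    then have x: "\<bar>x\<bar> \<le> 2 / d * exp (d / 2 * \<bar>x\<bar>)" using pCons.prems by (simp add: field_simps)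
    have "\<bar>poly (pCons c p) x\<bar> \<le> \<bar>c\<bar> + \<bar>x\<bar> * \<bar>poly p x\<bar>"
      by (simp add: abs_mult order_trans[OF abs_triangle_ineq])
    also have "\<bar>x\<bar> * \<bar>poly p x\<bar> \<le> (2 / d * exp (d / 2 * \<bar>x\<bar>)) * (C * exp (d / 2 * \<bar>x\<bar>))"
      using x C pCons.prems by (intro mult_mono) auto
    also have "\<dots> = 2 * C / d * exp (d * \<bar>x\<bar>)"
      by (simp flip: exp_add add: algebra_simps)
    also have "\<bar>c\<bar> \<le> \<bar>c\<bar> * exp (d * \<bar>x\<bar>)"
      using mult_left_mono[of 1 "exp (d * \<bar>x\<bar>)" "\<bar>c\<bar>"] pCons.prems by simp
    finally show ?thesis by (simp add: algebra_simps)
  qed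
  then show ?case using C pCons.prems by (intro exI[of _ "\<bar>c\<bar> + 2 * C / d"]) auto
qed

text \<open>The complex slope b treats the Gaussian weight (b = 0), Fourier kernels (b imaginary)
  and wave packets (general b) with the same integral formulas.\<close>

definition cgauss :: "real \<Rightarrow> complex \<Rightarrow> real \<Rightarrow> complex" where
  "cgauss a b x = exp (complex_of_real (- (a * x\<^sup>2)) + b * complex_of_real x)"

lemma norm_cgauss: "cmod (cgauss a b x) = exp (- (a * x\<^sup>2) + Re b * x)"
  by (simp add: cgauss_def)

lemma continuous_cgauss [continuous_intros]: "continuous_on A (cgauss a b)"
  unfolding cgauss_def by (intro continuous_intros)

lemma borel_measurable_cgauss [measurable]: "cgauss a b \<in> borel_measurable borel"
  by (intro borel_measurable_continuous_onI continuous_intros)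

lemma borel_measurable_poly [measurable]: "poly (p :: real poly) \<in> borel_measurable borel"
  by (intro borel_measurable_continuous_onI continuous_intros)

text \<open>A polynomial costs a factor exp |x| <= exp x + exp (-x), so the majorant is again a sum
  of real Gaussians, with slopes shifted by 1.\<close>

lemma poly_cgauss_bound:
  assumes "a > 0"
  obtains C where "C \<ge> 0" "\<And>x. cmod (complex_of_real (poly p x) * cgauss a b x) \<le> 
     C * (exp (- (a * x\<^sup>2) + (Re b + 1) * x) + exp (- (a * x\<^sup>2) + (Re b - 1) * x))"
proof -
  obtain C where C: "C \<ge> 0" "\<And>x. \<bar>poly p x\<bar> \<le> C * exp (1 * \<bar>x\<bar>)"
    using poly_le_exp_abs[of 1 p] by auto
  have "cmod (complex_of_real (poly p x) * cgauss a b x) \<le> 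
     C * (exp (- (a * x\<^sup>2) + (Re b + 1) * x) + exp (- (a * x\<^sup>2) + (Re b - 1) * x))" for x
  proof -
    have "exp \<bar>x\<bar> \<le> exp x + exp (- x)" by (cases "x \<ge> 0") auto
    with C(2)[of x] have "\<bar>poly p x\<bar> \<le> C * (exp x + exp (- x))"
      using mult_left_mono[OF _ C(1)] by fastforce
    then have "\<bar>poly p x\<bar> * exp (- (a * x\<^sup>2) + Re b * x) \<le> C * (exp x + exp (- x)) * exp (- (a * x\<^sup>2) + Re b * x)"
      by (intro mult_right_mono) auto
    also have "\<dots> = C * (exp (- (a * x\<^sup>2) + (Re b + 1) * x) + exp (- (a * x\<^sup>2) + (Re b - 1) * x))"
      by (simp add: algebra_simps flip: exp_add)
    finally show ?thesis by (simp add: norm_mult norm_cgauss)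
  qed
  with C(1) show thesis by (rule that)
qed

lemma integrable_poly_cgauss:
  assumes "a > 0"
  shows "integrable lborel (\<lambda>x. complex_of_real (poly p x) * cgauss a b x)"
proof -
  obtain C where C: "\<And>x. cmod (complex_of_real (poly p x) * cgauss a b x) \<le> 
     C * (exp (- (a * x\<^sup>2) + (Re b + 1) * x) + exp (- (a * x\<^sup>2) + (Re b - 1) * x))"
    using poly_cgauss_bound[OF assms, of p b] by metis
  have "integrable lborel (\<lambda>x. C * (exp (- (a * x\<^sup>2) + (Re b + 1) * x) + exp (- (a * x\<^sup>2) + (Re b - 1) * x)))"
    using real_gauss_integral[OF assms, of "Re b + 1"] real_gauss_integral[OF assms, of "Re b - 1"]
    by (auto simp: has_bochner_integral_iff simp del: integrable_mult_left_iff)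
  then show ?thesis
    by (rule integrable_dominated) (use C in auto)
qed

lemma gauss_tendsto_0:
  fixes a c :: real
  assumes "a > 0"
  shows "((\<lambda>x. exp (- (a * x\<^sup>2) + c * x)) \<longlongrightarrow> 0) at_top"
    "((\<lambda>x. exp (- (a * x\<^sup>2) + c * x)) \<longlongrightarrow> 0) at_bot"
  using assms by real_asymp+

lemma poly_cgauss_tendsto_0:
  assumes "a > 0"
  shows "((\<lambda>x. complex_of_real (poly p x) * cgauss a b x) \<longlongrightarrow> 0) at_top"
    "((\<lambda>x. complex_of_real (poly p x) * cgauss a b x) \<longlongrightarrow> 0) at_bot"
proof -
  obtain C where C: "\<And>x. cmod (complex_of_real (poly p x) * cgauss a b x) \<le> 
     C * (exp (- (a * x\<^sup>2) + (Re b + 1) * x) + exp (- (a * x\<^sup>2) + (Re b - 1) * x))"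
    using poly_cgauss_bound[OF assms, of p b] by metis
  have "((\<lambda>x. C * (exp (- (a * x\<^sup>2) + (Re b + 1) * x) + exp (- (a * x\<^sup>2) + (Re b - 1) * x))) \<longlongrightarrow> C * (0 + 0)) at_top"
    by (intro tendsto_intros gauss_tendsto_0 assms)
  then show "((\<lambda>x. complex_of_real (poly p x) * cgauss a b x) \<longlongrightarrow> 0) at_top"
    unfolding add_0_right mult_zero_right by (rule Lim_null_comparison[OF always_eventually[OF allI[OF C]]])
  have "((\<lambda>x. C * (exp (- (a * x\<^sup>2) + (Re b + 1) * x) + exp (- (a * x\<^sup>2) + (Re b - 1) * x))) \<longlongrightarrow> C * (0 + 0)) at_bot"
    by (intro tendsto_intros gauss_tendsto_0 assms)
  then show "((\<lambda>x. complex_of_real (poly p x) * cgauss a b x) \<longlongrightarrow> 0) at_bot"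
    unfolding add_0_right mult_zero_right by (rule Lim_null_comparison[OF always_eventually[OF allI[OF C]]])
qed

text \<open>The product of polynomial and Gaussian vanishes at both ends, so its derivative
  integrates to 0. For a = 1 this says that, under the integral, the operator 2x - d/dx on
  polynomials acts as multiplication by b.\<close>

lemma poly_cgauss_by_parts:
  assumes a: "a > 0"
  shows "(LINT x|lborel. complex_of_real (poly (pderiv p) x) * cgauss a b x) =
    (LINT x|lborel. complex_of_real (poly ([:0, 2 * a:] * p) x) * cgauss a b x)
     - b * (LINT x|lborel. complex_of_real (poly p x) * cgauss a b x)"
proof -
  define F where "F = (\<lambda>x. complex_of_real (poly p x) * cgauss a b x)"
  define f where "f = (\<lambda>x. complex_of_real (poly (pderiv p) x) * cgauss a b x
     - complex_of_real (poly ([:0, 2 * a:] * p) x) * cgauss a b x + b * F x)"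
  have deriv: "(F has_vector_derivative f x) (at x)" for x
  proof -
    have "((\<lambda>z. exp (- (complex_of_real a * z\<^sup>2) + b * z)) has_field_derivative
       exp (- (complex_of_real a * (complex_of_real x)\<^sup>2) + b * complex_of_real x) * (- (complex_of_real a * (2 * complex_of_real x)) + b)) 
       (at (complex_of_real x))"
      by (auto intro!: derivative_eq_intros)
    from has_vector_derivative_real_field[OF this]
    have 1: "(cgauss a b has_vector_derivative cgauss a b x * (b - 2 * a * x)) (at x)"
      by (simp add: cgauss_def[abs_def] algebra_simps)
    have "(poly p has_real_derivative poly (pderiv p) x) (at x)"
      by (rule poly_DERIV)
    then have 2: "((\<lambda>x. complex_of_real (poly p x)) has_vector_derivative complex_of_real (poly (pderiv p) x)) (at x)"
      by (intro has_vector_derivative_of_real) (simp add: has_real_derivative_iff_has_vector_derivative)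
    show ?thesis
      unfolding F_def f_def
      by (rule has_vector_derivative_eq_rhs[OF has_vector_derivative_mult[OF 2 1]]) (simp add: algebra_simps)
  qed
  have int: "integrable lborel f"
    unfolding f_def F_def
    by (intro Bochner_Integration.integrable_add Bochner_Integration.integrable_diff integrable_mult_right
        integrable_poly_cgauss a)
  have "(LBINT x=-\<infinity>..\<infinity>. f x) = 0 - 0"
  proof (rule interval_integral_FTC_integrable[where F = F])
    show "isCont f x" for x
      unfolding f_def F_def cgauss_def by (intro continuous_intros)
    show "set_integrable lborel (einterval (-\<infinity>) \<infinity>) f"
      using int by (simp add: set_integrable_def)
    show "((F \<circ> real_of_ereal) \<longlongrightarrow> 0) (at_right (- \<infinity>))" "((F \<circ> real_of_ereal) \<longlongrightarrow> 0) (at_left \<infinity>)"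
      using poly_cgauss_tendsto_0[OF a, of p b] unfolding F_def
      by (simp_all add: ereal_tendsto_simps1)
  qed (use deriv in auto)
  then have "(LINT x|lborel. f x) = 0"
    by (simp add: interval_integral_to_infinity_eq interval_lebesgue_integral_def set_lebesgue_integral_def)
  moreover have "(LINT x|lborel. f x) = (LINT x|lborel. complex_of_real (poly (pderiv p) x) * cgauss a b x)
     - (LINT x|lborel. complex_of_real (poly ([:0, 2 * a:] * p) x) * cgauss a b x)
     + b * (LINT x|lborel. complex_of_real (poly p x) * cgauss a b x)"
    unfolding f_def F_def
    by (simp only: Bochner_Integration.integral_add Bochner_Integration.integral_diff integral_mult_right_zero
        Bochner_Integration.integrable_diff integrable_mult_right integrable_poly_cgauss[OF a])
  moreover have "x = y - w" if "x - y + w = 0" for x y w :: complex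
  proof -
    have "x = (x - y + w) + (y - w)" by simp
    then show ?thesis unfolding that by simp
  qed
  ultimately show ?thesis by metis
qed

lemma std_gauss_cis_integral:
  "(LINT x|lborel. complex_of_real (exp (- x\<^sup>2 / 2)) * cis (s * x)) = complex_of_real (sqrt (2 * pi) * exp (- s\<^sup>2 / 2))"
proof -
  have "complex_of_real (exp (- s\<^sup>2 / 2)) = char std_normal_distribution s"
    by (simp add: char_std_normal_distribution)
  also have "\<dots> = (LINT x|lborel. std_normal_density x *\<^sub>R cis (s * x))"
    unfolding char_def by (subst integral_density) (auto simp: cis_conv_exp)
  also have "\<dots> = (LINT x|lborel. complex_of_real (1 / sqrt (2 * pi)) * (complex_of_real (exp (- x\<^sup>2 / 2)) * cis (s * x)))"
    by (simp add: std_normal_density_def scaleR_conv_of_real)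
  also have "\<dots> = complex_of_real (1 / sqrt (2 * pi)) * (LINT x|lborel. complex_of_real (exp (- x\<^sup>2 / 2)) * cis (s * x))"
    by (rule integral_mult_right_zero)
  finally have "complex_of_real (sqrt (2 * pi)) * complex_of_real (exp (- s\<^sup>2 / 2)) = 
    complex_of_real (sqrt (2 * pi)) * complex_of_real (1 / sqrt (2 * pi)) * (LINT x|lborel. complex_of_real (exp (- x\<^sup>2 / 2)) * cis (s * x))"
    by (simp only: mult.assoc)
  also have "complex_of_real (sqrt (2 * pi)) * complex_of_real (1 / sqrt (2 * pi)) = 1"
    by (subst of_real_mult[symmetric]) simp
  finally show ?thesis by (simp only: of_real_mult mult_1)
qed

text \<open>Only the real part of the slope is removed, by a real substitution centred at Re b /
  (2a). The imaginary part stays as an oscillation, evaluated by the characteristic function of the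
  normal distribution, so no contour has to be shifted.\<close>

lemma cgauss_integral:
  assumes a: "a > 0"
  shows "(LINT x|lborel. cgauss a b x) = complex_of_real (sqrt (pi / a)) * exp (b\<^sup>2 / (4 * a))"
proof -
  define r s where "r = Re b" and "s = Im b"
  define t c where "t = r / (2 * a)" and "c = 1 / sqrt (2 * a)"
  have c: "c > 0" "c\<^sup>2 = 1 / (2 * a)" using a by (auto simp: c_def power_divide)
  have b: "b = complex_of_real r + \<i> * complex_of_real s" by (simp add: r_def s_def complex_eq_iff)
  define K where "K = exp (complex_of_real (r\<^sup>2 / (4 * a)) + \<i> * complex_of_real (s * t))"
  have *: "cgauss a b (t + c * z) = K * (complex_of_real (exp (- z\<^sup>2 / 2)) * cis (s * c * z))" for z
  proof -
    have "- (a * (t + c * z)\<^sup>2) + r * (t + c * z) = r\<^sup>2 / (4 * a) - a * c\<^sup>2 * z\<^sup>2"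
      using a by (simp add: t_def field_simps power2_eq_square)
    also have "\<dots> = r\<^sup>2 / (4 * a) + - z\<^sup>2 / 2"
      using a by (simp add: c(2))
    finally have e: "complex_of_real (- (a * (t + c * z)\<^sup>2)) + complex_of_real (r * (t + c * z)) = 
       complex_of_real (r\<^sup>2 / (4 * a)) + complex_of_real (- z\<^sup>2 / 2)"
      by (simp only: of_real_add[symmetric])
    have "complex_of_real (- (a * (t + c * z)\<^sup>2)) + b * complex_of_real (t + c * z) = 
      (complex_of_real (- (a * (t + c * z)\<^sup>2)) + complex_of_real (r * (t + c * z))) + \<i> * complex_of_real (s * (t + c * z))"
      by (simp add: b algebra_simps)
    also have "\<dots> = (complex_of_real (r\<^sup>2 / (4 * a)) + \<i> * complex_of_real (s * t)) + 
      (complex_of_real (- z\<^sup>2 / 2) + \<i> * complex_of_real (s * c * z))"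
      unfolding e by (simp add: algebra_simps)
    finally show ?thesis
      unfolding cgauss_def K_def by (simp only: exp_add exp_of_real cis_conv_exp)
  qed
  have "(LINT x|lborel. cgauss a b x) = c *\<^sub>R (LINT z|lborel. cgauss a b (t + c * z))"
    using lborel_integral_real_affine[of c "cgauss a b" t] c(1) by simp
  also have "\<dots> = complex_of_real c * (K * complex_of_real (sqrt (2 * pi) * exp (- (s * c)\<^sup>2 / 2)))"
    unfolding * by (simp only: integral_mult_right_zero std_gauss_cis_integral scaleR_conv_of_real)
  also have "\<dots> = complex_of_real (c * sqrt (2 * pi)) * (K * exp (complex_of_real (- (s * c)\<^sup>2 / 2)))"
    by (simp only: of_real_mult exp_of_real mult_ac)
  also have "c * sqrt (2 * pi) = sqrt (pi / a)"
    using a by (simp add: c_def real_sqrt_mult real_sqrt_divide)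
  also have "K * exp (complex_of_real (- (s * c)\<^sup>2 / 2)) = exp (b\<^sup>2 / (4 * a))"
    unfolding K_def exp_add[symmetric] using a
    by (intro arg_cong[of _ _ exp])
       (simp add: b t_def power_mult_distrib c(2) power2_sum field_simps)
  finally show ?thesis .
qed

text \<open>The physicists' Hermite polynomials, generated by the raising operator 2x - d/dx and not
  by the three-term recurrence, because integration by parts against exp(-x^2) acts on exactly this
  operator.\<close>

fun hermite_poly :: "nat \<Rightarrow> real poly" where
  "hermite_poly 0 = 1"
| "hermite_poly (Suc n) = [:0, 2:] * hermite_poly n - pderiv (hermite_poly n)"

text \<open>Differentiating the raising relation for r gives 2r + 2x r' - r''. By the induction
  hypothesis r' is a multiple of the preceding polynomial, so 2x r' - r'' is a raising step again
  and returns a multiple of r.\<close>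

lemma pderiv_hermite_poly_Suc: "pderiv (hermite_poly (Suc n)) = smult (2 * real (Suc n)) (hermite_poly n)"
proof (induction n)
  case 0
  then show ?case by (simp add: pderiv_pCons)
next
  case (Suc n)
  define q where "q = hermite_poly n"
  define r where "r = hermite_poly (Suc n)"
  have r: "r = [:0, 2:] * q - pderiv q" by (simp add: r_def q_def)
  have dr: "pderiv r = smult (2 * real (Suc n)) q" using Suc by (simp add: r_def q_def)
  have "pderiv (hermite_poly (Suc (Suc n))) = pderiv ([:0, 2:] * r - pderiv r)"
    by (simp add: r_def)
  also have "\<dots> = smult 2 r + [:0, 2:] * pderiv r - pderiv (pderiv r)"
    by (simp add: pderiv_diff pderiv_mult pderiv_pCons pderiv_smult algebra_simps)
  also have "\<dots> = smult 2 r + smult (2 * real (Suc n)) ([:0, 2:] * q - pderiv q)"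
    unfolding dr by (simp add: pderiv_smult smult_diff_right algebra_simps)
  also have "\<dots> = smult (2 * real (Suc (Suc n))) r"
    unfolding r[symmetric] by (simp add: smult_add_left[symmetric] algebra_simps)
  finally show ?case by (simp add: r_def)
qed

lemma degree_hermite_poly: "degree (hermite_poly n) = n \<and> lead_coeff (hermite_poly n) = 2 ^ n"
proof (induction n)
  case (Suc n)
  have nz: "hermite_poly n \<noteq> 0" using Suc by auto
  have e: "hermite_poly (Suc n) = - pderiv (hermite_poly n) + [:0, 2:] * hermite_poly n"
    by simp
  have deg: "degree ([:0, 2:] * hermite_poly n) = Suc n" using nz Suc by (subst degree_mult_eq) auto
  have "degree (- pderiv (hermite_poly n)) < degree ([:0, 2:] * hermite_poly n)" using Suc 
    unfolding deg by (simp add: degree_pderiv)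
  then have d: "degree (hermite_poly (Suc n)) = Suc n"
    unfolding e by (subst degree_add_eq_right) (use deg in auto)
  moreover have "coeff (pderiv (hermite_poly n)) (Suc n) = 0"
    using Suc by (intro coeff_eq_0) (simp add: degree_pderiv)
  then have "coeff (hermite_poly (Suc n)) (Suc n) = 2 ^ Suc n"
    using conjunct2[OF Suc] conjunct1[OF Suc] unfolding e by simp
  ultimately show ?case by simp
qed auto

text \<open>Under the weight exp(-x^2) the raising operator is adjoint to d/dx. Each raising step on
  one factor becomes a differentiation of the other, which lowers its index and contributes a factor
  2(n + 1).\<close>

lemma hermite_poly_orthogonal:
  "(LINT x|lborel. complex_of_real (poly (hermite_poly m * hermite_poly n) x) * cgauss 1 0 x)
    = (if m = n then complex_of_real (sqrt pi * 2 ^ n * fact n) else 0)"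
proof -
  define I where "I = (\<lambda>p. LINT x|lborel. complex_of_real (poly p x) * cgauss 1 0 x)"
  have step: "I (p * hermite_poly (Suc n)) = I (pderiv p * hermite_poly n)" for p n
  proof -
    have int: "integrable lborel (\<lambda>x. complex_of_real (poly q x) * cgauss 1 0 x)" for q
      by (rule integrable_poly_cgauss) simp
    have diff: "I (q - r) = I q - I r" for q r
      unfolding I_def by (subst Bochner_Integration.integral_diff[symmetric])
        (simp_all only: int poly_diff of_real_diff left_diff_distrib)
    have "I (pderiv (p * hermite_poly n)) = I ([:0, 2:] * (p * hermite_poly n))"
      unfolding I_def using poly_cgauss_by_parts[of 1 "p * hermite_poly n" 0] by simp
    then have "I ([:0, 2:] * (p * hermite_poly n) - pderiv (p * hermite_poly n)) = 0" by (simp add: diff)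
    moreover have "[:0, 2:] * (p * hermite_poly n) - pderiv (p * hermite_poly n) = 
       p * hermite_poly (Suc n) - pderiv p * hermite_poly n"
      by (simp only: hermite_poly.simps pderiv_mult) (simp add: algebra_simps)
    ultimately show ?thesis by (simp only: diff right_minus_eq)
  qed
  have smult: "I (smult c q) = c * I q" for c q by (simp add: I_def mult.assoc)
  have zero: "I 0 = 0" by (simp add: I_def)
  have one: "I 1 = complex_of_real (sqrt pi)"
  proof -
    have "cgauss 1 0 x = complex_of_real (exp (- (1 * x\<^sup>2) + 0 * x))" for x
      by (simp add: cgauss_def exp_of_real[symmetric])
    with real_gauss_integral[of 1 0] show ?thesis by (simp add: I_def has_bochner_integral_iff)
  qed
  have "I (hermite_poly m * hermite_poly n) = (if m = n then complex_of_real (sqrt pi * 2 ^ n * fact n) else 0)"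
  proof (induction n arbitrary: m)
    case 0
    then show ?case
      using step[of 1] one zero by (cases m) (simp_all del: hermite_poly.simps add: hermite_poly.simps(1))
  next
    case (Suc n)
    have "I (hermite_poly (Suc n)) = 0"
      using step[of 1 n] zero by (simp del: hermite_poly.simps)
    with Suc show ?case
      by (cases m) (simp_all add: step zero pderiv_hermite_poly_Suc smult algebra_simps
          del: hermite_poly.simps add: hermite_poly.simps(1))
  qed
  then show ?thesis by (simp add: I_def)
qed

text \<open>Each raising step contributes one factor b; these powers become the Hermite coefficients
  of a wave packet.\<close>

lemma hermite_poly_cgauss_integral:
  "(LINT x|lborel. complex_of_real (poly (hermite_poly n) x) * cgauss 1 b x) = b ^ n * (LINT x|lborel. cgauss 1 b x)"
proof (induction n)
  case (Suc n)
  have int: "integrable lborel (\<lambda>x. complex_of_real (poly q x) * cgauss 1 b x)" for q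
    by (rule integrable_poly_cgauss) simp
  have "(LINT x|lborel. complex_of_real (poly (hermite_poly (Suc n)) x) * cgauss 1 b x) = 
     (LINT x|lborel. complex_of_real (poly ([:0, 2:] * hermite_poly n) x) * cgauss 1 b x) -
     (LINT x|lborel. complex_of_real (poly (pderiv (hermite_poly n)) x) * cgauss 1 b x)"
    by (subst Bochner_Integration.integral_diff[symmetric]) (simp_all only: int hermite_poly.simps poly_diff of_real_diff left_diff_distrib)
  also have "\<dots> = b * (LINT x|lborel. complex_of_real (poly (hermite_poly n) x) * cgauss 1 b x)"
    using poly_cgauss_by_parts[of 1 "hermite_poly n" b] by simp
  finally show ?case using Suc by simp
qed simp

subsection \<open>Plancherel\<close>

text \<open>A pointwise integral, informative only for integrable f. General square-integrable
  functions enter through their truncations to bounded intervals.\<close>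

definition fourier :: "(real \<Rightarrow> complex) \<Rightarrow> real \<Rightarrow> complex" where
  "fourier f k = complex_of_real (1 / sqrt (2 * pi)) * (LINT x|lborel. f x * cis (- (k * x)))"

lemma FT_trunc_eq_fourier: "FT_trunc R u = fourier (\<lambda>x. indicator {-R..R} x * u x)"
  by (auto simp: fun_eq_iff FT_trunc_def fourier_def set_lebesgue_integral_def scaleR_conv_of_real
      mult.assoc indicator_eq_0_iff intro!: arg_cong2[of _ _ _ _ "(*)"] Bochner_Integration.integral_cong split: split_indicator)

lemma borel_measurable_cis [measurable (raw)]:
  "f \<in> borel_measurable M \<Longrightarrow> (\<lambda>x. cis (f x)) \<in> borel_measurable M"
  by (rule measurable_compose[OF _ borel_measurable_continuous_onI]) (auto intro: continuous_intros)

lemma borel_measurable_fourier: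
  assumes [measurable]: "f \<in> borel_measurable borel"
  shows "fourier f \<in> borel_measurable borel"
proof -
  have "(\<lambda>k. LINT x|lborel. f x * cis (- (k * x))) \<in> borel_measurable borel"
    by (rule lborel.borel_measurable_lebesgue_integral) measurable
  then show ?thesis unfolding fourier_def[abs_def] by measurable
qed

lemma norm_fourier_le:
  assumes "integrable lborel f"
  shows "cmod (fourier f k) \<le> (LINT x|lborel. cmod (f x))"
proof -
  have "cmod (LINT x|lborel. f x * cis (- (k * x))) \<le> (LINT x|lborel. cmod (f x * cis (- (k * x))))"
    by (rule integral_norm_bound)
  then have "cmod (fourier f k) \<le> 1 / sqrt (2 * pi) * (LINT x|lborel. cmod (f x))"
    unfolding fourier_def norm_mult by (intro mult_mono) (auto simp: norm_mult norm_divide)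
  also have "\<dots> \<le> 1 * (LINT x|lborel. cmod (f x))"
    using pi_gt3 by (intro mult_right_mono) (auto simp: real_le_rsqrt)
  finally show ?thesis by simp
qed

lemma integrable_mult_cis:
  assumes "integrable M f" "g \<in> borel_measurable M"
  shows "integrable M (\<lambda>x. f x * cis (g x))"
  by (rule integrable_dominated[OF integrable_norm[OF assms(1)]]) (use assms in \<open>auto simp: norm_mult\<close>)

text \<open>Its value at 0 is \<open>L2inner f g\<close>, and up to a constant its transform is
  \<open>fourier f\<close> times the conjugate of \<open>fourier g\<close>. Plancherel is therefore
  Fourier inversion of this function at the single point 0.\<close>

definition correlation :: "(real \<Rightarrow> complex) \<Rightarrow> (real \<Rightarrow> complex) \<Rightarrow> real \<Rightarrow> complex" where
  "correlation f g t = (LINT x|lborel. f x * cnj (g (x - t)))"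

lemma borel_measurable_correlation:
  assumes [measurable]: "f \<in> borel_measurable borel" "g \<in> borel_measurable borel"
  shows "correlation f g \<in> borel_measurable borel"
  unfolding correlation_def[abs_def] by (rule lborel.borel_measurable_lebesgue_integral) measurable

lemma correlation_pair_integrable:
  fixes f g :: "real \<Rightarrow> complex"
  assumes f: "integrable lborel f" and g: "integrable lborel g"
  shows "integrable (lborel \<Otimes>\<^sub>M lborel) (\<lambda>(x, t). f x * cnj (g (x - t)))"
proof (rule lborel_pair.Fubini_integrable)
  note [measurable] = borel_measurable_integrable[OF f] borel_measurable_integrable[OF g]
  show "(\<lambda>(x, t). f x * cnj (g (x - t))) \<in> borel_measurable (lborel \<Otimes>\<^sub>M lborel)" by measurable
  have "(LINT t|lborel. norm (case (x, t) of (x, t) \<Rightarrow> f x * cnj (g (x - t)))) = 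
     cmod (f x) * (LINT t|lborel. cmod (g t))" for x
    using integral_reflect[of "\<lambda>t. cmod (g t)" x] by (simp add: norm_mult)
  then show "integrable lborel (\<lambda>x. LINT t|lborel. norm (case (x, t) of (x, t) \<Rightarrow> f x * cnj (g (x - t))))"
    using f by simp
  show "AE x in lborel. integrable lborel (\<lambda>t. case (x, t) of (x, t) \<Rightarrow> f x * cnj (g (x - t)))"
    using integrable_reflect[OF g] by auto
qed

lemma integrable_correlation:
  assumes f: "integrable lborel f" and g: "integrable lborel g"
  shows "integrable lborel (correlation f g)"
  using lborel_pair.integrable_snd[OF correlation_pair_integrable[OF assms]]
  by (simp add: correlation_def[abs_def])

lemma fourier_correlation:
  assumes f: "integrable lborel f" and g: "integrable lborel g"
  shows "fourier f k * cnj (fourier g k) = 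
    complex_of_real (1 / (2 * pi)) * (LINT t|lborel. correlation f g t * cis (- (k * t)))"
proof -
  note [measurable] = borel_measurable_integrable[OF f] borel_measurable_integrable[OF g]
  have int: "integrable (lborel \<Otimes>\<^sub>M lborel) (\<lambda>(x, t). f x * cnj (g (x - t)) * cis (- (k * t)))"
    using integrable_mult_cis[OF correlation_pair_integrable[OF assms], of "\<lambda>(x, t). - (k * t)"]
    by (simp add: case_prod_unfold)
  have "(LINT t|lborel. correlation f g t * cis (- (k * t))) = 
     (LINT t|lborel. (LINT x|lborel. f x * cnj (g (x - t)) * cis (- (k * t))))"
    by (simp add: correlation_def)
  also have "\<dots> = (LINT x|lborel. (LINT t|lborel. f x * cnj (g (x - t)) * cis (- (k * t))))"
    by (rule lborel_pair.Fubini_integral[OF int])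
  also have "\<dots> = (LINT x|lborel. f x * cis (- (k * x)) * cnj (LINT y|lborel. g y * cis (- (k * y))))"
  proof (rule Bochner_Integration.integral_cong[OF refl])
    fix x
    have "(LINT t|lborel. f x * cnj (g (x - t)) * cis (- (k * t))) = 
       (LINT y|lborel. f x * cnj (g y) * cis (- (k * (x - y))))"
      using integral_reflect[of "\<lambda>y. f x * cnj (g y) * cis (- (k * (x - y)))" x] by simp
    also have "\<dots> = (LINT y|lborel. f x * cis (- (k * x)) * cnj (g y * cis (- (k * y))))"
      by (intro Bochner_Integration.integral_cong) (auto simp: cis_cnj cis_mult algebra_simps)
    finally show "(LINT t|lborel. f x * cnj (g (x - t)) * cis (- (k * t))) = 
       f x * cis (- (k * x)) * cnj (LINT y|lborel. g y * cis (- (k * y)))" 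
      by (simp only: integral_mult_right_zero Bochner_Integration.integral_cnj)
  qed
  also have "\<dots> = (LINT x|lborel. f x * cis (- (k * x))) * cnj (LINT y|lborel. g y * cis (- (k * y)))"
    by (rule integral_mult_left_zero)
  finally have "(LINT t|lborel. correlation f g t * cis (- (k * t))) = 
     (LINT x|lborel. f x * cis (- (k * x))) * cnj (LINT y|lborel. g y * cis (- (k * y)))" .
  moreover have "complex_of_real (1 / sqrt (2 * pi)) * complex_of_real (1 / sqrt (2 * pi)) = complex_of_real (1 / (2 * pi))"
    by (subst of_real_mult[symmetric]) simp
  moreover have "c * a * (c * b) = (c * c) * (a * b)" for a b c :: complex by (simp only: mult_ac)
  ultimately show ?thesis
    unfolding fourier_def complex_cnj_mult complex_cnj_complex_of_real by (simp only:)
qed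

text \<open>The transform of the Gaussian convergence factor is 2 pi times a normal density of width
  \<epsilon>, hence an approximate identity as \<epsilon> tends to 0.\<close>

lemma gauss_cis_integral:
  assumes "\<epsilon> > 0"
  shows "(LINT k|lborel. complex_of_real (exp (- (\<epsilon> * k)\<^sup>2 / 2)) * cis (- (k * t))) = 
    complex_of_real (2 * pi * normal_density 0 \<epsilon> t)"
proof -
  have "complex_of_real (exp (- (\<epsilon> * k)\<^sup>2 / 2)) * cis (- (k * t)) = cgauss (\<epsilon>\<^sup>2 / 2) (- \<i> * complex_of_real t) k" for k
    by (simp add: cgauss_def cis_conv_exp exp_of_real[symmetric] exp_add[symmetric] power_mult_distrib algebra_simps)
  then have "(LINT k|lborel. complex_of_real (exp (- (\<epsilon> * k)\<^sup>2 / 2)) * cis (- (k * t))) = 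
    complex_of_real (sqrt (pi / (\<epsilon>\<^sup>2 / 2))) * exp ((- \<i> * complex_of_real t)\<^sup>2 / (4 * (\<epsilon>\<^sup>2 / 2)))"
    using cgauss_integral[of "\<epsilon>\<^sup>2 / 2" "- \<i> * complex_of_real t"] assms by simp
  also have "(- \<i> * complex_of_real t)\<^sup>2 / (4 * (\<epsilon>\<^sup>2 / 2)) = complex_of_real (- (t\<^sup>2) / (2 * \<epsilon>\<^sup>2))"
    by (simp add: power_mult_distrib)
  also have "complex_of_real (sqrt (pi / (\<epsilon>\<^sup>2 / 2))) * exp (complex_of_real (- (t\<^sup>2) / (2 * \<epsilon>\<^sup>2))) = 
     complex_of_real (sqrt (pi / (\<epsilon>\<^sup>2 / 2)) * exp (- (t\<^sup>2) / (2 * \<epsilon>\<^sup>2)))"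
    by (simp only: exp_of_real of_real_mult)
  also have "sqrt (pi / (\<epsilon>\<^sup>2 / 2)) = 2 * pi * (1 / sqrt (2 * pi * \<epsilon>\<^sup>2))"
    using assms by (simp add: real_sqrt_mult real_sqrt_divide field_simps flip: power2_eq_square)
  finally show ?thesis by (simp add: normal_density_def)
qed

lemma integrable_gauss:
  fixes \<epsilon> :: real
  assumes "\<epsilon> > 0"
  shows "integrable lborel (\<lambda>k. exp (- (\<epsilon> * k)\<^sup>2 / 2))"
  using real_gauss_integral[of "\<epsilon>\<^sup>2 / 2" 0] assms
  by (auto simp: has_bochner_integral_iff power_mult_distrib)

text \<open>At this stage the two transforms are only known to be bounded; the Gaussian factor makes
  the double integral absolutely convergent, so that Fubini applies.\<close>

lemma fourier_regularised_inner:
  assumes f: "integrable lborel f" and g: "integrable lborel g" and \<epsilon>: "\<epsilon> > 0"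
  shows "(LINT k|lborel. complex_of_real (exp (- (\<epsilon> * k)\<^sup>2 / 2)) * (fourier f k * cnj (fourier g k))) = 
    (LINT t|lborel. complex_of_real (normal_density 0 \<epsilon> t) * correlation f g t)"
proof -
  define h where "h = correlation f g"
  have h: "integrable lborel h" unfolding h_def by (rule integrable_correlation[OF f g])
  note [measurable] = borel_measurable_integrable[OF h]
  define G where "G = (\<lambda>k. complex_of_real (exp (- (\<epsilon> * k)\<^sup>2 / 2)))"
  have [measurable]: "G \<in> borel_measurable borel" unfolding G_def by measurable
  have G: "integrable lborel (\<lambda>k. cmod (G k))" using integrable_gauss[OF \<epsilon>] by (simp add: G_def)
  have int: "integrable (lborel \<Otimes>\<^sub>M lborel) (\<lambda>(k, t). G k * h t * cis (- (k * t)))"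
  proof (rule lborel_pair.Fubini_integrable)
    show "(\<lambda>(k, t). G k * h t * cis (- (k * t))) \<in> borel_measurable (lborel \<Otimes>\<^sub>M lborel)" by measurable
    show "integrable lborel (\<lambda>k. LINT t|lborel. norm (case (k, t) of (k, t) \<Rightarrow> G k * h t * cis (- (k * t))))"
      using G by (simp add: norm_mult)
    show "AE k in lborel. integrable lborel (\<lambda>t. case (k, t) of (k, t) \<Rightarrow> G k * h t * cis (- (k * t)))"
      using h by (auto intro!: integrable_mult_cis)
  qed
  have "(LINT k|lborel. G k * (fourier f k * cnj (fourier g k))) = 
     (LINT k|lborel. complex_of_real (1 / (2 * pi)) * (LINT t|lborel. G k * h t * cis (- (k * t))))"
    unfolding fourier_correlation[OF f g] h_def[symmetric] by (simp add: mult_ac)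
  also have "\<dots> = complex_of_real (1 / (2 * pi)) * (LINT k|lborel. (LINT t|lborel. G k * h t * cis (- (k * t))))"
    by (rule integral_mult_right_zero)
  also have "(LINT k|lborel. (LINT t|lborel. G k * h t * cis (- (k * t)))) = 
      (LINT t|lborel. (LINT k|lborel. G k * h t * cis (- (k * t))))"
    by (rule lborel_pair.Fubini_integral[OF int, symmetric])
  also have "(\<lambda>t. LINT k|lborel. G k * h t * cis (- (k * t))) = 
     (\<lambda>t. complex_of_real (2 * pi) * (complex_of_real (normal_density 0 \<epsilon> t) * h t))"
  proof
    fix t
    have "(LINT k|lborel. G k * h t * cis (- (k * t))) = h t * (LINT k|lborel. G k * cis (- (k * t)))"
      by (subst integral_mult_right_zero[symmetric]) (simp add: mult_ac)
    then show "(LINT k|lborel. G k * h t * cis (- (k * t))) = complex_of_real (2 * pi) * (complex_of_real (normal_density 0 \<epsilon> t) * h t)"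
      unfolding G_def gauss_cis_integral[OF \<epsilon>] by simp
  qed
  finally show ?thesis unfolding G_def h_def by simp
qed

lemma norm_correlation_le:
  assumes "in_L2 f" "in_L2 g"
  shows "cmod (correlation f g t) \<le> L2norm f * L2norm g"
  using Cauchy_Schwarz_L2[OF assms(1) in_L2_translate(1)[OF assms(2), of t]] in_L2_translate(2)[OF assms(2), of t]
  by (simp add: L2inner_def correlation_def)

text \<open>Cauchy-Schwarz reduces continuity of the correlation at 0 to continuity of translations
  in L^2.\<close>

lemma correlation_tendsto:
  assumes f: "in_L2 f" and g: "in_L2 g" and t: "t \<longlonglongrightarrow> (0::real)"
  shows "(\<lambda>n. correlation f g (t n)) \<longlonglongrightarrow> L2inner f g"
proof (rule LIM_zero_cancel, rule Lim_null_comparison)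
  have "(\<lambda>n. L2norm f * L2norm (\<lambda>x. g (x - t n) - g x)) \<longlonglongrightarrow> L2norm f * 0"
    by (intro tendsto_intros translation_cont_L2 g t)
  then show "(\<lambda>n. L2norm f * L2norm (\<lambda>x. g (x - t n) - g x)) \<longlonglongrightarrow> 0" by simp
  have "cmod (correlation f g (t n) - L2inner f g) \<le> L2norm f * L2norm (\<lambda>x. g (x - t n) - g x)" for n
  proof -
    have "correlation f g (t n) - L2inner f g = L2inner f (\<lambda>x. g (x - t n) - g x)"
      unfolding correlation_def L2inner_def
      using in_L2_integrable_inner[OF f g] in_L2_integrable_inner[OF f in_L2_translate(1)[OF g, of "t n"]]
      by (simp add: right_diff_distrib)
    then show ?thesis
      using Cauchy_Schwarz_L2[OF f in_L2_diff[OF in_L2_translate(1)[OF g, of "t n"] g]] by simp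
  qed
  then show "\<forall>\<^sub>F n in sequentially. cmod (correlation f g (t n) - L2inner f g) \<le> L2norm f * L2norm (\<lambda>x. g (x - t n) - g x)"
    by simp
qed

text \<open>Rescaling by the width turns the concentrating density into a fixed one and moves the
  limit into the argument of the correlation, where dominated convergence applies.\<close>

lemma normal_density_correlation_tendsto:
  assumes f: "in_L2 f" and g: "in_L2 g"
  shows "(\<lambda>n. LINT t|lborel. complex_of_real (normal_density 0 (1 / real (Suc n)) t) * correlation f g t)
     \<longlonglongrightarrow> L2inner f g"
proof -
  note [measurable] = borel_measurable_correlation[OF in_L2_measurable[OF f] in_L2_measurable[OF g]]
  define S where "S = (\<lambda>s. complex_of_real (std_normal_density s))"
  have [measurable]: "S \<in> borel_measurable borel" unfolding S_def by measurable
  have eq: "(LINT t|lborel. complex_of_real (normal_density 0 (1 / real (Suc n)) t) * correlation f g t) = 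
    (LINT s|lborel. S s * correlation f g (s / real (Suc n)))" for n
  proof -
    define c where "c = 1 / real (Suc n)"
    have c: "c > 0" by (simp add: c_def)
    have "c * normal_density 0 c (c * s) = std_normal_density s" for s
      using c by (simp add: normal_density_def power_mult_distrib real_sqrt_mult)
    then have d: "complex_of_real c * complex_of_real (normal_density 0 c (c * s)) = S s" for s
      unfolding S_def of_real_mult[symmetric] by simp
    have "(LINT t|lborel. complex_of_real (normal_density 0 c t) * correlation f g t) = 
      c *\<^sub>R (LINT s|lborel. complex_of_real (normal_density 0 c (c * s)) * correlation f g (c * s))"
      using lborel_integral_real_affine[of c "\<lambda>t. complex_of_real (normal_density 0 c t) * correlation f g t" 0] c by simp
    also have "\<dots> = (LINT s|lborel. S s * correlation f g (c * s))"
      unfolding d[symmetric] scaleR_conv_of_real by (simp add: mult.assoc)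
    finally show ?thesis by (simp add: c_def)
  qed
  have "(\<lambda>n. LINT s|lborel. S s * correlation f g (s / real (Suc n))) \<longlonglongrightarrow> (LINT s|lborel. S s * L2inner f g)"
  proof (rule integral_dominated_convergence[where w = "\<lambda>s. std_normal_density s * (L2norm f * L2norm g)"])
    show "AE s in lborel. (\<lambda>n. S s * correlation f g (s / real (Suc n))) \<longlonglongrightarrow> S s * L2inner f g"
    proof (rule AE_I2)
      fix s
      have "(\<lambda>n. s / real (Suc n)) \<longlonglongrightarrow> 0" by real_asymp
      then show "(\<lambda>n. S s * correlation f g (s / real (Suc n))) \<longlonglongrightarrow> S s * L2inner f g"
        by (intro tendsto_mult_left correlation_tendsto f g)
    qed
    show "AE s in lborel. norm (S s * correlation f g (s / real (Suc n))) \<le> std_normal_density s * (L2norm f * L2norm g)" for n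
      using norm_correlation_le[OF f g] by (auto simp: S_def norm_mult intro!: mult_left_mono)
  qed auto
  moreover have "(LINT s|lborel. S s * L2inner f g) = L2inner f g"
  proof -
    have "(LINT s|lborel. S s) = 1" by (simp add: S_def)
    then show ?thesis unfolding integral_mult_left_zero by simp
  qed
  ultimately show ?thesis unfolding eq by (simp only:)
qed

lemma regularisation_tendsto: "(\<lambda>n. exp (- (1 / real (Suc n) * k)\<^sup>2 / 2)) \<longlonglongrightarrow> 1"
proof -
  have "(\<lambda>n. 1 / real (Suc n)) \<longlonglongrightarrow> 0" by real_asymp
  then have "(\<lambda>n. exp (- (1 / real (Suc n) * k)\<^sup>2 / 2)) \<longlonglongrightarrow> exp (- (0 * k)\<^sup>2 / 2)"
    by (intro tendsto_intros) auto
  then show ?thesis by simp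
qed

text \<open>With both functions equal, the regularised integrand is nonnegative and increases with
  n, so monotone convergence yields the square-integrability of the transform together with the
  value of its norm.\<close>

lemma Plancherel_norm:
  assumes f1: "integrable lborel f" and f2: "in_L2 f"
  shows "in_L2 (fourier f)" "L2norm (fourier f) = L2norm f"
proof -
  note [measurable] = borel_measurable_integrable[OF f1] borel_measurable_fourier[OF in_L2_measurable[OF f2]]
  define F where "F = (\<lambda>n k. exp (- (1 / real (Suc n) * k)\<^sup>2 / 2) * (cmod (fourier f k))\<^sup>2)"
  define u where "u = (\<lambda>k. (cmod (fourier f k))\<^sup>2)"
  have Fc: "complex_of_real (LINT k|lborel. F n k) = 
     (LINT k|lborel. complex_of_real (exp (- (1 / real (Suc n) * k)\<^sup>2 / 2)) * (fourier f k * cnj (fourier f k)))" for n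
    unfolding F_def by (subst integral_complex_of_real[symmetric]) (simp add: complex_norm_square[symmetric])
  have int: "integrable lborel (F n)" for n
  proof -
    have "integrable lborel (\<lambda>k. exp (- (1 / real (Suc n) * k)\<^sup>2 / 2) * (LINT x|lborel. cmod (f x))\<^sup>2)"
      by (intro integrable_mult_left integrable_gauss) auto
    then show ?thesis unfolding F_def
      by (rule integrable_dominated) (auto intro!: mult_left_mono power_mono norm_fourier_le f1)
  qed
  have "(\<lambda>n. complex_of_real (LINT k|lborel. F n k)) \<longlonglongrightarrow> L2inner f f"
    unfolding Fc using normal_density_correlation_tendsto[OF f2 f2]
    by (subst fourier_regularised_inner[OF f1 f1]) auto
  then have lim: "(\<lambda>n. LINT k|lborel. F n k) \<longlonglongrightarrow> (L2norm f)\<^sup>2"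
    unfolding L2inner_self tendsto_of_real_iff .
  have mono: "AE k in lborel. mono (\<lambda>n. F n k)"
    unfolding F_def by (intro AE_I2 monoI mult_right_mono)
      (auto simp: power_mult_distrib power_divide intro!: mult_right_mono divide_left_mono power_mono)
  have ptw: "AE k in lborel. (\<lambda>n. F n k) \<longlonglongrightarrow> u k"
  proof (rule AE_I2)
    fix k
    have "(\<lambda>n. F n k) \<longlonglongrightarrow> 1 * u k"
      unfolding F_def u_def by (intro tendsto_mult_right regularisation_tendsto)
    then show "(\<lambda>n. F n k) \<longlonglongrightarrow> u k" by simp
  qed
  have um: "u \<in> borel_measurable lborel" unfolding u_def by measurable
  have "integrable lborel u" "integral\<^sup>L lborel u = (L2norm f)\<^sup>2"
    using integrable_monotone_convergence[OF int mono ptw lim um]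
      integral_monotone_convergence[OF int mono ptw lim um] by auto
  then show "in_L2 (fourier f)" "L2norm (fourier f) = L2norm f"
    by (auto simp: in_L2_def u_def L2norm_def[of "fourier f"])
qed

text \<open>Now that both transforms are square-integrable, the product of their moduli dominates
  the regularised integrands, and the same limit works for two different functions.\<close>

lemma Plancherel_inner:
  assumes f1: "integrable lborel f" and f2: "in_L2 f" and g1: "integrable lborel g" and g2: "in_L2 g"
  shows "L2inner (fourier f) (fourier g) = L2inner f g"
proof -
  note [measurable] = borel_measurable_fourier[OF in_L2_measurable[OF f2]]
    borel_measurable_fourier[OF in_L2_measurable[OF g2]]
  have "(\<lambda>n. LINT k|lborel. complex_of_real (exp (- (1 / real (Suc n) * k)\<^sup>2 / 2)) * (fourier f k * cnj (fourier g k)))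
     \<longlonglongrightarrow> L2inner f g"
    by (subst fourier_regularised_inner[OF f1 g1]) (auto intro!: normal_density_correlation_tendsto f2 g2 simp del: of_nat_Suc)
  moreover have "(\<lambda>n. LINT k|lborel. complex_of_real (exp (- (1 / real (Suc n) * k)\<^sup>2 / 2)) * (fourier f k * cnj (fourier g k)))
     \<longlonglongrightarrow> (LINT k|lborel. fourier f k * cnj (fourier g k))"
  proof (rule integral_dominated_convergence[where w = "\<lambda>k. cmod (fourier f k) * cmod (fourier g k)"])
    show "integrable lborel (\<lambda>k. cmod (fourier f k) * cmod (fourier g k))"
      by (intro in_L2_integrable_norm_mult Plancherel_norm f1 f2 g1 g2)
    show "AE k in lborel. (\<lambda>n. complex_of_real (exp (- (1 / real (Suc n) * k)\<^sup>2 / 2)) * (fourier f k * cnj (fourier g k))) \<longlonglongrightarrow> fourier f k * cnj (fourier g k)"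
    proof (rule AE_I2)
      fix k
      have "(\<lambda>n. complex_of_real (exp (- (1 / real (Suc n) * k)\<^sup>2 / 2)) * (fourier f k * cnj (fourier g k))) \<longlonglongrightarrow> complex_of_real 1 * (fourier f k * cnj (fourier g k))"
        by (intro tendsto_mult_right tendsto_of_real regularisation_tendsto)
      then show "(\<lambda>n. complex_of_real (exp (- (1 / real (Suc n) * k)\<^sup>2 / 2)) * (fourier f k * cnj (fourier g k))) \<longlonglongrightarrow> fourier f k * cnj (fourier g k)"
        by simp
    qed
    show "AE k in lborel. norm (complex_of_real (exp (- (1 / real (Suc n) * k)\<^sup>2 / 2)) * (fourier f k * cnj (fourier g k))) \<le> cmod (fourier f k) * cmod (fourier g k)" for n
    proof (rule AE_I2)
      fix k
      show "norm (complex_of_real (exp (- (1 / real (Suc n) * k)\<^sup>2 / 2)) * (fourier f k * cnj (fourier g k))) \<le> cmod (fourier f k) * cmod (fourier g k)"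
        by (simp add: norm_mult mult_left_le_one_le)
    qed
  qed auto
  ultimately show ?thesis unfolding L2inner_def using LIMSEQ_unique by blast
qed

subsection \<open>Hermite functions\<close>

lemma poly_map_poly_of_real:
  "poly (map_poly complex_of_real p) (complex_of_real x) = complex_of_real (poly p x)"
  by (induction p) (auto simp: map_poly_pCons)

text \<open>The n-th Hermite polynomial has squared norm sqrt(pi) 2^n n! under exp(-x^2), and the
  dilation by \<beta> contributes 1/\<beta>.\<close>

definition hermite_const :: "real \<Rightarrow> nat \<Rightarrow> real" where
  "hermite_const \<beta> n = sqrt (\<beta> / (sqrt pi * 2 ^ n * fact n))"

definition hermite_fun :: "real \<Rightarrow> nat \<Rightarrow> real \<Rightarrow> real" where
  "hermite_fun \<beta> n x = hermite_const \<beta> n * poly (hermite_poly n) (\<beta> * x) * exp (- (\<beta>\<^sup>2 * x\<^sup>2) / 2)"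

abbreviation hermite :: "real \<Rightarrow> nat \<Rightarrow> real \<Rightarrow> complex" where
  "hermite \<beta> n \<equiv> (\<lambda>x. complex_of_real (hermite_fun \<beta> n x))"

lemma hermite_const_pos: "\<beta> > 0 \<Longrightarrow> hermite_const \<beta> n > 0"
  by (simp add: hermite_const_def)

lemma hermite_const_power2:
  "\<beta> > 0 \<Longrightarrow> (hermite_const \<beta> n)\<^sup>2 = \<beta> / (sqrt pi * 2 ^ n * fact n)"
  by (simp add: hermite_const_def)

lemma borel_measurable_hermite_fun [measurable]: "hermite_fun \<beta> n \<in> borel_measurable borel"
  unfolding hermite_fun_def[abs_def] by measurable

lemma hermite_mult_eq:
  "hermite \<beta> m x * cnj (hermite \<beta> n x) = complex_of_real (hermite_const \<beta> m * hermite_const \<beta> n) *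
     (complex_of_real (poly (hermite_poly m * hermite_poly n) (\<beta> * x)) * cgauss 1 0 (\<beta> * x))"
proof -
  have "exp (- (\<beta>\<^sup>2 * x\<^sup>2) / 2) * exp (- (\<beta>\<^sup>2 * x\<^sup>2) / 2) = exp (- (1 * (\<beta> * x)\<^sup>2))"
    by (simp add: exp_add[symmetric] power_mult_distrib)
  then have "hermite_fun \<beta> m x * hermite_fun \<beta> n x = (hermite_const \<beta> m * hermite_const \<beta> n) *
     (poly (hermite_poly m * hermite_poly n) (\<beta> * x) * exp (- (1 * (\<beta> * x)\<^sup>2)))"
    unfolding hermite_fun_def by (simp add: algebra_simps)
  moreover have "cgauss 1 0 (\<beta> * x) = complex_of_real (exp (- (1 * (\<beta> * x)\<^sup>2)))"
    by (simp add: cgauss_def exp_of_real[symmetric])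
  ultimately show ?thesis
    by (metis complex_cnj_complex_of_real of_real_mult)
qed

lemma in_L2_hermite:
  assumes "\<beta> > 0"
  shows "in_L2 (hermite \<beta> n)"
proof -
  have "integrable lborel (\<lambda>x. complex_of_real (poly (hermite_poly n * hermite_poly n) x) * cgauss 1 0 x)"
    by (rule integrable_poly_cgauss) simp
  from lborel_integrable_real_affine[OF this, of \<beta> 0] assms
  have "integrable lborel (\<lambda>x. hermite \<beta> n x * cnj (hermite \<beta> n x))"
    unfolding hermite_mult_eq by (intro integrable_mult_right) simp
  then have "integrable lborel (\<lambda>x. complex_of_real ((cmod (hermite \<beta> n x))\<^sup>2))"
    by (simp only: complex_norm_square)
  then show ?thesis unfolding in_L2_def complex_of_real_integrable_eq by simp
qed

lemma hermite_orthonormal: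
  assumes "\<beta> > 0"
  shows "L2inner (hermite \<beta> m) (hermite \<beta> n) = (if m = n then 1 else 0)"
proof -
  define F where "F = (\<lambda>x. complex_of_real (poly (hermite_poly m * hermite_poly n) x) * cgauss 1 0 x)"
  have "(LINT x|lborel. F x) = \<beta> *\<^sub>R (LINT x|lborel. F (\<beta> * x))"
    using lborel_integral_real_affine[of \<beta> F 0] assms by simp
  then have "(LINT x|lborel. F (\<beta> * x)) = complex_of_real (1 / \<beta>) * (LINT x|lborel. F x)"
    using assms by (simp add: scaleR_conv_of_real)
  moreover have "L2inner (hermite \<beta> m) (hermite \<beta> n) = 
    complex_of_real (hermite_const \<beta> m * hermite_const \<beta> n) * (LINT x|lborel. F (\<beta> * x))"
    unfolding L2inner_def hermite_mult_eq F_def by (rule integral_mult_right_zero)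
  moreover have "(LINT x|lborel. F x) = (if m = n then complex_of_real (sqrt pi * 2 ^ n * fact n) else 0)"
    unfolding F_def by (rule hermite_poly_orthogonal)
  moreover have "hermite_const \<beta> n * hermite_const \<beta> n * (1 / \<beta>) * (sqrt pi * 2 ^ n * fact n) = 1"
    using hermite_const_power2[OF assms, of n] assms by (simp add: power2_eq_square)
  then have "complex_of_real (hermite_const \<beta> n * hermite_const \<beta> n) * (complex_of_real (1 / \<beta>) * complex_of_real (sqrt pi * 2 ^ n * fact n)) = 1"
    by (metis mult.assoc of_real_1 of_real_mult)
  ultimately show ?thesis by (cases "m = n") simp_all
qed

lemma L2norm_hermite:
  assumes "\<beta> > 0"
  shows "L2norm (hermite \<beta> n) = 1"
proof -
  have "complex_of_real ((L2norm (hermite \<beta> n))\<^sup>2) = 1"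
    unfolding L2inner_self[symmetric] using hermite_orthonormal[OF assms, of n n] by simp
  then have "(L2norm (hermite \<beta> n))\<^sup>2 = 1" by (simp only: of_real_eq_1_iff)
  then show ?thesis using L2norm_nonneg[of "hermite \<beta> n"] by (simp add: power2_eq_1_iff)
qed

lemma hermite_const_Suc: "sqrt (real (Suc n) / 2) * hermite_const \<beta> (Suc n) = hermite_const \<beta> n / 2"
proof -
  have "hermite_const \<beta> (Suc n) = hermite_const \<beta> n / sqrt (2 * real (Suc n))"
    unfolding hermite_const_def real_sqrt_divide[symmetric] by (simp add: field_simps)
  moreover have "sqrt (real (Suc n) / 2) / sqrt (2 * real (Suc n)) = sqrt ((1 / 2)\<^sup>2)"
    unfolding real_sqrt_divide[symmetric] by (simp add: power2_eq_square field_simps)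
  ultimately show ?thesis by simp
qed

text \<open>Differentiating H(y) exp(-y^2/2) leaves the polynomial H' - yH = H'/2 - (2yH - H')/2,
  half a lowering minus half a raising step. At n = 0 the truncated index n - 1 is harmless, since
  its coefficient sqrt 0 vanishes.\<close>

lemma hermite_fun_deriv:
  "(hermite_fun \<beta> n has_real_derivative \<beta> * (sqrt (real n / 2) * hermite_fun \<beta> (n - 1) x
     - sqrt (real (Suc n) / 2) * hermite_fun \<beta> (Suc n) x)) (at x)"
proof -
  define y e where "y = \<beta> * x" and "e = exp (- (\<beta>\<^sup>2 * x\<^sup>2) / 2)"
  define d where "d = poly (pderiv (hermite_poly n)) y"
  have H1: "poly (hermite_poly (Suc n)) y = 2 * y * poly (hermite_poly n) y - d" by (simp add: d_def)
  have low: "sqrt (real n / 2) * hermite_fun \<beta> (n - 1) x = hermite_const \<beta> n * (d / 2) * e"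
  proof (cases n)
    case (Suc m)
    have "hermite_const \<beta> m = 2 * (sqrt (real (Suc m) / 2) * hermite_const \<beta> (Suc m))"
      using hermite_const_Suc[of m \<beta>] by linarith
    then have "sqrt (real (Suc m) / 2) * hermite_const \<beta> m = 2 * (sqrt (real (Suc m) / 2))\<^sup>2 * hermite_const \<beta> (Suc m)"
      by (simp only: power2_eq_square mult_ac)
    then have "sqrt (real (Suc m) / 2) * hermite_const \<beta> m = real (Suc m) * hermite_const \<beta> (Suc m)" by (simp only: real_sqrt_pow2 divide_nonneg_nonneg of_nat_0_le_iff zero_le_numeral)
    note 1 = this
    have "sqrt (real (Suc m) / 2) * hermite_fun \<beta> m x = (sqrt (real (Suc m) / 2) * hermite_const \<beta> m) * poly (hermite_poly m) y * e"
      unfolding hermite_fun_def y_def e_def by (simp only: mult_ac)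
    moreover have "d / 2 = real (Suc m) * poly (hermite_poly m) y"
      unfolding d_def Suc pderiv_hermite_poly_Suc by (simp del: of_nat_Suc)
    ultimately show ?thesis
      unfolding Suc 1 diff_Suc_1 by (simp only: mult_ac)
  qed (simp add: d_def)
  have high: "sqrt (real (Suc n) / 2) * hermite_fun \<beta> (Suc n) x = hermite_const \<beta> n / 2 * (2 * y * poly (hermite_poly n) y - d) * e"
    unfolding H1[symmetric] hermite_const_Suc[symmetric]
    by (simp only: hermite_fun_def y_def e_def mult_ac)
  have "(hermite_fun \<beta> n has_real_derivative 
     hermite_const \<beta> n * (d * \<beta>) * e + hermite_const \<beta> n * poly (hermite_poly n) y * (e * (- (\<beta>\<^sup>2 * x)))) (at x)"
    unfolding hermite_fun_def[abs_def] d_def e_def y_def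
    by (rule derivative_eq_intros refl | assumption | simp)+
  then show ?thesis
    by (rule DERIV_cong) (simp only: low high, simp add: y_def power2_eq_square algebra_simps)
qed

text \<open>A triangular system: a multiple of the basis polynomial of top degree cancels the
  leading coefficient.\<close>

lemma poly_expansion:
  fixes B :: "nat \<Rightarrow> 'a::field poly"
  assumes "\<And>n. degree (B n) = n" "\<And>n. B n \<noteq> 0"
  shows "degree p \<le> N \<Longrightarrow> \<exists>c. p = (\<Sum>n\<le>N. smult (c n) (B n))"
proof (induction N arbitrary: p)
  case 0
  obtain a b where "p = [:a:]" "B 0 = [:b:]" "b \<noteq> 0"
    using 0 assms(1)[of 0] assms(2)[of 0] by (metis degree_eq_zeroE le_zero_eq pCons_eq_0_iff)
  then show ?case by (intro exI[of _ "\<lambda>_. a / b"]) simp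
next
  case (Suc N)
  define a where "a = coeff p (Suc N) / lead_coeff (B (Suc N))"
  define q where "q = p - smult a (B (Suc N))"
  have lc: "coeff (B (Suc N)) (Suc N) \<noteq> 0" using assms by (metis leading_coeff_0_iff)
  have "coeff q i = 0" if "i > N" for i
  proof (cases "i = Suc N")
    case True
    then show ?thesis using lc by (simp add: q_def a_def assms)
  next
    case False
    then show ?thesis using that Suc.prems assms by (simp add: q_def coeff_eq_0)
  qed
  then have "degree q \<le> N" by (intro degree_le) auto
  with Suc.IH obtain c where "q = (\<Sum>n\<le>N. smult (c n) (B n))" by blast
  then have "p = (\<Sum>n\<le>Suc N. smult ((c(Suc N := a)) n) (B n))"
    by (simp add: q_def algebra_simps)
  then show ?case by blast
qed

lemma Pspace_eq_hermite_span:
  assumes "\<beta> > 0"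
  shows "Pspace \<beta> N = {(\<lambda>x. \<Sum>n\<le>N. c n * hermite \<beta> n x) | c. True}"
proof -
  define B where "B = (\<lambda>n. smult (complex_of_real (hermite_const \<beta> n))
     (pcompose (map_poly complex_of_real (hermite_poly n)) [:0, complex_of_real \<beta>:]))"
  have nz: "hermite_poly n \<noteq> 0" for n using degree_hermite_poly[of n] by auto
  have degB: "degree (B n) = n" for n
    using hermite_const_pos[OF assms, of n] assms degree_hermite_poly[of n]
    by (simp add: B_def degree_pcompose degree_map_poly)
  have nzB: "B n \<noteq> 0" for n
    using hermite_const_pos[OF assms, of n] assms nz[of n]
    by (auto simp: B_def pcompose_eq_0_iff map_poly_eq_0_iff)
  have B: "hermite \<beta> n x = complex_of_real (exp (- (\<beta>\<^sup>2 * x\<^sup>2) / 2)) * poly (B n) (complex_of_real x)" for n x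
    using poly_map_poly_of_real[of "hermite_poly n" "x * \<beta>"]
    by (simp add: B_def hermite_fun_def poly_pcompose mult_ac)
  have sumB: "(\<Sum>n\<le>N. c n * hermite \<beta> n x) = complex_of_real (exp (- (\<beta>\<^sup>2 * x\<^sup>2) / 2)) * poly (\<Sum>n\<le>N. smult (c n) (B n)) (complex_of_real x)" for c x
    by (simp add: B poly_sum sum_distrib_left mult.left_commute)
  show ?thesis
  proof (intro equalityI subsetI)
    fix v assume "v \<in> Pspace \<beta> N"
    then obtain p where p: "degree p \<le> N" "v = (\<lambda>x. complex_of_real (exp (- (\<beta>\<^sup>2 * x\<^sup>2) / 2)) * poly p (complex_of_real x))"
      unfolding Pspace_def by blast
    obtain c where "p = (\<Sum>n\<le>N. smult (c n) (B n))" using poly_expansion[OF degB nzB p(1)] by blast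
    then have "v = (\<lambda>x. \<Sum>n\<le>N. c n * hermite \<beta> n x)" unfolding sumB p(2) by simp
    then show "v \<in> {(\<lambda>x. \<Sum>n\<le>N. c n * hermite \<beta> n x) | c. True}" by blast
  next
    fix v assume "v \<in> {(\<lambda>x. \<Sum>n\<le>N. c n * hermite \<beta> n x) | c. True}"
    then obtain c where c: "v = (\<lambda>x. \<Sum>n\<le>N. c n * hermite \<beta> n x)" by blast
    have "degree (\<Sum>n\<le>N. smult (c n) (B n)) \<le> N"
      by (intro degree_sum_le) (auto simp: degB intro: order_trans[OF degree_smult_le])
    then show "v \<in> Pspace \<beta> N" unfolding c sumB Pspace_def by blast
  qed
qed

lemma in_L2_hermite_sum: "\<beta> > 0 \<Longrightarrow> in_L2 (\<lambda>x. \<Sum>n\<in>A. c n * hermite \<beta> n x)"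
  by (intro in_L2_sum in_L2_cmult in_L2_hermite)

lemma L2inner_hermite_sum:
  assumes "\<beta> > 0"
  shows "L2inner (\<lambda>x. \<Sum>n\<le>N. c n * hermite \<beta> n x) (hermite \<beta> m) = (if m \<le> N then c m else 0)"
  by (subst L2inner_sum_left) (auto intro!: in_L2_hermite assms simp: hermite_orthonormal[OF assms] if_distrib[of "\<lambda>z. _ * z"] cong: if_cong)

text \<open>\<open>proj\<close> is a definite description, so uniqueness must be shown as well:
  testing a candidate against each Hermite function of index at most N fixes all its
  coefficients.\<close>

lemma proj_eq_hermite_sum:
  assumes \<beta>: "\<beta> > 0" and u: "in_L2 u"
  shows "proj \<beta> N u = (\<lambda>x. \<Sum>n\<le>N. L2inner u (hermite \<beta> n) * hermite \<beta> n x)"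
  unfolding Defs.proj_def
proof (rule the_equality)
  define w where "w = (\<lambda>x. \<Sum>n\<le>N. L2inner u (hermite \<beta> n) * hermite \<beta> n x)"
  have wL2: "in_L2 w" unfolding w_def by (rule in_L2_hermite_sum[OF \<beta>])
  have orth: "L2inner (\<lambda>x. u x - w x) (hermite \<beta> n) = 0" if "n \<le> N" for n
    using that L2inner_hermite_sum[OF \<beta>, where N = N and c = "\<lambda>n. L2inner u (hermite \<beta> n)" and m = n]
    unfolding L2inner_diff_left[OF u wL2 in_L2_hermite[OF \<beta>]] by (simp add: w_def)
  have "L2inner (\<lambda>x. u x - w x) p = 0" if "p \<in> Pspace \<beta> N" for p
  proof -
    from that obtain c where "p = (\<lambda>x. \<Sum>n\<le>N. c n * hermite \<beta> n x)"
      unfolding Pspace_eq_hermite_span[OF \<beta>] by blast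
    then show ?thesis
      by (simp add: L2inner_sum_right in_L2_hermite[OF \<beta>] in_L2_diff[OF u wL2] orth)
  qed
  moreover have "w \<in> Pspace \<beta> N" 
    unfolding Pspace_eq_hermite_span[OF \<beta>] w_def
    by (intro CollectI exI[of _ "\<lambda>n. L2inner u (hermite \<beta> n)"]) simp
  ultimately show "(\<lambda>x. \<Sum>n\<le>N. L2inner u (hermite \<beta> n) * hermite \<beta> n x) \<in> Pspace \<beta> N \<and>
     (\<forall>p\<in>Pspace \<beta> N. L2inner (\<lambda>x. u x - (\<Sum>n\<le>N. L2inner u (hermite \<beta> n) * hermite \<beta> n x)) p = 0)"
    unfolding w_def by blast
next
  fix v assume v: "v \<in> Pspace \<beta> N \<and> (\<forall>p\<in>Pspace \<beta> N. L2inner (\<lambda>x. u x - v x) p = 0)"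
  then obtain c where c: "v = (\<lambda>x. \<Sum>n\<le>N. c n * hermite \<beta> n x)"
    unfolding Pspace_eq_hermite_span[OF \<beta>] by blast
  have vL2: "in_L2 v" unfolding c by (rule in_L2_hermite_sum[OF \<beta>])
  have "c n = L2inner u (hermite \<beta> n)" if "n \<le> N" for n
  proof -
    have "hermite \<beta> n = (\<lambda>x. \<Sum>k\<le>N. (if k = n then 1 else 0) * hermite \<beta> k x)"
      using that by (simp add: if_distrib[of "\<lambda>c. c * _"] cong: if_cong)
    then have "hermite \<beta> n \<in> Pspace \<beta> N"
      unfolding Pspace_eq_hermite_span[OF \<beta>]
      by (intro CollectI exI[of _ "\<lambda>k. if k = n then 1 else 0"] conjI TrueI)
    then have "L2inner (\<lambda>x. u x - v x) (hermite \<beta> n) = 0" using v by blast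
    then show ?thesis
      using that L2inner_hermite_sum[OF \<beta>, where N = N and c = c and m = n]
      unfolding L2inner_diff_left[OF u vL2 in_L2_hermite[OF \<beta>]] by (simp add: c)
  qed
  then show "v = (\<lambda>x. \<Sum>n\<le>N. L2inner u (hermite \<beta> n) * hermite \<beta> n x)"
    unfolding c by simp
qed

subsection \<open>Wave packets and a smooth cutoff\<close>

text \<open>A coherent state: its width 1/\<beta> is that of the lowest Hermite function. It is
  normalised in L^1 and not in L^2, so that its modulus at a fixed point x integrates to 1 over all
  centres q.\<close>

definition gabor :: "real \<Rightarrow> real \<Rightarrow> real \<Rightarrow> real \<Rightarrow> complex" where
  "gabor \<beta> q k x = complex_of_real (normal_density q (1 / \<beta>) x) * cis (k * x)"

lemma borel_measurable_gabor [measurable]: "gabor \<beta> q k \<in> borel_measurable borel"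
  unfolding gabor_def[abs_def] by measurable

lemma norm_gabor: "cmod (gabor \<beta> q k x) = normal_density q (1 / \<beta>) x"
  by (simp add: gabor_def norm_mult)

lemma gabor_L2:
  assumes "\<beta> > 0"
  shows "in_L2 (gabor \<beta> q k)" "(L2norm (gabor \<beta> q k))\<^sup>2 = \<beta> / (2 * sqrt pi)"
proof -
  have eq: "(cmod (gabor \<beta> q k x))\<^sup>2 = \<beta> / (2 * sqrt pi) * normal_density q (1 / (sqrt 2 * \<beta>)) x" for x
  proof -
    have "(exp (- (x - q)\<^sup>2 / (2 * (1 / \<beta>)\<^sup>2)))\<^sup>2 = exp (- (x - q)\<^sup>2 / (2 * (1 / (sqrt 2 * \<beta>))\<^sup>2))"
      by (simp add: power2_eq_square exp_add[symmetric] mult.assoc)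
    moreover have "(1 / sqrt (2 * pi * (1 / \<beta>)\<^sup>2))\<^sup>2 = \<beta> / (2 * sqrt pi) * (1 / sqrt (2 * pi * (1 / (sqrt 2 * \<beta>))\<^sup>2))"
      using assms by (simp add: power_divide power_mult_distrib real_sqrt_divide real_sqrt_mult real_div_sqrt power2_eq_square field_simps)
    ultimately show ?thesis
      unfolding norm_gabor normal_density_def power_mult_distrib by (simp only: mult.assoc)
  qed
  show "in_L2 (gabor \<beta> q k)"
    unfolding in_L2_def eq using assms by auto
  show "(L2norm (gabor \<beta> q k))\<^sup>2 = \<beta> / (2 * sqrt pi)"
    unfolding L2norm_power2 eq using assms by simp
qed

text \<open>The product of packet and Hermite function is a Hermite polynomial times one Gaussian
  whose complex slope b encodes the phase-space point, so its integral is b^n times a Gaussian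
  value.\<close>

lemma gabor_hermite_inner:
  fixes \<beta> q k :: real
  assumes \<beta>: "\<beta> > 0" and b: "b = Complex (\<beta> * q) (k / \<beta>)"
  shows "L2inner (gabor \<beta> q k) (hermite \<beta> n) = 
    complex_of_real (1 / sqrt 2 * hermite_const \<beta> n * exp (- (\<beta> * q)\<^sup>2 / 2)) * (b ^ n * exp (b\<^sup>2 / 4))"
proof -
  define F where "F = (\<lambda>y. complex_of_real (poly (hermite_poly n) y) * cgauss 1 b y)"
  define c where "c = \<beta> / sqrt (2 * pi) * hermite_const \<beta> n * exp (- (\<beta> * q)\<^sup>2 / 2)"
  have nd: "normal_density q (1 / \<beta>) x = \<beta> / sqrt (2 * pi) * exp (- (\<beta> * (x - q))\<^sup>2 / 2)" for x
    using \<beta> by (simp add: normal_density_def real_sqrt_divide real_sqrt_mult power_divide power_mult_distrib mult_ac)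
  have eq: "gabor \<beta> q k x * cnj (hermite \<beta> n x) = complex_of_real c * F (\<beta> * x)" for x
  proof -
    have "complex_of_real (exp (- (\<beta> * (x - q))\<^sup>2 / 2)) * cis (k * x) * complex_of_real (exp (- (\<beta>\<^sup>2 * x\<^sup>2) / 2)) = 
      complex_of_real (exp (- (\<beta> * q)\<^sup>2 / 2)) * cgauss 1 b (\<beta> * x)"
    proof -
      have "- (\<beta> * (x - q))\<^sup>2 / 2 + - (\<beta>\<^sup>2 * x\<^sup>2) / 2 = - (\<beta> * q)\<^sup>2 / 2 + (- (1 * (\<beta> * x)\<^sup>2) + \<beta> * q * (\<beta> * x))"
        by (simp add: power2_eq_square field_simps)
      then have r: "complex_of_real (- (\<beta> * (x - q))\<^sup>2 / 2) + complex_of_real (- (\<beta>\<^sup>2 * x\<^sup>2) / 2) = 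
         complex_of_real (- (\<beta> * q)\<^sup>2 / 2) + (complex_of_real (- (1 * (\<beta> * x)\<^sup>2)) + complex_of_real (\<beta> * q * (\<beta> * x)))"
        by (simp only: of_real_add[symmetric])
      have bx: "b * complex_of_real (\<beta> * x) = complex_of_real (\<beta> * q * (\<beta> * x)) + \<i> * complex_of_real (k * x)"
        using \<beta> by (simp add: b complex_eq_iff)
      show ?thesis
        unfolding cgauss_def cis_conv_exp exp_of_real[symmetric] exp_add[symmetric] bx
        using r by (intro arg_cong[of _ _ exp]) (simp only: add_ac)
    qed
    note main = this
    have "a * e\<^sub>1 * c * (h * p * e\<^sub>2) = a * h * e\<^sub>3 * (p * g)" if "e\<^sub>1 * c * e\<^sub>2 = e\<^sub>3 * g"
      for a e\<^sub>1 c h p e\<^sub>2 e\<^sub>3 g :: complex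
    proof -
      have "a * e\<^sub>1 * c * (h * p * e\<^sub>2) = a * h * p * (e\<^sub>1 * c * e\<^sub>2)" by (simp only: mult_ac)
      then show ?thesis unfolding that by (simp only: mult_ac)
    qed
    from this[OF main] show ?thesis
      unfolding gabor_def nd hermite_fun_def F_def c_def of_real_mult complex_cnj_mult complex_cnj_complex_of_real .
  qed
  have "(LINT x|lborel. F x) = \<beta> *\<^sub>R (LINT x|lborel. F (\<beta> * x))"
    using lborel_integral_real_affine[of \<beta> F 0] \<beta> by simp
  then have "(LINT x|lborel. F (\<beta> * x)) = complex_of_real (1 / \<beta>) * (LINT x|lborel. F x)"
    using \<beta> by (simp add: scaleR_conv_of_real)
  moreover have "(LINT x|lborel. F x) = b ^ n * (complex_of_real (sqrt pi) * exp (b\<^sup>2 / 4))"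
    unfolding F_def hermite_poly_cgauss_integral using cgauss_integral[of 1 b] by simp
  moreover have "L2inner (gabor \<beta> q k) (hermite \<beta> n) = complex_of_real c * (LINT x|lborel. F (\<beta> * x))"
    unfolding L2inner_def eq by (rule integral_mult_right_zero)
  ultimately have "L2inner (gabor \<beta> q k) (hermite \<beta> n) = 
    complex_of_real c * complex_of_real (1 / \<beta>) * complex_of_real (sqrt pi) * (b ^ n * exp (b\<^sup>2 / 4))"
    by (simp only: mult_ac)
  moreover have "c * (1 / \<beta>) * sqrt pi = 1 / sqrt 2 * hermite_const \<beta> n * exp (- (\<beta> * q)\<^sup>2 / 2)"
    using \<beta> by (simp add: c_def real_sqrt_mult)
  then have "complex_of_real c * complex_of_real (1 / \<beta>) * complex_of_real (sqrt pi) = 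
     complex_of_real (1 / sqrt 2 * hermite_const \<beta> n * exp (- (\<beta> * q)\<^sup>2 / 2))"
    by (simp only: of_real_mult[symmetric])
  ultimately show ?thesis by (simp only:)
qed

text \<open>Since |b|^2 = 2l, the powers of 2 cancel against the normalisation and leave the Poisson
  weights of mean l, scaled by the squared norm of the packet.\<close>

lemma gabor_hermite_coeff:
  fixes \<beta> q k :: real
  assumes \<beta>: "\<beta> > 0" and l: "l = ((\<beta> * q)\<^sup>2 + (k / \<beta>)\<^sup>2) / 2"
  shows "(cmod (L2inner (gabor \<beta> q k) (hermite \<beta> n)))\<^sup>2 = \<beta> / (2 * sqrt pi) * (exp (- l) * l ^ n / fact n)"
proof -
  define b where "b = Complex (\<beta> * q) (k / \<beta>)"
  have nb: "(cmod b)\<^sup>2 = 2 * l" by (simp add: b_def cmod_power2 l)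
  have re: "Re (b\<^sup>2) = (\<beta> * q)\<^sup>2 - (k / \<beta>)\<^sup>2" by (simp add: b_def power2_eq_square)
  have "(cmod (L2inner (gabor \<beta> q k) (hermite \<beta> n)))\<^sup>2 = 
     (1 / sqrt 2)\<^sup>2 * (hermite_const \<beta> n)\<^sup>2 * (exp (- (\<beta> * q)\<^sup>2 / 2))\<^sup>2 * (((cmod b)\<^sup>2) ^ n * (exp (Re (b\<^sup>2) / 4))\<^sup>2)"
    unfolding gabor_hermite_inner[OF \<beta> b_def] norm_mult norm_of_real norm_power power_mult_distrib power2_abs norm_exp_eq_Re
    by (simp add: power_mult[symmetric] mult.commute)
  also have "\<dots> = 1 / 2 * (hermite_const \<beta> n)\<^sup>2 * (2 * l) ^ n * ((exp (- (\<beta> * q)\<^sup>2 / 2))\<^sup>2 * (exp (Re (b\<^sup>2) / 4))\<^sup>2)"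
    unfolding nb by (simp add: power_divide)
  also have "(exp (- (\<beta> * q)\<^sup>2 / 2))\<^sup>2 * (exp (Re (b\<^sup>2) / 4))\<^sup>2 = exp (- l)"
    unfolding re l by (simp add: power2_eq_square[of "exp _"] exp_add[symmetric] field_simps)
  finally show ?thesis
    unfolding hermite_const_power2[OF \<beta>] using \<beta> by (simp add: power_mult_distrib mult_ac)
qed

text \<open>As v does not see the first K modes, g may be replaced by its component orthogonal to
  them. Pythagoras gives the norm of that component, and Cauchy-Schwarz concludes.\<close>

lemma Bessel_remainder:
  assumes \<beta>: "\<beta> > 0" and v: "in_L2 v" and g: "in_L2 g" 
    and orth: "\<And>n. n < K \<Longrightarrow> L2inner v (hermite \<beta> n) = 0"
  shows "(cmod (L2inner v g))\<^sup>2 \<le> 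
    (L2norm v)\<^sup>2 * ((L2norm g)\<^sup>2 - (\<Sum>n<K. (cmod (L2inner g (hermite \<beta> n)))\<^sup>2))"
proof -
  define c where "c = (\<lambda>n. L2inner g (hermite \<beta> n))"
  define s where "s = (\<lambda>x. \<Sum>n<K. c n * hermite \<beta> n x)"
  define w where "w = (\<lambda>x. g x - s x)"
  have s: "in_L2 s" unfolding s_def by (rule in_L2_hermite_sum[OF \<beta>])
  have w: "in_L2 w" unfolding w_def by (rule in_L2_diff[OF g s])
  have s_inner: "L2inner z s = (\<Sum>n<K. cnj (c n) * L2inner z (hermite \<beta> n))" if "in_L2 z" for z
    unfolding s_def by (rule L2inner_sum_right) (use that in_L2_hermite[OF \<beta>] in auto)
  have w_inner: "L2inner z w = L2inner z g - L2inner z s" if "in_L2 z" for z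
    using arg_cong[OF L2inner_diff_left[OF g s that], where f = cnj] by (simp add: L2inner_cnj w_def)
  have vs: "L2inner v s = 0" unfolding s_inner[OF v] by (simp add: orth)
  have "L2inner s (hermite \<beta> n) = c n" if "n < K" for n
    unfolding s_def using that
    by (subst L2inner_sum_left) (auto intro!: in_L2_hermite \<beta> simp: hermite_orthonormal[OF \<beta>] if_distrib[of "\<lambda>z. _ * z"] cong: if_cong)
  then have "L2inner w (hermite \<beta> n) = 0" if "n < K" for n
    unfolding w_def L2inner_diff_left[OF g s in_L2_hermite[OF \<beta>]] using that by (simp add: c_def)
  then have ws: "L2inner w s = 0" unfolding s_inner[OF w] by simp
  have "L2inner w w = L2inner w g" using w_inner[OF w] ws by simp
  also have "\<dots> = cnj (L2inner g w)" by (simp add: L2inner_cnj)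
  also have "L2inner g w = L2inner g g - (\<Sum>n<K. cnj (c n) * c n)"
    unfolding w_inner[OF g] s_inner[OF g] c_def by simp
  also have "(\<Sum>n<K. cnj (c n) * c n) = complex_of_real (\<Sum>n<K. (cmod (c n))\<^sup>2)"
    by (simp only: of_real_sum complex_norm_square mult.commute)
  finally have "complex_of_real ((L2norm w)\<^sup>2) = complex_of_real ((L2norm g)\<^sup>2 - (\<Sum>n<K. (cmod (c n))\<^sup>2))"
    unfolding L2inner_self by simp
  then have nw: "(L2norm w)\<^sup>2 = (L2norm g)\<^sup>2 - (\<Sum>n<K. (cmod (c n))\<^sup>2)"
    by (simp only: of_real_eq_iff)
  have "L2inner v g = L2inner v w" using w_inner[OF v] vs by simp
  then have "(cmod (L2inner v g))\<^sup>2 \<le> (L2norm v * L2norm w)\<^sup>2"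
    using Cauchy_Schwarz_L2[OF v w] by (intro power_mono) auto
  then show ?thesis unfolding power_mult_distrib nw c_def .
qed

text \<open>Chernoff's bound with parameter 2: for n >= K the power l^n is at most (2l)^n / 2^K, and
  the enlarged series sums to at most exp (2l).\<close>

lemma exp_tail_bound:
  fixes l :: real
  assumes "l \<ge> 0"
  shows "1 - (\<Sum>n<K. exp (- l) * l ^ n / fact n) \<le> exp l / 2 ^ K"
proof -
  have exp_series: "(\<lambda>n. x ^ n / fact n) sums exp x" for x :: real
    using exp_converges[of x] by (simp add: divide_inverse mult.commute)
  define a b where "a = (\<lambda>n. l ^ n / fact n)" and "b = (\<lambda>n. (2 * l) ^ n / fact n)"
  have a: "summable a" "suminf a = exp l" and b: "summable b" "suminf b = exp (2 * l)"
    using exp_series[of l] exp_series[of "2 * l"] by (auto simp: a_def b_def sums_iff)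
  have b_nonneg: "0 \<le> (\<Sum>n<K. b n)" using assms by (intro sum_nonneg) (simp add: b_def)
  have "exp l - (\<Sum>n<K. a n) = (\<Sum>n. a (n + K))"
    using suminf_split_initial_segment[OF a(1), of K] a(2) by simp
  also have "\<dots> \<le> (\<Sum>n. b (n + K) / 2 ^ K)"
  proof (rule suminf_le)
    show "a (n + K) \<le> b (n + K) / 2 ^ K" for n
    proof -
      have "b (n + K) / 2 ^ K = 2 ^ n * a (n + K)"
        by (simp add: a_def b_def power_mult_distrib power_add)
      moreover have "1 * a (n + K) \<le> 2 ^ n * a (n + K)"
        using assms by (intro mult_right_mono) (auto simp: a_def)
      ultimately show ?thesis by simp
    qed
  qed (use a b in \<open>auto intro!: summable_divide simp: summable_iff_shift\<close>)
  also have "\<dots> = (\<Sum>n. b (n + K)) / 2 ^ K"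
    using b by (intro suminf_divide) (simp add: summable_iff_shift)
  also have "(\<Sum>n. b (n + K)) \<le> exp (2 * l)"
    using suminf_split_initial_segment[OF b(1), of K] b(2) b_nonneg by linarith
  finally have "exp l - (\<Sum>n<K. a n) \<le> exp (2 * l) / 2 ^ K"
    by (simp add: divide_right_mono)
  then have "exp (- l) * (exp l - (\<Sum>n<K. a n)) \<le> exp (- l) * (exp (2 * l) / 2 ^ K)"
    by (intro mult_left_mono) auto
  also have "exp (- l) * (exp (2 * l) / 2 ^ K) = exp l / 2 ^ K"
    by (simp add: exp_add[symmetric])
  also have "exp (- l) * (exp l - (\<Sum>n<K. a n)) = 1 - (\<Sum>n<K. exp (- l) * l ^ n / fact n)"
    by (simp add: a_def right_diff_distrib sum_distrib_left exp_add[symmetric])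
  finally show ?thesis .
qed

text \<open>For a wave packet the Bessel remainder is a Poisson tail. Its bound through exp l
  increases with the mean, so it is uniform over a whole region of phase space.\<close>

lemma gabor_inner_bound:
  assumes \<beta>: "\<beta> > 0" and v: "in_L2 v" 
    and orth: "\<And>n. n < K \<Longrightarrow> L2inner v (hermite \<beta> n) = 0"
    and l: "((\<beta> * q)\<^sup>2 + (k / \<beta>)\<^sup>2) / 2 \<le> l"
  shows "cmod (L2inner v (gabor \<beta> q k)) \<le> L2norm v * sqrt (\<beta> / (2 * sqrt pi) * (exp l / 2 ^ K))"
proof -
  define l' where "l' = ((\<beta> * q)\<^sup>2 + (k / \<beta>)\<^sup>2) / 2"
  define C where "C = \<beta> / (2 * sqrt pi)"
  have C: "C \<ge> 0" using \<beta> by (simp add: C_def)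
  have "(cmod (L2inner v (gabor \<beta> q k)))\<^sup>2 \<le> (L2norm v)\<^sup>2 * (C - (\<Sum>n<K. C * (exp (- l') * l' ^ n / fact n)))"
    using Bessel_remainder[OF \<beta> v gabor_L2(1)[OF \<beta>, of q k] orth]
    unfolding gabor_hermite_coeff[OF \<beta> l'_def] gabor_L2(2)[OF \<beta>] C_def .
  also have "C - (\<Sum>n<K. C * (exp (- l') * l' ^ n / fact n)) = C * (1 - (\<Sum>n<K. exp (- l') * l' ^ n / fact n))"
    by (simp add: right_diff_distrib sum_distrib_left)
  also have "1 - (\<Sum>n<K. exp (- l') * l' ^ n / fact n) \<le> exp l' / 2 ^ K"
    by (rule exp_tail_bound) (simp add: l'_def)
  also have "exp l' / 2 ^ K \<le> exp l / 2 ^ K" using l by (simp add: l'_def divide_right_mono)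
  finally have "(cmod (L2inner v (gabor \<beta> q k)))\<^sup>2 \<le> (L2norm v)\<^sup>2 * (C * (exp l / 2 ^ K))"
    using C by (simp add: mult_left_mono)
  then have "sqrt ((cmod (L2inner v (gabor \<beta> q k)))\<^sup>2) \<le> sqrt ((L2norm v)\<^sup>2 * (C * (exp l / 2 ^ K)))"
    by (rule real_sqrt_le_mono)
  then show ?thesis unfolding real_sqrt_mult[of "(L2norm v)\<^sup>2"] by (simp add: C_def)
qed

section \<open>The indicator of an interval mollified by a Gaussian of width 1/\<beta>\<close>

definition window :: "real \<Rightarrow> real \<Rightarrow> real \<Rightarrow> real" where
  "window \<beta> a x = (LINT q|lborel. indicator {-a..a} q * normal_density q (1 / \<beta>) x)"

lemma normal_density_swap: "normal_density q \<sigma> x = normal_density x \<sigma> q"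
  by (simp add: normal_density_def power2_commute)

lemma borel_measurable_window [measurable]: "window \<beta> a \<in> borel_measurable borel"
  unfolding window_def[abs_def]
  by (rule lborel.borel_measurable_lebesgue_integral) (unfold normal_density_def, measurable)

lemma window_integrable:
  assumes "\<beta> > 0"
  shows "integrable lborel (\<lambda>q. indicator {-a..a} q * normal_density q (1 / \<beta>) x)"
  unfolding normal_density_swap[of _ _ x]
  by (rule integrable_dominated[OF integrable_normal_density[of "1 / \<beta>" x]])
     (use assms in \<open>auto split: split_indicator\<close>)

lemma window_bounds:
  assumes "\<beta> > 0"
  shows "0 \<le> window \<beta> a x" "window \<beta> a x \<le> 1"
proof -
  show "0 \<le> window \<beta> a x" unfolding window_def by (intro integral_nonneg_AE) auto
  have "window \<beta> a x \<le> (LINT q|lborel. normal_density x (1 / \<beta>) q)"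
    unfolding window_def using window_integrable[OF assms, of a x] assms
    by (intro integral_mono) (auto simp: normal_density_swap[of _ _ x] split: split_indicator)
  then show "window \<beta> a x \<le> 1" using assms by simp
qed

text \<open>If q > 2M, then q - x >= M and hence (q - x)^2 >= M^2 + (q - x - M)^2; symmetrically on
  the left. So outside the interval the density is at most exp(-(\<beta> M)^2/2) times a shifted
  density of mass 1, one for each side, which explains the factor 2.\<close>

lemma one_minus_window_le:
  assumes \<beta>: "\<beta> > 0" and x: "\<bar>x\<bar> \<le> M"
  shows "1 - window \<beta> (2 * M) x \<le> 2 * exp (- (\<beta> * M)\<^sup>2 / 2)"
proof -
  define nd where "nd = (\<lambda>\<mu> q. normal_density \<mu> (1 / \<beta>) q)"
  define E where "E = exp (- (\<beta> * M)\<^sup>2 / 2)"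
  have int: "integrable lborel (nd \<mu>)" for \<mu> unfolding nd_def using \<beta> by simp
  have one: "(LINT q|lborel. nd \<mu> q) = 1" for \<mu> unfolding nd_def using \<beta> by simp
  have intw: "integrable lborel (\<lambda>q. indicator {-(2*M)..2*M} q * nd x q)"
    using window_integrable[OF \<beta>, of "2 * M" x] by (simp add: nd_def normal_density_swap[of _ _ x])
  have nd_le: "nd x q \<le> E * nd \<mu> q" if "M\<^sup>2 + (q - \<mu>)\<^sup>2 \<le> (q - x)\<^sup>2" for \<mu> q
  proof -
    have "- (q - x)\<^sup>2 / (2 * (1 / \<beta>)\<^sup>2) \<le> - (\<beta> * M)\<^sup>2 / 2 + - (q - \<mu>)\<^sup>2 / (2 * (1 / \<beta>)\<^sup>2)"
      using mult_left_mono[OF that, of "\<beta>\<^sup>2"] \<beta> by (simp add: power_divide power_mult_distrib field_simps)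
    then have "exp (- (q - x)\<^sup>2 / (2 * (1 / \<beta>)\<^sup>2)) \<le> E * exp (- (q - \<mu>)\<^sup>2 / (2 * (1 / \<beta>)\<^sup>2))"
      unfolding E_def exp_add[symmetric] by simp
    then show ?thesis unfolding nd_def normal_density_def
      using mult_left_mono[of _ _ "1 / sqrt (2 * pi * (1 / \<beta>)\<^sup>2)"] by (simp add: mult_ac divide_right_mono)
  qed
  have "1 - window \<beta> (2 * M) x = (LINT q|lborel. nd x q - indicator {-(2*M)..2*M} q * nd x q)"
    using one int intw by (simp add: window_def nd_def normal_density_swap[of _ _ x])
  also have "\<dots> \<le> (LINT q|lborel. E * (nd (x + M) q + nd (x - M) q))"
  proof (rule integral_mono)
    fix q
    have E: "E \<ge> 0" and nn: "nd \<mu> q \<ge> 0" for \<mu> by (auto simp: E_def nd_def)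
    show "nd x q - indicator {-(2*M)..2*M} q * nd x q \<le> E * (nd (x + M) q + nd (x - M) q)"
    proof (cases "q \<in> {-(2*M)..2*M}")
      case True
      then show ?thesis using E nn by (simp add: add_nonneg_nonneg)
    next
      case False
      then consider "q > 2 * M" | "q < - (2 * M)" by force
      then have "nd x q \<le> E * nd (x + M) q \<or> nd x q \<le> E * nd (x - M) q"
      proof cases
        case 1
        have "0 \<le> 2 * M * ((q - x) - M)" using 1 x by (intro mult_nonneg_nonneg) auto
        then have "M\<^sup>2 + (q - (x + M))\<^sup>2 \<le> (q - x)\<^sup>2" by (simp add: power2_eq_square algebra_simps)
        then show ?thesis using nd_le by blast
      next
        case 2
        have "0 \<le> 2 * M * ((x - q) - M)" using 2 x by (intro mult_nonneg_nonneg) auto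
        then have "M\<^sup>2 + (q - (x - M))\<^sup>2 \<le> (q - x)\<^sup>2" by (simp add: power2_eq_square algebra_simps)
        then show ?thesis using nd_le by blast
      qed
      moreover have "0 \<le> E * nd (x + M) q" "0 \<le> E * nd (x - M) q" using E nn by auto
      ultimately show ?thesis using False by (auto simp: distrib_left)
    qed
  qed (use int intw in auto)
  also have "\<dots> = 2 * E" using int one by simp
  finally show ?thesis by (simp add: E_def)
qed

text \<open>Although v is only square-integrable, Cauchy-Schwarz bounds the integral over x
  uniformly in q, and q ranges over a bounded interval.\<close>

lemma window_pair_integrable:
  assumes \<beta>: "\<beta> > 0" and v: "in_L2 v"
  shows "integrable (lborel \<Otimes>\<^sub>M lborel) (\<lambda>(q, x). indicator {-a..a} q *\<^sub>R (v x * cnj (gabor \<beta> q k x)))"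
proof (rule lborel_pair.Fubini_integrable)
  note [measurable] = in_L2_measurable[OF v]
  have [measurable]: "(\<lambda>(q, x). gabor \<beta> q k x) \<in> borel_measurable (lborel \<Otimes>\<^sub>M lborel)"
    unfolding gabor_def normal_density_def by measurable
  show "(\<lambda>(q, x). indicator {-a..a} q *\<^sub>R (v x * cnj (gabor \<beta> q k x))) \<in> borel_measurable (lborel \<Otimes>\<^sub>M lborel)"
    by measurable
  define C where "C = L2norm v * sqrt (\<beta> / (2 * sqrt pi))"
  have bd: "(LINT x|lborel. cmod (v x) * cmod (gabor \<beta> q k x)) \<le> C" for q
    using Cauchy_Schwarz_L2_norm[OF v gabor_L2(1)[OF \<beta>, of q k]] 
    unfolding C_def gabor_L2(2)[OF \<beta>, of q k, symmetric] by simp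
  have "integrable lborel (\<lambda>q. indicator {-a..a} q * C)"
    by (intro integrable_mult_left integrable_real_indicator) (auto simp: emeasure_lborel_Icc_eq)
  then show "integrable lborel (\<lambda>q. LINT x|lborel. norm (case (q, x) of (q, x) \<Rightarrow> indicator {-a..a} q *\<^sub>R (v x * cnj (gabor \<beta> q k x))))"
  proof (rule integrable_dominated)
    show "norm (LINT x|lborel. norm (case (q, x) of (q, x) \<Rightarrow> indicator {-a..a} q *\<^sub>R (v x * cnj (gabor \<beta> q k x)))) \<le> indicator {-a..a} q * C" for q
      using bd[of q] by (auto simp: norm_mult split: split_indicator)
  qed measurable
  show "AE q in lborel. integrable lborel (\<lambda>x. case (q, x) of (q, x) \<Rightarrow> indicator {-a..a} q *\<^sub>R (v x * cnj (gabor \<beta> q k x)))"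
    using in_L2_integrable_inner[OF v gabor_L2(1)[OF \<beta>]] by (auto intro!: integrable_scaleR_right)
qed

lemma window_mult:
  assumes \<beta>: "\<beta> > 0"
  shows "(LINT q|lborel. indicator {-a..a} q *\<^sub>R (v x * cnj (gabor \<beta> q k x))) = 
    complex_of_real (window \<beta> a x) * v x * cis (- (k * x))"
proof -
  have "(LINT q|lborel. indicator {-a..a} q *\<^sub>R (v x * cnj (gabor \<beta> q k x))) = 
    (LINT q|lborel. complex_of_real (indicator {-a..a} q * normal_density q (1 / \<beta>) x) * (v x * cis (- (k * x))))"
    by (intro Bochner_Integration.integral_cong) (auto simp: gabor_def cis_cnj scaleR_conv_of_real mult_ac)
  also have "\<dots> = complex_of_real (window \<beta> a x) * (v x * cis (- (k * x)))"
    unfolding window_def by (subst integral_mult_left_zero) (simp only: integral_complex_of_real)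
  finally show ?thesis by (simp only: mult.assoc)
qed

text \<open>Read off from the Fubini integrability at frequency k = 0; it makes the windowed
  function eligible for Plancherel.\<close>

lemma window_mult_integrable:
  assumes \<beta>: "\<beta> > 0" and v: "in_L2 v"
  shows "integrable lborel (\<lambda>x. complex_of_real (window \<beta> a x) * v x)"
  using lborel_pair.integrable_snd[OF window_pair_integrable[OF assms, of a 0]]
  unfolding window_mult[OF \<beta>] by simp

lemma window_mult_L2:
  assumes \<beta>: "\<beta> > 0" and v: "in_L2 v"
  shows "in_L2 (\<lambda>x. complex_of_real (window \<beta> a x) * v x)"
    "L2norm (\<lambda>x. complex_of_real (window \<beta> a x) * v x) \<le> L2norm v"
proof -
  note [measurable] = in_L2_measurable[OF v]
  have le: "cmod (complex_of_real (window \<beta> a x) * v x) \<le> cmod (v x)" for x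
    using window_bounds[OF \<beta>, of a x] by (simp add: norm_mult mult_left_le_one_le)
  show "in_L2 (\<lambda>x. complex_of_real (window \<beta> a x) * v x)"
    by (rule in_L2_dominated[OF v, where C = 1]) (use le in auto)
  show "L2norm (\<lambda>x. complex_of_real (window \<beta> a x) * v x) \<le> L2norm v"
    by (rule L2norm_mono[OF v]) (use le in auto)
qed

lemma fourier_window_mult:
  assumes \<beta>: "\<beta> > 0" and v: "in_L2 v"
  shows "fourier (\<lambda>x. complex_of_real (window \<beta> a x) * v x) k = 
    complex_of_real (1 / sqrt (2 * pi)) * (LINT q|lborel. indicator {-a..a} q *\<^sub>R L2inner v (gabor \<beta> q k))"
proof -
  have "(LINT x|lborel. complex_of_real (window \<beta> a x) * v x * cis (- (k * x))) = 
     (LINT x|lborel. (LINT q|lborel. indicator {-a..a} q *\<^sub>R (v x * cnj (gabor \<beta> q k x))))"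
    unfolding window_mult[OF \<beta>] ..
  also have "\<dots> = (LINT q|lborel. (LINT x|lborel. indicator {-a..a} q *\<^sub>R (v x * cnj (gabor \<beta> q k x))))"
    by (rule lborel_pair.Fubini_integral[OF window_pair_integrable[OF assms]])
  also have "\<dots> = (LINT q|lborel. indicator {-a..a} q *\<^sub>R L2inner v (gabor \<beta> q k))"
    unfolding L2inner_def by (simp only: integral_scaleR_right)
  finally show ?thesis unfolding fourier_def by simp
qed

text \<open>Every packet in the mixture has |q| <= a and |k| <= B, hence mean at most l. The
  q-integral contributes the length 2a, and 1 / sqrt (2 pi) <= 1/2 absorbs the 2.\<close>

lemma fourier_window_bound:
  assumes \<beta>: "\<beta> > 0" and v: "in_L2 v" and a: "a \<ge> 0"
    and orth: "\<And>n. n < K \<Longrightarrow> L2inner v (hermite \<beta> n) = 0"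
    and l: "((\<beta> * a)\<^sup>2 + (B / \<beta>)\<^sup>2) / 2 \<le> l" and k: "\<bar>k\<bar> \<le> B"
  shows "cmod (fourier (\<lambda>x. complex_of_real (window \<beta> a x) * v x) k) \<le> 
    a * (L2norm v * sqrt (\<beta> / (2 * sqrt pi) * (exp l / 2 ^ K)))"
proof -
  define D where "D = L2norm v * sqrt (\<beta> / (2 * sqrt pi) * (exp l / 2 ^ K))"
  have D: "D \<ge> 0" using \<beta> by (simp add: D_def)
  have bd: "cmod (indicator {-a..a} q *\<^sub>R L2inner v (gabor \<beta> q k)) \<le> indicator {-a..a} q * D" for q
  proof (cases "q \<in> {-a..a}")
    case True
    have "(\<beta> * q)\<^sup>2 \<le> (\<beta> * a)\<^sup>2" using True \<beta> 
      by (intro power2_le_iff_abs_le[THEN iffD2]) (auto simp: abs_mult a)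
    moreover have "(k / \<beta>)\<^sup>2 \<le> (B / \<beta>)\<^sup>2" using k \<beta> 
      by (intro power2_le_iff_abs_le[THEN iffD2]) (auto simp: abs_divide divide_right_mono)
    ultimately have "((\<beta> * q)\<^sup>2 + (k / \<beta>)\<^sup>2) / 2 \<le> l" using l by simp
    from gabor_inner_bound[OF \<beta> v orth this] True show ?thesis by (simp add: D_def)
  qed simp
  have intD: "integrable lborel (\<lambda>q. indicator {-a..a} q * D)"
    by (intro integrable_mult_left integrable_real_indicator) (auto simp: emeasure_lborel_Icc_eq)
  have "cmod (LINT q|lborel. indicator {-a..a} q *\<^sub>R L2inner v (gabor \<beta> q k)) \<le> (LINT q|lborel. indicator {-a..a} q * D)"
  proof (rule order_trans[OF integral_norm_bound integral_mono'])
    show "integrable lborel (\<lambda>q. indicator {-a..a} q * D)" by (rule intD)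
  qed (use bd D in auto)
  also have "\<dots> = 2 * a * D" using a by simp
  finally have "cmod (fourier (\<lambda>x. complex_of_real (window \<beta> a x) * v x) k) \<le> 1 / sqrt (2 * pi) * (2 * a * D)"
    unfolding fourier_window_mult[OF \<beta> v] norm_mult
    by (intro mult_mono) (auto simp: norm_divide)
  also have "1 / sqrt (2 * pi) \<le> 1 / 2"
    using pi_gt3 by (intro divide_left_mono) (auto intro!: real_le_rsqrt)
  finally show ?thesis unfolding D_def[symmetric] using a D by (simp add: mult_right_mono)
qed

subsection \<open>The error bound for functions orthogonal to low Hermite modes\<close>

text \<open>The square of N is paid for by exp(N/5), and 2^N is bounded below using ln 2 >= 2/3;
  then 1/5 + 5/16 - 2/3 = -37/240 lies below -1/8. The right-hand side is the square of 10
  exp(-N/16).\<close>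

lemma frequency_decay_numeric:
  assumes "N \<ge> 1"
  shows "(real N)\<^sup>2 * (exp (5 * real N / 16) / 2 ^ N) \<le> 100 * exp (- real N / 8)"
proof -
  have "real N \<le> 10 * exp (real N / 10)"
    using exp_ge_add_one_self[of "real N / 10"] by linarith
  then have "(real N)\<^sup>2 \<le> (10 * exp (real N / 10))\<^sup>2" by (intro power_mono) auto
  also have "\<dots> = 100 * exp (real N / 5)" by (simp add: power2_eq_square exp_add[symmetric])
  finally have a: "(real N)\<^sup>2 \<le> 100 * exp (real N / 5)" .
  have "exp (real N * (2 / 3)) \<le> exp (real N * ln 2)"
    using mult_left_mono[OF ln2_ge_two_thirds, of "real N"] by simp
  also have "\<dots> = 2 ^ N" by (simp add: exp_of_nat_mult)
  finally have "exp (5 * real N / 16) / 2 ^ N \<le> exp (5 * real N / 16) / exp (real N * (2 / 3))"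
    by (intro divide_left_mono) auto
  then have "(real N)\<^sup>2 * (exp (5 * real N / 16) / 2 ^ N) \<le> 100 * exp (real N / 5) * (exp (5 * real N / 16) / exp (real N * (2 / 3)))"
    using a by (intro mult_mono) auto
  also have "\<dots> = 100 * exp (real N / 5 + 5 * real N / 16 - real N * (2 / 3))"
    by (simp only: exp_add exp_diff times_divide_eq_right mult.assoc)
  also have "\<dots> \<le> 100 * exp (- real N / 8)" by simp
  finally show ?thesis .
qed

context
  fixes \<beta> M B :: real and N :: nat
  assumes \<beta>: "\<beta> > 0" and N: "N \<ge> 1"
    and M: "M = sqrt (real N) / (2 * sqrt 2 * \<beta>)" and B: "B = sqrt (real N) * \<beta> / (2 * sqrt 2)"
begin

text \<open>The transform is uniformly small on the band, so the squared norm costs only the band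
  length 2B. Together with the squared window length this gives a multiple of r^3 <= N^2/8, absorbed
  by the numerical estimate.\<close>

lemma low_frequency_bound:
  assumes v: "in_L2 v" and orth: "\<And>n. n < N - 1 \<Longrightarrow> L2inner v (hermite \<beta> n) = 0"
  shows "L2norm (\<lambda>k. indicator {k. \<bar>k\<bar> \<le> B} k * fourier (\<lambda>x. complex_of_real (window \<beta> (2 * M) x) * v x) k)
    \<le> 10 * exp (- real N / 16) * L2norm v"
proof (rule power2_le_imp_le)
  \<comment> \<open>The dimensionless threshold: \<beta> M and B/\<beta> both equal r, so the
    largest mean is ((2r)^2 + r^2)/2 = 5N/16.\<close>
  define r where "r = sqrt (real N) / (2 * sqrt 2)"
  have r: "r \<ge> 0" "r\<^sup>2 = real N / 8" by (auto simp: r_def power_divide power_mult_distrib)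
  have Mr: "M = r / \<beta>" and Br: "B = r * \<beta>" using \<beta> by (auto simp: M B r_def)
  have M0: "M \<ge> 0" and B0: "B \<ge> 0" using \<beta> r by (auto simp: Mr Br)
  define F where "F = fourier (\<lambda>x. complex_of_real (window \<beta> (2 * M) x) * v x)"
  define S where "S = 2 * M * (L2norm v * sqrt (\<beta> / (2 * sqrt pi) * (exp (5 * real N / 16) / 2 ^ (N - 1))))"
  have S: "S \<ge> 0" unfolding S_def using M0 \<beta> by (intro mult_nonneg_nonneg) auto
  have bd: "cmod (F k) \<le> S" if "\<bar>k\<bar> \<le> B" for k
    unfolding F_def S_def
  proof (rule fourier_window_bound[OF \<beta> v _ orth _ that])
    have scale: "\<beta> * (2 * M) = 2 * r" "B / \<beta> = r" using \<beta> by (auto simp: Mr Br)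
    show "((\<beta> * (2 * M))\<^sup>2 + (B / \<beta>)\<^sup>2) / 2 \<le> 5 * real N / 16"
      unfolding scale by (simp add: power_mult_distrib r)
  qed (use M0 in auto)
  have int: "integrable lborel (\<lambda>k. indicator {-B..B} k * S\<^sup>2)"
    by (intro integrable_mult_left integrable_real_indicator) (auto simp: emeasure_lborel_Icc_eq)
  have "(L2norm (\<lambda>k. indicator {k. \<bar>k\<bar> \<le> B} k * F k))\<^sup>2 \<le> (LINT k|lborel. indicator {-B..B} k * S\<^sup>2)"
    unfolding L2norm_power2
  proof (rule integral_mono'[OF int])
    show "(cmod (indicator {k. \<bar>k\<bar> \<le> B} k * F k))\<^sup>2 \<le> indicator {-B..B} k * S\<^sup>2" for k
      using power_mono[OF bd, of k 2] by (auto split: split_indicator)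
  qed auto
  also have "\<dots> = S\<^sup>2 * (2 * B)" using B0 by simp
  also have "\<dots> = (L2norm v)\<^sup>2 * (4 * M\<^sup>2 * (2 * B) * \<beta> / (2 * sqrt pi) * (exp (5 * real N / 16) / 2 ^ (N - 1)))"
    using \<beta> unfolding S_def power_mult_distrib by simp
  also have "\<dots> \<le> (L2norm v)\<^sup>2 * (100 * exp (- real N / 8))"
  proof (rule mult_left_mono)
    have "r\<^sup>2 \<le> (real N)\<^sup>2" unfolding r using N by (simp add: power2_eq_square field_simps)
    then have "r \<le> real N" by (rule power2_le_imp_le) simp
    then have c1: "r * r\<^sup>2 \<le> real N * (real N / 8)" unfolding r by (intro mult_right_mono) auto
    have "sqrt pi \<ge> 1" using pi_gt3 by (intro real_le_rsqrt) auto
    then have c2: "8 * (r * r\<^sup>2) / (2 * sqrt pi) \<le> 8 * (r * r\<^sup>2) / (2 * 1)"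
      using r by (intro divide_left_mono mult_left_mono) auto
    have eq: "4 * M\<^sup>2 * (2 * B) * \<beta> = 8 * (r * r\<^sup>2)"
      using \<beta> by (simp add: Mr Br power_divide power2_eq_square)
    have "4 * M\<^sup>2 * (2 * B) * \<beta> / (2 * sqrt pi) \<le> (real N)\<^sup>2 / 2"
      unfolding eq using c1 c2 unfolding power2_eq_square[of "real N"] by linarith
    then have "4 * M\<^sup>2 * (2 * B) * \<beta> / (2 * sqrt pi) * (2 * (exp (5 * real N / 16) / 2 ^ N)) \<le> 
       (real N)\<^sup>2 / 2 * (2 * (exp (5 * real N / 16) / 2 ^ N))"
      by (intro mult_right_mono) auto
    also have "\<dots> \<le> 100 * exp (- real N / 8)"
      using frequency_decay_numeric[OF N] by simp
    \<comment> \<open>Knowing only N - 1 vanishing coefficients costs the factor 2 carried along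
      above; N >= 1 makes the natural subtraction exact.\<close>
    also have "2 * (exp (5 * real N / 16) / 2 ^ N) = exp (5 * real N / 16) / 2 ^ (N - 1)"
      using N by (simp add: power_eq_if)
    finally show "4 * M\<^sup>2 * (2 * B) * \<beta> / (2 * sqrt pi) * (exp (5 * real N / 16) / 2 ^ (N - 1)) \<le> 100 * exp (- real N / 8)" .
  qed simp
  also have "\<dots> = (10 * exp (- real N / 16) * L2norm v)\<^sup>2"
    by (simp add: power_mult_distrib power2_eq_square[of "exp _"] exp_add[symmetric])
  finally show "(L2norm (\<lambda>k. indicator {k. \<bar>k\<bar> \<le> B} k * F k))\<^sup>2 \<le> (10 * exp (- real N / 16) * L2norm v)\<^sup>2" .
qed simp

text \<open>In the inner product the window is moved from f onto v, since the low-frequency estimate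
  concerns the windowed v. The constant 12 is 2 from the defect of the window plus 10 from the low
  frequencies.\<close>

lemma inner_bound_integrable:
  assumes f1: "integrable lborel f" and f: "in_L2 f" and v: "in_L2 v" 
    and orth: "\<And>n. n < N - 1 \<Longrightarrow> L2inner v (hermite \<beta> n) = 0"
  shows "cmod (L2inner f v) \<le> L2norm v * (L2norm (\<lambda>x. indicator {x. \<bar>x\<bar> > M} x * f x)
     + L2norm (\<lambda>k. indicator {k. \<bar>k\<bar> > B} k * fourier f k) + 12 * exp (- real N / 16) * L2norm f)"
proof -
  define e where "e = exp (- real N / 16)"
  define m where "m = window \<beta> (2 * M)"
  note [measurable] = in_L2_measurable[OF f] in_L2_measurable[OF v]
  have [measurable]: "m \<in> borel_measurable borel" unfolding m_def by measurable
  have m01: "0 \<le> m x" "m x \<le> 1" for x unfolding m_def using window_bounds[OF \<beta>] by auto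
  have \<beta>M: "(\<beta> * M)\<^sup>2 / 2 = real N / 16" 
    using \<beta> by (simp add: M power_divide power_mult_distrib)
  have m_close: "1 - m x \<le> 2 * e" if "\<bar>x\<bar> \<le> M" for x
    using one_minus_window_le[OF \<beta> that] \<beta>M by (simp add: m_def e_def)
  define w where "w = (\<lambda>x. complex_of_real (m x) * v x)"
  have w1: "integrable lborel w" and w2: "in_L2 w" and nw: "L2norm w \<le> L2norm v"
    unfolding w_def m_def using window_mult_integrable[OF \<beta> v] window_mult_L2[OF \<beta> v] by auto
  have A [measurable]: "{x :: real. \<bar>x\<bar> > c} \<in> sets borel" "{x :: real. \<bar>x\<bar> \<le> c} \<in> sets borel" for c by measurable
  define g where "g = (\<lambda>x. complex_of_real (1 - m x) * f x)"
  define g1 where "g1 = (\<lambda>x. indicator {x. \<bar>x\<bar> > M} x * f x)"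
  have g1: "in_L2 g1" unfolding g1_def by (rule in_L2_indicator_mult[OF f A(1)])
  have gm: "cmod (g x) \<le> cmod (f x)" for x
    using m01[of x] by (simp add: g_def norm_mult mult_left_le_one_le del: of_real_diff)
  have [measurable]: "g \<in> borel_measurable borel" unfolding g_def by measurable
  have g: "in_L2 g" by (rule in_L2_dominated[OF f, where C = 1]) (use gm in auto)
  have "L2norm g \<le> L2norm g1 + 2 * e * L2norm f"
  proof -
    define a b where "a = (\<lambda>x. indicator {x. \<bar>x\<bar> > M} x * g x)" and "b = (\<lambda>x. indicator {x. \<bar>x\<bar> \<le> M} x * g x)"
    have ab: "in_L2 a" "in_L2 b" unfolding a_def b_def by (auto intro!: in_L2_indicator_mult g)
    have "g = (\<lambda>x. a x + b x)" by (auto simp: a_def b_def fun_eq_iff split: split_indicator)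
    then have "L2norm g \<le> L2norm a + L2norm b" using L2norm_triangle[OF ab] by simp
    also have "L2norm a \<le> L2norm g1"
      using ab gm by (intro L2norm_mono[OF g1]) (auto simp: a_def g1_def split: split_indicator)
    also have "L2norm b \<le> L2norm (\<lambda>x. complex_of_real (2 * e) * f x)"
    proof (rule L2norm_mono)
      show "cmod (b x) \<le> cmod (complex_of_real (2 * e) * f x)" for x
      proof (cases "\<bar>x\<bar> \<le> M")
        case True
        have "\<bar>1 - m x\<bar> * cmod (f x) \<le> 2 * e * cmod (f x)"
          using m_close[OF True] m01[of x] by (intro mult_right_mono) auto
        then show ?thesis using True by (simp add: b_def g_def norm_mult e_def del: of_real_diff)
      qed (simp add: b_def)
    qed (use f ab in auto)
    also have "\<dots> = 2 * e * L2norm f" unfolding L2norm_cmult by (simp add: e_def)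
    finally show ?thesis by simp
  qed
  then have 1: "cmod (L2inner g v) \<le> (L2norm g1 + 2 * e * L2norm f) * L2norm v"
    using Cauchy_Schwarz_L2[OF g v] mult_right_mono[OF _ L2norm_nonneg[of v]] by fastforce
  have split_space: "L2inner f v = L2inner g v + L2inner f w"
  proof -
    have "f x * cnj (v x) = g x * cnj (v x) + f x * cnj (w x)" for x
      by (simp add: g_def w_def algebra_simps)
    then show ?thesis
      unfolding L2inner_def using in_L2_integrable_inner[OF g v] in_L2_integrable_inner[OF f w2] by simp
  qed
  have split_freq: "L2inner f w = L2inner (\<lambda>k. indicator {k. \<bar>k\<bar> > B} k * fourier f k) (fourier w)
     + L2inner (fourier f) (\<lambda>k. indicator {k. \<bar>k\<bar> \<le> B} k * fourier w k)"
  proof -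
    note F = Plancherel_norm(1)[OF f1 f] Plancherel_norm(1)[OF w1 w2]
    have "fourier f x * cnj (fourier w x) = (indicator {k. \<bar>k\<bar> > B} x * fourier f x) * cnj (fourier w x) + 
       fourier f x * cnj (indicator {k. \<bar>k\<bar> \<le> B} x * fourier w x)" for x
      by (auto split: split_indicator)
    then show ?thesis
      unfolding Plancherel_inner[OF f1 f w1 w2, symmetric] unfolding L2inner_def
      using in_L2_integrable_inner[OF in_L2_indicator_mult[OF F(1) A(1)] F(2)]
        in_L2_integrable_inner[OF F(1) in_L2_indicator_mult[OF F(2) A(2)]] by simp
  qed
  have high: "cmod (L2inner (\<lambda>k. indicator {k. \<bar>k\<bar> > B} k * fourier f k) (fourier w)) \<le> 
      L2norm (\<lambda>k. indicator {k. \<bar>k\<bar> > B} k * fourier f k) * L2norm v"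
  proof -
    have "cmod (L2inner (\<lambda>k. indicator {k. \<bar>k\<bar> > B} k * fourier f k) (fourier w)) \<le> 
      L2norm (\<lambda>k. indicator {k. \<bar>k\<bar> > B} k * fourier f k) * L2norm (fourier w)"
      by (intro Cauchy_Schwarz_L2 in_L2_indicator_mult A Plancherel_norm f1 f w1 w2)
    also have "L2norm (fourier w) \<le> L2norm v" using Plancherel_norm(2)[OF w1 w2] nw by simp
    finally show ?thesis by (simp add: mult_left_mono)
  qed
  have low: "cmod (L2inner (fourier f) (\<lambda>k. indicator {k. \<bar>k\<bar> \<le> B} k * fourier w k)) \<le> 
      L2norm f * (10 * e * L2norm v)"
  proof -
    have "cmod (L2inner (fourier f) (\<lambda>k. indicator {k. \<bar>k\<bar> \<le> B} k * fourier w k)) \<le> 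
       L2norm (fourier f) * L2norm (\<lambda>k. indicator {k. \<bar>k\<bar> \<le> B} k * fourier w k)"
      by (intro Cauchy_Schwarz_L2 in_L2_indicator_mult A Plancherel_norm f1 f w1 w2)
    also have "L2norm (fourier f) = L2norm f" by (rule Plancherel_norm(2)[OF f1 f])
    also have "L2norm (\<lambda>k. indicator {k. \<bar>k\<bar> \<le> B} k * fourier w k) \<le> 10 * e * L2norm v"
      using low_frequency_bound[OF v orth] by (simp add: w_def m_def e_def)
    finally show ?thesis by (simp add: mult_left_mono)
  qed
  have "cmod (L2inner f v) \<le> cmod (L2inner g v) + (cmod (L2inner (\<lambda>k. indicator {k. \<bar>k\<bar> > B} k * fourier f k) (fourier w))
     + cmod (L2inner (fourier f) (\<lambda>k. indicator {k. \<bar>k\<bar> \<le> B} k * fourier w k)))"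
    unfolding split_space split_freq by (rule order_trans[OF norm_triangle_ineq add_left_mono[OF norm_triangle_ineq]])
  also have "\<dots> \<le> (L2norm g1 + 2 * e * L2norm f) * L2norm v + 
     (L2norm (\<lambda>k. indicator {k. \<bar>k\<bar> > B} k * fourier f k) * L2norm v + L2norm f * (10 * e * L2norm v))"
    by (intro add_mono 1 high low)
  also have "\<dots> = L2norm v * (L2norm g1
     + L2norm (\<lambda>k. indicator {k. \<bar>k\<bar> > B} k * fourier f k) + 12 * e * L2norm f)"
    by (simp add: algebra_simps)
  finally show ?thesis unfolding g1_def e_def .
qed

end

section \<open>Truncation to bounded intervals, extending the bound to all of L^2\<close>

definition truncate :: "nat \<Rightarrow> (real \<Rightarrow> complex) \<Rightarrow> real \<Rightarrow> complex" where
  "truncate n u x = indicator {- real n..real n} x * u x"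

lemma FT_trunc_eq: "FT_trunc (real n) u = fourier (truncate n u)"
  unfolding FT_trunc_eq_fourier truncate_def[abs_def] ..

lemma truncate_L2: "in_L2 u \<Longrightarrow> in_L2 (truncate n u)"
  unfolding truncate_def[abs_def] by (rule in_L2_indicator_mult) auto

lemma truncate_integrable:
  assumes "in_L2 u"
  shows "integrable lborel (truncate n u)"
proof -
  have "integrable lborel (\<lambda>x. (cmod (indicator {- real n..real n} x))\<^sup>2)"
    by (rule integrable_dominated[of _ "indicator {- real n..real n}"]) (auto split: split_indicator)
  then have "in_L2 (\<lambda>x. indicator {- real n..real n} x)"
    by (simp add: in_L2_def)
  from in_L2_integrable_mult[OF this assms] show ?thesis by (simp add: truncate_def[abs_def])
qed

lemma truncate_tendsto:
  assumes u: "in_L2 u"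
  shows "(\<lambda>n. L2norm (\<lambda>x. u x - truncate n u x)) \<longlonglongrightarrow> 0"
proof -
  note [measurable] = in_L2_measurable[OF u]
  have "(\<lambda>n. LINT x|lborel. (cmod (u x - truncate n u x))\<^sup>2) \<longlonglongrightarrow> (LINT x|(lborel::real measure). 0)"
  proof (rule integral_dominated_convergence[where w = "\<lambda>x. (cmod (u x))\<^sup>2"])
    show "AE x in lborel. (\<lambda>n. (cmod (u x - truncate n u x))\<^sup>2) \<longlonglongrightarrow> 0"
    proof (rule AE_I2)
      fix x
      have "\<forall>\<^sub>F n in sequentially. real n \<ge> \<bar>x\<bar>" by real_asymp
      then have "\<forall>\<^sub>F n in sequentially. (cmod (u x - truncate n u x))\<^sup>2 = 0"
        by eventually_elim (auto simp: truncate_def abs_le_iff split: split_indicator)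
      then show "(\<lambda>n. (cmod (u x - truncate n u x))\<^sup>2) \<longlonglongrightarrow> 0" by (rule tendsto_eventually)
    qed
    show "AE x in lborel. norm ((cmod (u x - truncate n u x))\<^sup>2) \<le> (cmod (u x))\<^sup>2" for n
      by (auto simp: truncate_def split: split_indicator)
  qed (use u in \<open>auto simp: in_L2_def truncate_def[abs_def]\<close>)
  from tendsto_real_sqrt[OF this] show ?thesis by (simp add: L2norm_def)
qed

text \<open>The \<open>lim\<close> in \<open>E_f\<close> is informative only once convergence is
  known. By Plancherel the values for two truncations differ by at most the L^2 distance of the
  truncations, so the sequence is Cauchy.\<close>

lemma E_f_LIMSEQ:
  assumes u: "in_L2 u"
  shows "(\<lambda>n. L2norm (\<lambda>k. indicator {k. \<bar>k\<bar> > sqrt (real N) * \<beta> / (2 * sqrt 2)} k * fourier (truncate n u) k))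
    \<longlonglongrightarrow> E_f \<beta> N u"
proof -
  define A where "A = {k. \<bar>k\<bar> > sqrt (real N) * \<beta> / (2 * sqrt 2)}"
  have A: "A \<in> sets borel" unfolding A_def by measurable
  define a where "a = (\<lambda>n. L2norm (\<lambda>k. indicator A k * fourier (truncate n u) k))"
  define d where "d = (\<lambda>n. L2norm (\<lambda>x. u x - truncate n u x))"
  have d: "d \<longlonglongrightarrow> 0" unfolding d_def by (rule truncate_tendsto[OF u])
  have le: "\<bar>a n - a m\<bar> \<le> d n + d m" for n m
  proof -
    note t = truncate_L2[OF u] truncate_integrable[OF u]
    have F: "in_L2 (fourier (truncate n u))" for n by (intro Plancherel_norm t)
    have diff: "fourier (truncate n u) k - fourier (truncate m u) k = fourier (\<lambda>x. truncate n u x - truncate m u x) k" for k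
      unfolding fourier_def using integrable_mult_cis[OF t(2), of "\<lambda>x. - (k * x)" n]
        integrable_mult_cis[OF t(2), of "\<lambda>x. - (k * x)" m]
      by (simp add: left_diff_distrib right_diff_distrib)
    have td: "in_L2 (\<lambda>x. truncate n u x - truncate m u x)" "integrable lborel (\<lambda>x. truncate n u x - truncate m u x)"
      by (intro in_L2_diff t Bochner_Integration.integrable_diff)+
    have "\<bar>a n - a m\<bar> \<le> L2norm (\<lambda>k. indicator A k * fourier (truncate n u) k - indicator A k * fourier (truncate m u) k)"
      unfolding a_def by (intro L2norm_triangle_diff in_L2_indicator_mult F A)
    also have "\<dots> \<le> L2norm (fourier (\<lambda>x. truncate n u x - truncate m u x))"
    proof (rule L2norm_mono)
      show "in_L2 (fourier (\<lambda>x. truncate n u x - truncate m u x))" by (intro Plancherel_norm td)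
      show "(\<lambda>k. indicator A k * fourier (truncate n u) k - indicator A k * fourier (truncate m u) k) \<in> borel_measurable borel"
        by (intro in_L2_measurable in_L2_diff in_L2_indicator_mult F A)
    qed (auto simp: diff split: split_indicator)
    also have "\<dots> = L2norm (\<lambda>x. (u x - truncate m u x) - (u x - truncate n u x))"
      using Plancherel_norm(2)[OF td(2,1)] by simp
    also have "\<dots> \<le> d m + d n"
      unfolding d_def by (intro L2norm_diff_triangle in_L2_diff u t)
    finally show ?thesis by simp
  qed
  have "Cauchy a"
  proof (rule metric_CauchyI)
    fix e :: real assume "e > 0"
    then obtain n0 where n0: "\<And>n. n \<ge> n0 \<Longrightarrow> \<bar>d n\<bar> < e / 2"
      using LIMSEQ_D[OF d, of "e / 2"] by auto
    show "\<exists>M. \<forall>m\<ge>M. \<forall>n\<ge>M. dist (a m) (a n) < e"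
    proof (intro exI[of _ n0] allI impI)
      fix m n assume "m \<ge> n0" "n \<ge> n0"
      then show "dist (a m) (a n) < e" using n0[of m] n0[of n] le[of m n] by (simp add: dist_real_def)
    qed
  qed
  then have "a \<longlonglongrightarrow> lim a"
    by (simp add: Cauchy_convergent_iff convergent_LIMSEQ_iff)
  then show ?thesis unfolding E_f_def FT_trunc_eq a_def A_def .
qed

text \<open>Truncating does not increase the spatial tail or the norm, and the frequency tails of
  the truncations converge to \<open>E_f\<close> by definition. The 12 in front of
  \<open>E_h\<close> becomes a common factor because the other two terms are nonnegative.\<close>

lemma inner_bound_E_N:
  assumes \<beta>: "\<beta> > 0" and N: "N \<ge> 1" and u: "in_L2 u" and v: "in_L2 v"
    and orth: "\<And>n. n < N - 1 \<Longrightarrow> L2inner v (hermite \<beta> n) = 0"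
  shows "cmod (L2inner u v) \<le> 12 * E_N \<beta> N u * L2norm v"
proof -
  define M where "M = sqrt (real N) / (2 * sqrt 2 * \<beta>)"
  define B where "B = sqrt (real N) * \<beta> / (2 * sqrt 2)"
  define e where "e = exp (- real N / 16)"
  define a where "a = (\<lambda>n. L2norm (\<lambda>k. indicator {k. \<bar>k\<bar> > B} k * fourier (truncate n u) k))"
  note t = truncate_L2[OF u] truncate_integrable[OF u]
  have a: "a \<longlonglongrightarrow> E_f \<beta> N u" unfolding a_def B_def by (rule E_f_LIMSEQ[OF u])
  have Ef: "E_f \<beta> N u \<ge> 0" using a by (rule LIMSEQ_le_const) (auto simp: a_def)
  have [measurable]: "{x :: real. \<bar>x\<bar> > M} \<in> sets borel" by measurable
  have "cmod (L2inner (truncate n u) v) \<le> L2norm v * (E_s \<beta> N u + a n + 12 * e * L2norm u)" for n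
  proof -
    have "L2norm (truncate n u) \<le> L2norm u"
      using in_L2_measurable[OF t(1)] by (intro L2norm_mono u) (auto simp: truncate_def split: split_indicator)
    moreover have "L2norm (\<lambda>x. indicator {x. \<bar>x\<bar> > M} x * truncate n u x) \<le> E_s \<beta> N u"
      unfolding E_s_def M_def[symmetric]
      by (intro L2norm_mono in_L2_indicator_mult in_L2_measurable u t) 
         (auto simp: truncate_def split: split_indicator)
    ultimately have "L2norm v * (L2norm (\<lambda>x. indicator {x. \<bar>x\<bar> > M} x * truncate n u x) + a n + 12 * e * L2norm (truncate n u))
      \<le> L2norm v * (E_s \<beta> N u + a n + 12 * e * L2norm u)"
      by (intro mult_left_mono add_mono) (auto simp: e_def)
    then show ?thesis
      using inner_bound_integrable[OF \<beta> N M_def B_def t(2) t(1) v orth, of n] unfolding a_def e_def by linarith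
  qed
  moreover have "(\<lambda>n. cmod (L2inner (truncate n u) v)) \<longlonglongrightarrow> cmod (L2inner u v)"
  proof (rule tendsto_norm, rule LIM_zero_cancel, rule Lim_null_comparison)
    have "(\<lambda>n. L2norm (\<lambda>x. u x - truncate n u x) * L2norm v) \<longlonglongrightarrow> 0 * L2norm v"
      by (intro tendsto_intros truncate_tendsto u)
    then show "(\<lambda>n. L2norm (\<lambda>x. u x - truncate n u x) * L2norm v) \<longlonglongrightarrow> 0" by simp
    have "cmod (L2inner (truncate n u) v - L2inner u v) \<le> L2norm (\<lambda>x. u x - truncate n u x) * L2norm v" for n
      using Cauchy_Schwarz_L2[OF in_L2_diff[OF u t(1)[of n]] v] 
      unfolding L2inner_diff_left[OF u t(1)[of n] v] by (simp add: norm_minus_commute)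
    then show "\<forall>\<^sub>F n in sequentially. cmod (L2inner (truncate n u) v - L2inner u v) \<le> L2norm (\<lambda>x. u x - truncate n u x) * L2norm v"
      by simp
  qed
  moreover have "(\<lambda>n. L2norm v * (E_s \<beta> N u + a n + 12 * e * L2norm u)) \<longlonglongrightarrow> L2norm v * (E_s \<beta> N u + E_f \<beta> N u + 12 * e * L2norm u)"
    by (intro tendsto_intros a)
  ultimately have "cmod (L2inner u v) \<le> L2norm v * (E_s \<beta> N u + E_f \<beta> N u + 12 * e * L2norm u)"
    by (intro LIMSEQ_le) auto
  also have "\<dots> \<le> L2norm v * (12 * E_N \<beta> N u)"
    using Ef by (intro mult_left_mono) (auto simp: E_N_def E_h_def e_def E_s_def)
  finally show ?thesis by (simp add: mult_ac)
qed

lemma E_N_nonneg: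
  assumes u: "in_L2 u"
  shows "E_N \<beta> N u \<ge> 0"
proof -
  have "E_f \<beta> N u \<ge> 0" using E_f_LIMSEQ[OF u] by (rule LIMSEQ_le_const) auto
  then show ?thesis by (simp add: E_N_def E_h_def E_s_def)
qed

subsection \<open>Weak derivatives against Hermite functions\<close>

lemma power_le_fact_exp:
  fixes x :: real
  assumes "x \<ge> 0"
  shows "x ^ n \<le> fact n * exp x"
proof -
  have s: "(\<lambda>n. x ^ n / fact n) sums exp x"
    using exp_converges[of x] by (simp add: divide_inverse mult.commute)
  have "(\<Sum>i\<in>{n}. x ^ i / fact i) \<le> exp x"
    using s assms by (intro sum_le_suminf[THEN order_trans]) (auto simp: sums_iff)
  then show ?thesis by (simp add: field_simps)
qed

text \<open>The classical flat function exp(-1/t), divided by powers of t because differentiation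
  produces such powers: the span of this family is closed under differentiation.\<close>

definition flat_exp :: "nat \<Rightarrow> real \<Rightarrow> real" where
  "flat_exp j t = (if t > 0 then exp (- (1 / t)) / t ^ j else 0)"

lemma flat_nonneg [simp]: "0 \<le> flat_exp j t"
  by (simp add: flat_exp_def)

text \<open>One term of the exponential series at 1/t dominates the negative power. The free
  exponent m serves twice: m = 0 gives a uniform bound, m = 2 gives derivative 0 at the
  origin.\<close>

lemma flat_le: "flat_exp j t \<le> fact (j + m) * \<bar>t\<bar> ^ m"
proof (cases "t > 0")
  case True
  have "(1 / t) ^ (j + m) \<le> fact (j + m) * exp (1 / t)"
    using True by (intro power_le_fact_exp) auto
  then have "exp (- (1 / t)) * (1 / t) ^ (j + m) * t ^ m \<le> exp (- (1 / t)) * (fact (j + m) * exp (1 / t)) * t ^ m"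
    using True by (intro mult_right_mono mult_left_mono) auto
  also have "exp (- (1 / t)) * (fact (j + m) * exp (1 / t)) = fact (j + m)"
    by (simp add: exp_minus)
  also have "exp (- (1 / t)) * (1 / t) ^ (j + m) * t ^ m = flat_exp j t"
    using True by (simp add: flat_exp_def power_add power_divide)
  finally show ?thesis using True by simp
qed (simp add: flat_exp_def)

lemma flat_deriv: "(flat_exp j has_real_derivative flat_exp (j + 2) t - real j * flat_exp (j + 1) t) (at t)"
proof -
  consider "t > 0" | "t < 0" | "t = 0" by linarith
  then show ?thesis
  proof cases
    case 1
    have "((\<lambda>t. exp (- (1 / t)) / t ^ j) has_real_derivative flat_exp (j + 2) t - real j * flat_exp (j + 1) t) (at t)"
    proof -
      have P: "((\<lambda>t. t ^ j) has_real_derivative real j * t ^ j / t) (at t)"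
        using DERIV_pow[of j t] 1 by (cases j) auto
      have E: "((\<lambda>t. exp (- (1 / t))) has_real_derivative exp (- (1 / t)) / t\<^sup>2) (at t)"
        using 1 by (auto intro!: derivative_eq_intros simp: power2_eq_square)
      from 1 have "t ^ j \<noteq> 0" by simp
      from DERIV_divide[OF E P this] show ?thesis
        by (rule DERIV_cong) (use 1 in \<open>simp add: flat_exp_def power2_eq_square field_simps\<close>)
    qed
    then show ?thesis
      by (rule has_field_derivative_transform_within_open[of _ _ _ "{0<..}"]) (use 1 in \<open>auto simp: flat_exp_def\<close>)
  next
    case 2
    have "((\<lambda>_. 0) has_real_derivative flat_exp (j + 2) t - real j * flat_exp (j + 1) t) (at t)"
      using 2 by (simp add: flat_exp_def)
    then show ?thesis
      by (rule has_field_derivative_transform_within_open[of _ _ _ "{..<0}"]) (use 2 in \<open>auto simp: flat_exp_def\<close>)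
  next
    case 3
    have "(\<lambda>h. (flat_exp j (0 + h) - flat_exp j 0) / h) \<midarrow>0\<rightarrow> 0"
    proof (rule Lim_null_comparison)
      have "norm ((flat_exp j (0 + h) - flat_exp j 0) / h) \<le> fact (j + 2) * \<bar>h\<bar>" if "h \<noteq> 0" for h
      proof -
        have "norm ((flat_exp j (0 + h) - flat_exp j 0) / h) = flat_exp j h / \<bar>h\<bar>"
          by (simp add: flat_exp_def[of j 0])
        also have "\<dots> \<le> fact (j + 2) * \<bar>h\<bar> ^ 2 / \<bar>h\<bar>"
          by (intro divide_right_mono flat_le) auto
        also have "\<dots> = fact (j + 2) * \<bar>h\<bar>"
          using that by (simp add: power2_eq_square del: power2_abs abs_mult_self_eq)
        finally show ?thesis .
      qed
      then show "\<forall>\<^sub>F h in at 0. norm ((flat_exp j (0 + h) - flat_exp j 0) / h) \<le> fact (j + 2) * \<bar>h\<bar>"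
        by (simp add: eventually_at_filter)
      show "((\<lambda>h. fact (j + 2) * \<bar>h\<bar>) \<longlongrightarrow> 0) (at (0::real))"
        by (auto intro!: tendsto_eq_intros)
    qed
    then show ?thesis unfolding 3 by (simp add: DERIV_def flat_exp_def)
  qed
qed

text \<open>A class of functions that vanish outside [-R, R] and is closed under differentiation, so
  that the iterated derivatives demanded by \<open>test_fn\<close> are handled by induction. Sums
  are included because the product rule creates them.\<close>

inductive gauss_bump :: "real \<Rightarrow> real \<Rightarrow> (real \<Rightarrow> real) \<Rightarrow> bool" for R \<beta> :: real where
  gen: "gauss_bump R \<beta> (\<lambda>x. poly p x * flat_exp j (1 - (x / R)\<^sup>2) * exp (- (\<beta>\<^sup>2 * x\<^sup>2) / 2))"
| add: "gauss_bump R \<beta> f \<Longrightarrow> gauss_bump R \<beta> g \<Longrightarrow> gauss_bump R \<beta> (\<lambda>x. f x + g x)"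

lemma flat_cutoff_deriv:
  "((\<lambda>x. flat_exp j (1 - (x / R)\<^sup>2)) has_real_derivative
     (flat_exp (j + 2) (1 - (x / R)\<^sup>2) - real j * flat_exp (j + 1) (1 - (x / R)\<^sup>2)) * (- 2 * x / R\<^sup>2)) (at x)"
proof (rule DERIV_chain2[OF flat_deriv])
  show "((\<lambda>x. 1 - (x / R)\<^sup>2) has_real_derivative - 2 * x / R\<^sup>2) (at x)"
    by (cases "R = 0") (auto intro!: derivative_eq_intros simp: power2_eq_square field_simps)
qed

lemma gauss_bump_deriv:
  assumes "gauss_bump R \<beta> f"
  shows "\<exists>g. gauss_bump R \<beta> g \<and> (\<forall>x. (f has_real_derivative g x) (at x))"
  using assms
proof induction
  case (gen p j)
  define E where "E = (\<lambda>x. exp (- (\<beta>\<^sup>2 * x\<^sup>2) / 2))"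
  define s where "s = (\<lambda>j x. flat_exp j (1 - (x / R)\<^sup>2))"
  define q1 q2 q3 where "q1 = pderiv p - [:0, \<beta>\<^sup>2:] * p" and "q2 = [:0, - 2 / R\<^sup>2:] * p" and "q3 = [:0, 2 * real j / R\<^sup>2:] * p"
  define g where "g = (\<lambda>x. poly q1 x * s j x * E x + poly q2 x * s (j + 2) x * E x + poly q3 x * s (j + 1) x * E x)"
  have "gauss_bump R \<beta> g" unfolding g_def s_def E_def by (intro gauss_bump.intros)
  moreover have "((\<lambda>x. poly p x * s j x * E x) has_real_derivative g x) (at x)" for x
  proof -
    have 1: "(s j has_real_derivative (s (j + 2) x - real j * s (j + 1) x) * (- 2 * x / R\<^sup>2)) (at x)"
      unfolding s_def by (rule flat_cutoff_deriv)
    have 2: "(E has_real_derivative E x * (- (\<beta>\<^sup>2 * x))) (at x)"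
      unfolding E_def by (auto intro!: derivative_eq_intros)
    have "((\<lambda>x. poly p x * s j x * E x) has_real_derivative 
        (poly (pderiv p) x * s j x + (s (j + 2) x - real j * s (j + 1) x) * (- 2 * x / R\<^sup>2) * poly p x) * E x + E x * (- (\<beta>\<^sup>2 * x)) * (poly p x * s j x)) (at x)"
      by (intro DERIV_mult poly_DERIV 1 2)
    then show ?thesis
      by (rule DERIV_cong) (simp add: g_def q1_def q2_def q3_def algebra_simps diff_divide_distrib add_divide_distrib)
  qed
  ultimately show ?case unfolding s_def E_def by blast
next
  case (add f g)
  then obtain f' g' where "gauss_bump R \<beta> f'" "gauss_bump R \<beta> g'"
    "\<And>x. (f has_real_derivative f' x) (at x)" "\<And>x. (g has_real_derivative g' x) (at x)" by blast
  then show ?case by (intro exI[of _ "\<lambda>x. f' x + g' x"]) (auto intro: gauss_bump.add DERIV_add)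
qed

lemma gauss_bump_test_fn:
  assumes R: "R > 0" and f: "gauss_bump R \<beta> f"
  shows "test_fn f"
  unfolding test_fn_def
proof (intro conjI allI exI[of _ R] impI)
  fix k x
  have "gauss_bump R \<beta> ((deriv ^^ k) f)"
  proof (induction k)
    case (Suc k)
    obtain g where g: "gauss_bump R \<beta> g" "\<And>x. ((deriv ^^ k) f has_real_derivative g x) (at x)"
      using gauss_bump_deriv[OF Suc] by blast
    then have "(deriv ^^ Suc k) f = g" by (auto simp: fun_eq_iff DERIV_imp_deriv)
    with g show ?case by simp
  qed (simp add: f)
  then show "(deriv ^^ k) f differentiable at x"
    using gauss_bump_deriv real_differentiable_def by blast
next
  fix x assume "R < \<bar>x\<bar>"
  then have "(x / R)\<^sup>2 \<ge> 1" using R by (simp add: power_divide abs_le_square_iff[symmetric] le_divide_eq)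
  then have "flat_exp j (1 - (x / R)\<^sup>2) = 0" for j by (simp add: flat_exp_def)
  with f show "f x = 0" by induction auto
qed

text \<open>The action of d/dx on sequences indexed by the modes. On the values of the Hermite
  functions at a point it gives their derivatives; on the coefficients of u it gives minus those of
  the weak derivative. For n = 0 the truncated index n - 1 carries the coefficient 0.\<close>

definition ladder :: "real \<Rightarrow> (nat \<Rightarrow> complex) \<Rightarrow> nat \<Rightarrow> complex" where
  "ladder \<beta> h n = complex_of_real \<beta> * (complex_of_real (sqrt (real n / 2)) * h (n - 1)
     - complex_of_real (sqrt (real (Suc n) / 2)) * h (Suc n))"

definition hermite_deriv :: "real \<Rightarrow> nat \<Rightarrow> real \<Rightarrow> real" where
  "hermite_deriv \<beta> n x = \<beta> * (sqrt (real n / 2) * hermite_fun \<beta> (n - 1) x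
     - sqrt (real (Suc n) / 2) * hermite_fun \<beta> (Suc n) x)"

lemma ladder_hermite: "ladder \<beta> (\<lambda>n. hermite \<beta> n x) n = complex_of_real (hermite_deriv \<beta> n x)"
  by (simp add: ladder_def hermite_deriv_def)

lemma in_L2_ladder:
  assumes "\<And>n. in_L2 (h n)"
  shows "in_L2 (\<lambda>x. ladder \<beta> (\<lambda>n. h n x) n)"
  unfolding ladder_def by (intro in_L2_cmult in_L2_diff assms)

text \<open>A Hermite function lacks compact support, so the weak derivative is tested against its
  products with cutoffs of growing radius, and dominated convergence removes the cutoff.\<close>

lemma weak_deriv_hermite_inner:
  assumes \<beta>: "\<beta> > 0" and u: "in_L2 u" and u1: "in_L2 u1" and w: "weak_deriv u u1"
  shows "L2inner u1 (hermite \<beta> n) = - ladder \<beta> (\<lambda>n. L2inner u (hermite \<beta> n)) n"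
proof -
  note [measurable] = in_L2_measurable[OF u] in_L2_measurable[OF u1]
  have [measurable]: "hermite_deriv \<beta> n \<in> borel_measurable borel" unfolding hermite_deriv_def[abs_def] by measurable
  have hd: "in_L2 (\<lambda>x. complex_of_real (hermite_deriv \<beta> n x))"
    using in_L2_ladder[of "hermite \<beta>" \<beta> n, OF in_L2_hermite[OF \<beta>]] unfolding ladder_hermite .
  define R where "R = (\<lambda>m::nat. real (Suc m))"
  \<comment> \<open>The factor exp 1 makes the cutoffs tend to 1, since \<open>flat_exp 0 1\<close>
    is exp(-1).\<close>
  define \<eta> where "\<eta> = (\<lambda>m x. exp 1 * flat_exp 0 (1 - (x / R m)\<^sup>2))"
  define \<eta>' where "\<eta>' = (\<lambda>m x. exp 1 * (flat_exp 2 (1 - (x / R m)\<^sup>2) * (- 2 * x / (R m)\<^sup>2)))"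
  define \<phi> where "\<phi> = (\<lambda>m x. hermite_fun \<beta> n x * \<eta> m x)"
  have R: "R m > 0" for m by (simp add: R_def)
  have \<eta>_deriv: "(\<eta> m has_real_derivative \<eta>' m x) (at x)" for m x
    unfolding \<eta>_def \<eta>'_def using DERIV_cmult[OF flat_cutoff_deriv[of 0 "R m" x], of "exp 1"] by (simp add: numeral_2_eq_2)
  have \<phi>_deriv: "deriv (\<phi> m) x = hermite_deriv \<beta> n x * \<eta> m x + \<eta>' m x * hermite_fun \<beta> n x" for m x
    unfolding \<phi>_def hermite_deriv_def by (intro DERIV_imp_deriv DERIV_mult hermite_fun_deriv \<eta>_deriv)
  have test: "test_fn (\<phi> m)" for m
  proof (rule gauss_bump_test_fn[OF R])
    have "\<phi> m = (\<lambda>x. poly (smult (exp 1 * hermite_const \<beta> n) (pcompose (hermite_poly n) [:0, \<beta>:])) x * flat_exp 0 (1 - (x / R m)\<^sup>2) * exp (- (\<beta>\<^sup>2 * x\<^sup>2) / 2))"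
      by (auto simp: fun_eq_iff \<phi>_def \<eta>_def hermite_fun_def poly_pcompose mult_ac)
    then show "gauss_bump (R m) \<beta> (\<phi> m)" by (simp only: gauss_bump.gen)
  qed
  have arg_lim: "(\<lambda>m. 1 - (x / R m)\<^sup>2) \<longlonglongrightarrow> 1" for x
  proof -
    have "(\<lambda>m. x / R m) \<longlonglongrightarrow> 0" unfolding R_def by real_asymp
    then have "(\<lambda>m. 1 - (x / R m)\<^sup>2) \<longlonglongrightarrow> 1 - 0\<^sup>2" by (intro tendsto_intros)
    then show ?thesis by simp
  qed
  have flat_lim: "(\<lambda>m. flat_exp j (1 - (x / R m)\<^sup>2)) \<longlonglongrightarrow> flat_exp j 1" for j x
    using flat_deriv[of j 1, THEN DERIV_isCont] arg_lim by (rule isCont_tendsto_compose)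
  have \<eta>_lim: "(\<lambda>m. \<eta> m x) \<longlonglongrightarrow> 1" for x
  proof -
    have "(\<lambda>m. \<eta> m x) \<longlonglongrightarrow> exp 1 * flat_exp 0 1" unfolding \<eta>_def by (intro tendsto_intros flat_lim)
    then show ?thesis by (simp add: flat_exp_def exp_minus)
  qed
  have \<eta>'_lim: "(\<lambda>m. \<eta>' m x) \<longlonglongrightarrow> 0" for x
  proof -
    have "(\<lambda>m. - 2 * x / (R m)\<^sup>2) \<longlonglongrightarrow> 0" unfolding R_def by real_asymp
    then have "(\<lambda>m. \<eta>' m x) \<longlonglongrightarrow> exp 1 * (flat_exp 2 1 * 0)" unfolding \<eta>'_def by (intro tendsto_intros flat_lim)
    then show ?thesis by simp
  qed
  have \<eta>_bound: "\<bar>\<eta> m x\<bar> \<le> exp 1" for m x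
    using flat_le[of 0 "1 - (x / R m)\<^sup>2" 0] by (simp add: \<eta>_def abs_mult)
  \<comment> \<open>Inside the support \<open>flat_exp 2\<close> is at most fact 2 = 2, and |2x| /
    R^2 <= 2 because every radius is at least 1; hence 4.\<close>
  have \<eta>'_bound: "\<bar>\<eta>' m x\<bar> \<le> 4 * exp 1" for m x
  proof (cases "\<bar>x\<bar> \<le> R m")
    case True
    have "flat_exp 2 (1 - (x / R m)\<^sup>2) \<le> 2" using flat_le[of 2 "1 - (x / R m)\<^sup>2" 0] by (simp add: eval_nat_numeral)
    moreover have "\<bar>- 2 * x / (R m)\<^sup>2\<bar> \<le> 2"
    proof -
      have "R m \<ge> 1" by (simp add: R_def)
      then have "\<bar>x\<bar> \<le> (R m)\<^sup>2" using True mult_mono[of 1 "R m" "\<bar>x\<bar>" "R m"] by (simp add: power2_eq_square)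
      then show ?thesis using R[of m] by (simp add: abs_mult divide_le_eq)
    qed
    ultimately have "flat_exp 2 (1 - (x / R m)\<^sup>2) * \<bar>- 2 * x / (R m)\<^sup>2\<bar> \<le> 2 * 2" by (intro mult_mono) auto
    then have "exp 1 * (flat_exp 2 (1 - (x / R m)\<^sup>2) * \<bar>- 2 * x / (R m)\<^sup>2\<bar>) \<le> exp 1 * (2 * 2)"
      by (rule mult_left_mono) simp
    moreover have "\<bar>\<eta>' m x\<bar> = exp 1 * (flat_exp 2 (1 - (x / R m)\<^sup>2) * \<bar>- 2 * x / (R m)\<^sup>2\<bar>)"
      unfolding \<eta>'_def by (simp only: abs_mult abs_exp_cancel abs_of_nonneg[OF flat_nonneg])
    ultimately show ?thesis by simp
  next
    case False
    then have "(x / R m)\<^sup>2 \<ge> 1" using R[of m] by (simp add: power_divide abs_le_square_iff[symmetric] le_divide_eq)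
    then show ?thesis by (simp add: \<eta>'_def flat_exp_def)
  qed
  have [measurable]: "\<eta> m \<in> borel_measurable borel" "\<eta>' m \<in> borel_measurable borel" for m
    unfolding \<eta>_def \<eta>'_def flat_exp_def by measurable
  have lim1: "(\<lambda>m. LINT x|lborel. u x * complex_of_real (deriv (\<phi> m) x)) \<longlonglongrightarrow> (LINT x|lborel. u x * complex_of_real (hermite_deriv \<beta> n x))"
    unfolding \<phi>_deriv
  proof (rule integral_dominated_convergence)
    show "integrable lborel (\<lambda>x. exp 1 * (cmod (u x) * cmod (complex_of_real (hermite_deriv \<beta> n x))) + 4 * exp 1 * (cmod (u x) * cmod (hermite \<beta> n x)))"
      by (intro Bochner_Integration.integrable_add integrable_mult_right in_L2_integrable_norm_mult u hd in_L2_hermite \<beta>)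
    show "AE x in lborel. (\<lambda>m. u x * complex_of_real (hermite_deriv \<beta> n x * \<eta> m x + \<eta>' m x * hermite_fun \<beta> n x)) \<longlonglongrightarrow> u x * complex_of_real (hermite_deriv \<beta> n x)"
    proof (rule AE_I2)
      fix x
      have "(\<lambda>m. u x * complex_of_real (hermite_deriv \<beta> n x * \<eta> m x + \<eta>' m x * hermite_fun \<beta> n x)) \<longlonglongrightarrow> u x * complex_of_real (hermite_deriv \<beta> n x * 1 + 0 * hermite_fun \<beta> n x)"
        by (intro tendsto_intros \<eta>_lim \<eta>'_lim)
      then show "(\<lambda>m. u x * complex_of_real (hermite_deriv \<beta> n x * \<eta> m x + \<eta>' m x * hermite_fun \<beta> n x)) \<longlonglongrightarrow> u x * complex_of_real (hermite_deriv \<beta> n x)" by simp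
    qed
    show "AE x in lborel. norm (u x * complex_of_real (hermite_deriv \<beta> n x * \<eta> m x + \<eta>' m x * hermite_fun \<beta> n x)) \<le> 
      exp 1 * (cmod (u x) * cmod (complex_of_real (hermite_deriv \<beta> n x))) + 4 * exp 1 * (cmod (u x) * cmod (hermite \<beta> n x))" for m
    proof (rule AE_I2)
      fix x
      have "\<bar>hermite_deriv \<beta> n x * \<eta> m x + \<eta>' m x * hermite_fun \<beta> n x\<bar> \<le> \<bar>hermite_deriv \<beta> n x\<bar> * exp 1 + 4 * exp 1 * \<bar>hermite_fun \<beta> n x\<bar>"
        by (rule order_trans[OF abs_triangle_ineq]) (unfold abs_mult, intro add_mono mult_mono \<eta>_bound \<eta>'_bound, auto)
      then have "cmod (u x) * \<bar>hermite_deriv \<beta> n x * \<eta> m x + \<eta>' m x * hermite_fun \<beta> n x\<bar> \<le> cmod (u x) * (\<bar>hermite_deriv \<beta> n x\<bar> * exp 1 + 4 * exp 1 * \<bar>hermite_fun \<beta> n x\<bar>)"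
        by (rule mult_left_mono) simp
      then show "norm (u x * complex_of_real (hermite_deriv \<beta> n x * \<eta> m x + \<eta>' m x * hermite_fun \<beta> n x)) \<le> 
        exp 1 * (cmod (u x) * cmod (complex_of_real (hermite_deriv \<beta> n x))) + 4 * exp 1 * (cmod (u x) * cmod (hermite \<beta> n x))"
        unfolding norm_mult norm_of_real by (simp add: algebra_simps)
    qed
  qed measurable
  have lim2: "(\<lambda>m. LINT x|lborel. u1 x * complex_of_real (\<phi> m x)) \<longlonglongrightarrow> (LINT x|lborel. u1 x * hermite \<beta> n x)"
    unfolding \<phi>_def
  proof (rule integral_dominated_convergence)
    show "integrable lborel (\<lambda>x. exp 1 * (cmod (u1 x) * cmod (hermite \<beta> n x)))"
      by (intro integrable_mult_right in_L2_integrable_norm_mult u1 in_L2_hermite \<beta>)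
    show "AE x in lborel. (\<lambda>m. u1 x * complex_of_real (hermite_fun \<beta> n x * \<eta> m x)) \<longlonglongrightarrow> u1 x * hermite \<beta> n x"
    proof (rule AE_I2)
      fix x
      have "(\<lambda>m. u1 x * complex_of_real (hermite_fun \<beta> n x * \<eta> m x)) \<longlonglongrightarrow> u1 x * complex_of_real (hermite_fun \<beta> n x * 1)"
        by (intro tendsto_intros \<eta>_lim)
      then show "(\<lambda>m. u1 x * complex_of_real (hermite_fun \<beta> n x * \<eta> m x)) \<longlonglongrightarrow> u1 x * hermite \<beta> n x" by simp
    qed
    show "AE x in lborel. norm (u1 x * complex_of_real (hermite_fun \<beta> n x * \<eta> m x)) \<le> exp 1 * (cmod (u1 x) * cmod (hermite \<beta> n x))" for m
    proof (rule AE_I2)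
      fix x
      have "\<bar>hermite_fun \<beta> n x\<bar> * \<bar>\<eta> m x\<bar> \<le> \<bar>hermite_fun \<beta> n x\<bar> * exp 1"
        by (intro mult_left_mono \<eta>_bound) auto
      then have "cmod (u1 x) * (\<bar>hermite_fun \<beta> n x\<bar> * \<bar>\<eta> m x\<bar>) \<le> cmod (u1 x) * (\<bar>hermite_fun \<beta> n x\<bar> * exp 1)"
        by (rule mult_left_mono) simp
      then show "norm (u1 x * complex_of_real (hermite_fun \<beta> n x * \<eta> m x)) \<le> exp 1 * (cmod (u1 x) * cmod (hermite \<beta> n x))"
        unfolding norm_mult norm_of_real abs_mult by (simp only: mult_ac)
    qed
  qed measurable
  have "(LINT x|lborel. u x * complex_of_real (deriv (\<phi> m) x)) = - (LINT x|lborel. u1 x * complex_of_real (\<phi> m x))" for m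
    using w test by (simp add: weak_deriv_def)
  then have "(LINT x|lborel. u x * complex_of_real (hermite_deriv \<beta> n x)) = - (LINT x|lborel. u1 x * hermite \<beta> n x)"
    using lim1 tendsto_minus[OF lim2] by (simp add: LIMSEQ_unique)
  then have "L2inner u1 (hermite \<beta> n) = - (LINT x|lborel. u x * complex_of_real (hermite_deriv \<beta> n x))"
    by (simp add: L2inner_def)
  also have "(LINT x|lborel. u x * complex_of_real (hermite_deriv \<beta> n x)) = ladder \<beta> (\<lambda>n. L2inner u (hermite \<beta> n)) n"
  proof -
    have "(LINT x|lborel. u x * complex_of_real (hermite_deriv \<beta> n x)) = 
      (LINT x|lborel. complex_of_real \<beta> * (complex_of_real (sqrt (real n / 2)) * (u x * cnj (hermite \<beta> (n - 1) x))
        - complex_of_real (sqrt (real (Suc n) / 2)) * (u x * cnj (hermite \<beta> (Suc n) x))))"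
      by (intro Bochner_Integration.integral_cong refl) (simp add: hermite_deriv_def algebra_simps)
    also have "\<dots> = ladder \<beta> (\<lambda>n. L2inner u (hermite \<beta> n)) n"
      unfolding ladder_def L2inner_def integral_mult_right_zero
      by (subst Bochner_Integration.integral_diff) 
         (intro integrable_mult_right in_L2_integrable_inner u in_L2_hermite \<beta> | simp only: integral_mult_right_zero)+
    finally show ?thesis .
  qed
  finally show ?thesis .
qed

subsection \<open>Projection errors\<close>

lemma hermite_vector_derivative:
  "(hermite \<beta> n has_vector_derivative ladder \<beta> (\<lambda>n. hermite \<beta> n x) n) (at x)"
  unfolding ladder_hermite hermite_deriv_def
  by (intro has_vector_derivative_of_real hermite_fun_deriv)

lemma ladder_has_vector_derivative:
  assumes "\<And>n. ((\<lambda>x. h n x) has_vector_derivative h' n) (at x)"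
  shows "((\<lambda>x. ladder \<beta> (\<lambda>n. h n x) n) has_vector_derivative ladder \<beta> h' n) (at x)"
  unfolding ladder_def
  by (intro has_vector_derivative_mult_right has_vector_derivative_diff assms)

text \<open>Summation by parts: the ladder is skew-symmetric, so all products of neighbours cancel
  except the link between N and N + 1 cut by the truncation. Arbitrary sequences are allowed because
  the identity is also applied with c or h replaced by its own ladder.\<close>

lemma ladder_sum:
  "(\<Sum>n\<le>N. c n * ladder \<beta> h n + ladder \<beta> c n * h n) =
     - (complex_of_real (\<beta> * sqrt (real (Suc N) / 2)) * (c N * h (Suc N) + c (Suc N) * h N))"
proof (induction N)
  case 0
  show ?case by (simp add: ladder_def algebra_simps)
next
  case (Suc N)
  show ?case unfolding sum.atMost_Suc Suc by (simp add: ladder_def algebra_simps)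
qed

lemma norm_ladder_le:
  assumes "\<beta> \<ge> 0" "cmod (h (n - 1)) \<le> b" "cmod (h (Suc n)) \<le> b"
  shows "cmod (ladder \<beta> h n) \<le> 2 * \<beta> * sqrt (real (Suc n) / 2) * b"
proof -
  have b: "b \<ge> 0" using assms(2) norm_ge_zero order_trans by blast
  have "cmod (ladder \<beta> h n) \<le> \<beta> * (sqrt (real n / 2) * cmod (h (n - 1)) + sqrt (real (Suc n) / 2) * cmod (h (Suc n)))"
    unfolding ladder_def norm_mult norm_of_real using assms(1)
    by (intro mult_mono order_trans[OF norm_triangle_ineq4]) (auto simp: norm_mult)
  also have "\<dots> \<le> \<beta> * (sqrt (real (Suc n) / 2) * b + sqrt (real (Suc n) / 2) * b)"
    using assms b by (intro mult_left_mono add_mono mult_mono) auto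
  finally show ?thesis by (simp add: algebra_simps)
qed

lemma L2norm_ladder_hermite_le:
  assumes \<beta>: "\<beta> > 0"
  shows "L2norm (\<lambda>x. ladder \<beta> (\<lambda>n. hermite \<beta> n x) n) \<le> 2 * \<beta> * sqrt (real (Suc n) / 2)"
proof -
  note h = in_L2_hermite[OF \<beta>]
  have "L2norm (\<lambda>x. ladder \<beta> (\<lambda>n. hermite \<beta> n x) n) = \<beta> *
    L2norm (\<lambda>x. complex_of_real (sqrt (real n / 2)) * hermite \<beta> (n - 1) x - complex_of_real (sqrt (real (Suc n) / 2)) * hermite \<beta> (Suc n) x)"
    unfolding ladder_def L2norm_cmult using \<beta> by simp
  also have "\<dots> \<le> \<beta> * (sqrt (real n / 2) * 1 + sqrt (real (Suc n) / 2) * 1)"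
    using L2norm_diff_triangle[OF in_L2_cmult[OF h[of "n - 1"], where c = "complex_of_real (sqrt (real n / 2))"]
        in_L2_cmult[OF h[of "Suc n"], where c = "complex_of_real (sqrt (real (Suc n) / 2))"]] \<beta>
    unfolding L2norm_cmult L2norm_hermite[OF \<beta>] norm_of_real by (intro mult_left_mono) auto
  also have "\<dots> \<le> \<beta> * (sqrt (real (Suc n) / 2) * 1 + sqrt (real (Suc n) / 2) * 1)"
    using \<beta> by (intro mult_left_mono add_mono mult_right_mono) auto
  finally show ?thesis by (simp add: algebra_simps)
qed

lemma L2norm_combination_le:
  assumes "in_L2 f" "in_L2 g" "cmod a \<le> A" "cmod b \<le> B" "L2norm f \<le> p" "L2norm g \<le> q"
  shows "L2norm (\<lambda>x. a * f x + b * g x) \<le> A * p + B * q"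
proof -
  have A: "A \<ge> 0" "B \<ge> 0" using assms(3,4) norm_ge_zero order_trans by blast+
  have "L2norm (\<lambda>x. a * f x + b * g x) \<le> cmod a * L2norm f + cmod b * L2norm g"
    using L2norm_triangle[OF in_L2_cmult[OF assms(1)] in_L2_cmult[OF assms(2)]] by (simp add: L2norm_cmult)
  also have "\<dots> \<le> A * p + B * q" using assms A by (intro add_mono mult_mono) auto
  finally show ?thesis .
qed

context
  fixes \<beta> :: real and N :: nat
  assumes \<beta>: "\<beta> > 0" and N: "N \<ge> 1"
begin

text \<open>The error v is orthogonal to the projection, so its squared norm is the inner product of
  u with v. The duality bound is linear in the norm of v, and one factor cancels.\<close>

lemma proj_error:
  assumes u: "in_L2 u"
  shows "in_L2 (\<lambda>x. u x - proj \<beta> N u x)" "L2norm (\<lambda>x. u x - proj \<beta> N u x) \<le> 12 * E_N \<beta> N u"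
proof -
  define w where "w = (\<lambda>x. \<Sum>n\<le>N. L2inner u (hermite \<beta> n) * hermite \<beta> n x)"
  have p: "proj \<beta> N u = w" unfolding w_def by (rule proj_eq_hermite_sum[OF \<beta> u])
  have w: "in_L2 w" unfolding w_def by (rule in_L2_hermite_sum[OF \<beta>])
  define v where "v = (\<lambda>x. u x - w x)"
  have v: "in_L2 v" unfolding v_def by (rule in_L2_diff[OF u w])
  have orth: "L2inner v (hermite \<beta> n) = 0" if "n \<le> N" for n
    using that L2inner_hermite_sum[OF \<beta>, where N = N and c = "\<lambda>n. L2inner u (hermite \<beta> n)" and m = n]
    unfolding v_def L2inner_diff_left[OF u w in_L2_hermite[OF \<beta>]] by (simp add: w_def)
  have "L2inner v w = 0"
    unfolding w_def by (subst L2inner_sum_right) (auto intro!: in_L2_hermite \<beta> v simp: orth)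
  then have "L2inner w v = 0" using L2inner_cnj[of v w] by simp
  then have "L2inner v v = L2inner u v"
    using L2inner_diff_left[OF u w v] by (simp add: v_def)
  then have "(L2norm v)\<^sup>2 = cmod (L2inner u v)"
    unfolding L2inner_self by (metis abs_of_nonneg norm_of_real zero_le_power2)
  also have "\<dots> \<le> 12 * E_N \<beta> N u * L2norm v"
    by (rule inner_bound_E_N[OF \<beta> N u v]) (use orth in auto)
  finally have "L2norm v * L2norm v \<le> 12 * E_N \<beta> N u * L2norm v" by (simp add: power2_eq_square)
  then have "L2norm v \<le> 12 * E_N \<beta> N u"
    using E_N_nonneg[OF u, of \<beta> N] L2norm_nonneg[of v] by (cases "L2norm v = 0") auto
  then show "in_L2 (\<lambda>x. u x - proj \<beta> N u x)" "L2norm (\<lambda>x. u x - proj \<beta> N u x) \<le> 12 * E_N \<beta> N u"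
    using v unfolding p v_def by auto
qed

text \<open>A single Hermite function is admissible in the duality bound exactly when its index is
  at least N - 1.\<close>

lemma hermite_coeff_bound:
  assumes u: "in_L2 u" and n: "N - 1 \<le> n"
  shows "cmod (L2inner u (hermite \<beta> n)) \<le> 12 * E_N \<beta> N u"
  using inner_bound_E_N[OF \<beta> N u in_L2_hermite[OF \<beta>, of n]] n
  by (simp add: hermite_orthonormal[OF \<beta>] L2norm_hermite[OF \<beta>])

text \<open>The derivative of the projection and the projection of the derivative differ by the
  boundary term of \<open>ladder_sum\<close>, built from the modes N and N + 1 and the coefficients
  of u there.\<close>

lemma proj_deriv_error:
  assumes u: "in_L2 u" and u1: "in_L2 u1" and w: "weak_deriv u u1"
  shows "L2norm (\<lambda>x. u1 x - vector_derivative (proj \<beta> N u) (at x))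
          \<le> 12 * E_N \<beta> N u1 + 24 * (\<beta> * sqrt (real N) * E_N \<beta> N u)"
proof -
  define c where "c = (\<lambda>n. L2inner u (hermite \<beta> n))"
  define E where "E = 12 * E_N \<beta> N u"
  have E: "E \<ge> 0" using E_N_nonneg[OF u] by (simp add: E_def)
  define s where "s = \<beta> * sqrt (real (Suc N) / 2)"
  \<comment> \<open>Here (N + 1)/2 <= N, by N >= 1.\<close>
  have s: "s \<ge> 0" "s \<le> \<beta> * sqrt (real N)" using \<beta> N by (auto simp: s_def)
  define r where "r = (\<lambda>x. c N * hermite \<beta> (Suc N) x + c (Suc N) * hermite \<beta> N x)"
  have r: "in_L2 r" unfolding r_def by (intro in_L2_add in_L2_cmult in_L2_hermite \<beta>)
  have nr: "L2norm r \<le> E * 1 + E * 1"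
    unfolding r_def c_def E_def
    by (intro L2norm_combination_le in_L2_hermite \<beta> hermite_coeff_bound u) (auto simp: L2norm_hermite[OF \<beta>])
  have d: "vector_derivative (proj \<beta> N u) (at x) = (\<Sum>n\<le>N. c n * ladder \<beta> (\<lambda>n. hermite \<beta> n x) n)" for x
    unfolding proj_eq_hermite_sum[OF \<beta> u] c_def
    by (intro vector_derivative_at has_vector_derivative_sum has_vector_derivative_mult_right hermite_vector_derivative)
  have p1: "proj \<beta> N u1 x = - (\<Sum>n\<le>N. ladder \<beta> c n * hermite \<beta> n x)" for x
    unfolding proj_eq_hermite_sum[OF \<beta> u1] weak_deriv_hermite_inner[OF \<beta> u u1 w] c_def
    by (simp add: sum_negf)
  have diff: "vector_derivative (proj \<beta> N u) (at x) = proj \<beta> N u1 x - complex_of_real s * r x" for x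
    using ladder_sum[of c \<beta> "\<lambda>n. hermite \<beta> n x" N] unfolding d p1 sum.distrib
    by (simp add: s_def r_def algebra_simps eq_neg_iff_add_eq_0)
  have "L2norm (\<lambda>x. u1 x - vector_derivative (proj \<beta> N u) (at x)) = 
    L2norm (\<lambda>x. (u1 x - proj \<beta> N u1 x) + complex_of_real s * r x)"
    unfolding diff by (simp add: algebra_simps)
  also have "\<dots> \<le> L2norm (\<lambda>x. u1 x - proj \<beta> N u1 x) + s * L2norm r"
    using L2norm_triangle[OF proj_error(1)[OF u1] in_L2_cmult[OF r, where c = "complex_of_real s"]] s unfolding L2norm_cmult by simp
  also have "\<dots> \<le> 12 * E_N \<beta> N u1 + \<beta> * sqrt (real N) * (E * 1 + E * 1)"
    using s E \<beta> by (intro add_mono proj_error(2) u1 mult_mono nr) auto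
  finally show ?thesis by (simp add: E_def algebra_simps)
qed

text \<open>The ladder is moved from functions to coefficients one step at a time, and each move
  leaves a boundary term. The second contains the ladder of the coefficients at N and N + 1, hence
  the coefficients of u from N - 1 to N + 2.\<close>

lemma proj_deriv2_error:
  assumes u: "in_L2 u" and u1: "in_L2 u1" and u2: "in_L2 u2" and w: "weak_deriv u u1" and w1: "weak_deriv u1 u2"
  shows "L2norm (\<lambda>x. u2 x - vector_derivative (\<lambda>y. vector_derivative (proj \<beta> N u) (at y)) (at x))
          \<le> 12 * E_N \<beta> N u2 + 144 * (\<beta>\<^sup>2 * real N * E_N \<beta> N u)"
proof -
  define c where "c = (\<lambda>n. L2inner u (hermite \<beta> n))"
  define E where "E = 12 * E_N \<beta> N u"
  have E: "E \<ge> 0" using E_N_nonneg[OF u] by (simp add: E_def)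
  define s where "s = \<beta> * sqrt (real (Suc N) / 2)"
  \<comment> \<open>Norm bound for a ladder step at the indices N and N + 1; the root belongs to the
    larger one.\<close>
  define t where "t = 2 * \<beta> * sqrt (real (Suc (Suc N)) / 2)"
  have s: "s \<ge> 0" and t: "t \<ge> 0" using \<beta> by (auto simp: s_def t_def)
  define h where "h = (\<lambda>x n. hermite \<beta> n x)"
  have cE: "cmod (c n) \<le> E" if "N - 1 \<le> n" for n
    unfolding c_def E_def by (rule hermite_coeff_bound[OF u that])
  have Dc: "cmod (ladder \<beta> c n) \<le> t * E" if n: "n = N \<or> n = Suc N" for n
  proof -
    have "cmod (ladder \<beta> c n) \<le> 2 * \<beta> * sqrt (real (Suc n) / 2) * E"
      by (rule norm_ladder_le) (use n \<beta> in \<open>auto intro!: cE\<close>)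
    also have "\<dots> \<le> t * E" unfolding t_def using n \<beta> E by (intro mult_right_mono mult_left_mono) auto
    finally show ?thesis .
  qed
  have Dh: "L2norm (\<lambda>x. ladder \<beta> (h x) n) \<le> t" if n: "n = N \<or> n = Suc N" for n
  proof -
    have "L2norm (\<lambda>x. ladder \<beta> (h x) n) \<le> 2 * \<beta> * sqrt (real (Suc n) / 2)"
      unfolding h_def by (rule L2norm_ladder_hermite_le[OF \<beta>])
    also have "\<dots> \<le> t" unfolding t_def using n \<beta> by (intro mult_left_mono) auto
    finally show ?thesis .
  qed
  have hL: "in_L2 (\<lambda>x. h x n)" and DhL: "in_L2 (\<lambda>x. ladder \<beta> (h x) n)" for n
    unfolding h_def using in_L2_hermite[OF \<beta>] by (auto intro: in_L2_ladder)
  define r1 r2 where "r1 = (\<lambda>x. c N * ladder \<beta> (h x) (Suc N) + c (Suc N) * ladder \<beta> (h x) N)"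
    and "r2 = (\<lambda>x. ladder \<beta> c N * h x (Suc N) + ladder \<beta> c (Suc N) * h x N)"
  have rL: "in_L2 r1" "in_L2 r2"
    unfolding r1_def r2_def by (intro in_L2_add in_L2_cmult hL DhL)+
  have nr1: "L2norm r1 \<le> E * t + E * t"
    unfolding r1_def by (intro L2norm_combination_le DhL cE Dh) auto
  have nr2: "L2norm r2 \<le> (t * E) * 1 + (t * E) * 1"
    unfolding r2_def by (intro L2norm_combination_le hL Dc) (auto simp: h_def L2norm_hermite[OF \<beta>])
  have nr: "L2norm (\<lambda>x. r1 x - r2 x) \<le> 4 * (t * E)"
    using L2norm_diff_triangle[OF rL] nr1 nr2 unfolding mult.commute[of E t] by linarith
  have d1: "vector_derivative (proj \<beta> N u) (at x) = (\<Sum>n\<le>N. c n * ladder \<beta> (h x) n)" for x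
    unfolding proj_eq_hermite_sum[OF \<beta> u] c_def h_def
    by (intro vector_derivative_at has_vector_derivative_sum has_vector_derivative_mult_right hermite_vector_derivative)
  have d2: "vector_derivative (\<lambda>y. vector_derivative (proj \<beta> N u) (at y)) (at x) = 
     (\<Sum>n\<le>N. c n * ladder \<beta> (ladder \<beta> (h x)) n)" for x
    unfolding d1
    by (intro vector_derivative_at has_vector_derivative_sum has_vector_derivative_mult_right 
        ladder_has_vector_derivative) (simp add: h_def hermite_vector_derivative)
  have inner1: "(\<lambda>n. L2inner u1 (hermite \<beta> n)) = (\<lambda>n. - ladder \<beta> c n)"
    unfolding weak_deriv_hermite_inner[OF \<beta> u u1 w] c_def ..
  have neg: "ladder \<beta> (\<lambda>n. - f n) n = - ladder \<beta> f n" for f n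
    by (simp add: ladder_def algebra_simps)
  have p2: "proj \<beta> N u2 x = (\<Sum>n\<le>N. ladder \<beta> (ladder \<beta> c) n * h x n)" for x
    unfolding proj_eq_hermite_sum[OF \<beta> u2] weak_deriv_hermite_inner[OF \<beta> u1 u2 w1] inner1 neg h_def by simp
  have diff: "vector_derivative (\<lambda>y. vector_derivative (proj \<beta> N u) (at y)) (at x) = 
      proj \<beta> N u2 x - complex_of_real s * (r1 x - r2 x)" for x
  proof -
    have "(\<Sum>n\<le>N. c n * ladder \<beta> (ladder \<beta> (h x)) n) + (\<Sum>n\<le>N. ladder \<beta> c n * ladder \<beta> (h x) n) = - (complex_of_real s * r1 x)"
      using ladder_sum[of c \<beta> "ladder \<beta> (h x)" N] unfolding sum.distrib s_def r1_def .
    moreover have "(\<Sum>n\<le>N. ladder \<beta> c n * ladder \<beta> (h x) n) + (\<Sum>n\<le>N. ladder \<beta> (ladder \<beta> c) n * h x n) = - (complex_of_real s * r2 x)"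
      using ladder_sum[of "ladder \<beta> c" \<beta> "h x" N] unfolding sum.distrib s_def r2_def .
    \<comment> \<open>Subtracting the two summations by parts eliminates the mixed sum b, in which
      both sequences carry one ladder.\<close>
    moreover have "a = d - s * (r - r')" if "a + b = - (s * r)" "b + d = - (s * r')" for a b d s r r' :: complex
    proof -
      have "a = (a + b) - (b + d) + d" by simp
      then show ?thesis unfolding that by (simp add: algebra_simps)
    qed
    ultimately show ?thesis unfolding d2 p2 by blast
  qed
  have "L2norm (\<lambda>x. u2 x - vector_derivative (\<lambda>y. vector_derivative (proj \<beta> N u) (at y)) (at x)) = 
    L2norm (\<lambda>x. (u2 x - proj \<beta> N u2 x) + complex_of_real s * (r1 x - r2 x))"
    unfolding diff by (simp add: algebra_simps)
  also have "\<dots> \<le> L2norm (\<lambda>x. u2 x - proj \<beta> N u2 x) + s * L2norm (\<lambda>x. r1 x - r2 x)"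
    using L2norm_triangle[OF proj_error(1)[OF u2] in_L2_cmult[OF in_L2_diff[OF rL], where c = "complex_of_real s"]] s unfolding L2norm_cmult by simp
  also have "\<dots> \<le> 12 * E_N \<beta> N u2 + s * (4 * (t * E))"
    using nr s by (intro add_mono proj_error(2) u2 mult_left_mono) auto
  \<comment> \<open>The product s t is at most \<beta>^2 (N + 2) <= 3 \<beta>^2 N for N >= 1, so the
    four boundary contributions give 12; with the 12 inside E this is the constant 144.\<close>
  also have "s * (4 * (t * E)) \<le> 12 * \<beta>\<^sup>2 * real N * E"
  proof -
    have "sqrt (real (Suc N) / 2) * sqrt (real (Suc (Suc N)) / 2) \<le> sqrt (real (Suc (Suc N)) / 2) * sqrt (real (Suc (Suc N)) / 2)"
      by (intro mult_right_mono) auto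
    also have "\<dots> = real (Suc (Suc N)) / 2" by simp
    also have "\<dots> \<le> 3 * real N / 2" using N by simp
    finally have "8 * \<beta>\<^sup>2 * E * (sqrt (real (Suc N) / 2) * sqrt (real (Suc (Suc N)) / 2)) \<le> 8 * \<beta>\<^sup>2 * E * (3 * real N / 2)"
      using E by (intro mult_left_mono) auto
    then show ?thesis unfolding s_def t_def by (simp add: power2_eq_square mult_ac)
  qed
  finally show ?thesis by (simp add: E_def algebra_simps)
qed

end

theorem theorem3p4:
  shows "\<exists>C>0. \<forall>N::nat. \<forall>\<beta>::real. N \<ge> 1 \<longrightarrow> \<beta> > 0 \<longrightarrow>
    (\<forall>u. in_L2 u \<longrightarrow>
        L2norm (\<lambda>x. u x - proj \<beta> N u x) \<le> C * E_N \<beta> N u) \<and>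
    (\<forall>u u1. in_L2 u \<longrightarrow> in_L2 u1 \<longrightarrow> weak_deriv u u1 \<longrightarrow>
        L2norm (\<lambda>x. u1 x - vector_derivative (proj \<beta> N u) (at x))
          \<le> C * (E_N \<beta> N u1 + \<beta> * sqrt (real N) * E_N \<beta> N u)) \<and>
    (\<forall>u u1 u2. in_L2 u \<longrightarrow> in_L2 u1 \<longrightarrow> in_L2 u2 \<longrightarrow>
        weak_deriv u u1 \<longrightarrow> weak_deriv u1 u2 \<longrightarrow>
        L2norm (\<lambda>x. u2 x - vector_derivative (\<lambda>y. vector_derivative (proj \<beta> N u) (at y)) (at x))
          \<le> C * (E_N \<beta> N u2 + \<beta> * E_N \<beta> N u1 + \<beta>^2 * real N * E_N \<beta> N u))"
\<comment> \<open>The second derivative sets the constant; the other two estimates come with 12 and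
  24.\<close>
proof (intro exI[of _ 144] conjI allI impI)
  fix N :: nat and \<beta> :: real and u u1 u2 :: "real \<Rightarrow> complex"
  assume N: "N \<ge> 1" and \<beta>: "\<beta> > 0" and u: "in_L2 u"
  have nn: "E_N \<beta> N v \<ge> 0" if "in_L2 v" for v using E_N_nonneg[OF that] .
  show "L2norm (\<lambda>x. u x - proj \<beta> N u x) \<le> 144 * E_N \<beta> N u"
    using proj_error(2)[OF \<beta> N u] nn[OF u] by linarith
  assume u1: "in_L2 u1" and w: "weak_deriv u u1"
  have "0 \<le> \<beta> * sqrt (real N) * E_N \<beta> N u" using \<beta> nn[OF u] by simp
  then show "L2norm (\<lambda>x. u1 x - vector_derivative (proj \<beta> N u) (at x))
          \<le> 144 * (E_N \<beta> N u1 + \<beta> * sqrt (real N) * E_N \<beta> N u)"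
    using proj_deriv_error[OF \<beta> N u u1 w] nn[OF u1] unfolding distrib_left by linarith
next
  fix N :: nat and \<beta> :: real and u u1 u2 :: "real \<Rightarrow> complex"
  assume N: "N \<ge> 1" and \<beta>: "\<beta> > 0" and u: "in_L2 u" and u1: "in_L2 u1" and u2: "in_L2 u2"
    and w: "weak_deriv u u1" and w1: "weak_deriv u1 u2"
  have "0 \<le> \<beta> * E_N \<beta> N u1" using \<beta> E_N_nonneg[OF u1] by simp
  then show "L2norm (\<lambda>x. u2 x - vector_derivative (\<lambda>y. vector_derivative (proj \<beta> N u) (at y)) (at x))
          \<le> 144 * (E_N \<beta> N u2 + \<beta> * E_N \<beta> N u1 + \<beta>^2 * real N * E_N \<beta> N u)"
    using proj_deriv2_error[OF \<beta> N u u1 u2 w w1] E_N_nonneg[OF u2, of \<beta> N] unfolding distrib_left by linarith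
qed simp

end
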